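(* The $D$-functions $\mathcal{D}^{\,j}_{m',m}$ of the Jordanian quantum group $SL_h(2)$ (with generators $x,u,v,y$) satisfy the following recurrence relations, for $j\ge\frac12$ in (i)-(iv), $j\ge 0$ in (v)-(viii), and indices $k,m,n\in\{-j,\dots,j\}$: (i) $\sqrt{j+k}\,\mathcal{D}^{\,j}_{k,m}-(2k-1)h\sqrt{j-k+1}\,\mathcal{D}^{\,j}_{k-1,m}=\sqrt{j+m}\,\mathcal{D}^{\,j-\frac12}_{k-\frac12,m-\frac12}\,x+\sqrt{j-m}\,\mathcal{D}^{\,j-\frac12}_{k-\frac12,m+\frac12}\,(u-(2m+1)hx)$; (ii) $\sqrt{j-k}\,\mathcal{D}^{\,j}_{k,m}=\sqrt{j+m}\,\mathcal{D}^{\,j-\frac12}_{k+\frac12,m-\frac12}\,v+\sqrt{j-m}\,\mathcal{D}^{\,j-\frac12}_{k+\frac12,m+\frac12}\,(y-(2m+1)hv)$; (iii) $\sqrt{j+n}\,\mathcal{D}^{\,j}_{m,n}=\sqrt{j+m}\,\mathcal{D}^{\,j-\frac12}_{m-\frac12,n-\frac12}\,(x+(2m-1)hv)+\sqrt{j-m}\,\mathcal{D}^{\,j-\frac12}_{m+\frac12,n-\frac12}\,v$; (iv) $\sqrt{j-n}\,\mathcal{D}^{\,j}_{m,n}+\sqrt{j+n+1}\,(2n+1)h\,\mathcal{D}^{\,j}_{m,n+1}=\sqrt{j+m}\,\mathcal{D}^{\,j-\frac12}_{m-\frac12,n+\frac12}\,(u+(2m-1)hy)+\sqrt{j-m}\,\mathcal{D}^{\,j-\frac12}_{m+\frac12,n+\frac12}\,y$;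 (v) $\sqrt{j-k+1}\,\mathcal{D}^{\,j}_{k,m}+(2k-1)h\sqrt{j+k}\,\mathcal{D}^{\,j}_{k-1,m}=\sqrt{j-m+1}\,\mathcal{D}^{\,j+\frac12}_{k-\frac12,m-\frac12}\,x-\sqrt{j+m+1}\,\mathcal{D}^{\,j+\frac12}_{k-\frac12,m+\frac12}\,(u-(2m+1)hx)$; (vi) $\sqrt{j+k+1}\,\mathcal{D}^{\,j}_{k,m}=-\sqrt{j-m+1}\,\mathcal{D}^{\,j+\frac12}_{k+\frac12,m-\frac12}\,v+\sqrt{j+m+1}\,\mathcal{D}^{\,j+\frac12}_{k+\frac12,m+\frac12}\,(y-(2m+1)hv)$; (vii) $\sqrt{j-n+1}\,\mathcal{D}^{\,j}_{m,n}=\sqrt{j-m+1}\,\mathcal{D}^{\,j+\frac12}_{m-\frac12,n-\frac12}\,(x+(2m-1)hv)-\sqrt{j+m+1}\,\mathcal{D}^{\,j+\frac12}_{m+\frac12,n-\frac12}\,v$; (viii) $\sqrt{j+n+1}\,\mathcal{D}^{\,j}_{m,n}-\sqrt{j-n}\,(2n+1)h\,\mathcal{D}^{\,j}_{m,n+1}=-\sqrt{j-m+1}\,\mathcal{D}^{\,j+\frac12}_{m-\frac12,n+\frac12}\,(u+(2m-1)hy)+\sqrt{j+m+1}\,\mathcal{D}^{\,j+\frac12}_{m+\frac12,n+\frac12}\,y$. Here $\mathcal{D}^{\,j}_{m',m}$ is read as $0$ when an index lies outside $\{-j,\dots,j\}$.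
   Context: $SL_h(2)$: the Hopf algebra generated by $x,y,u,v$ with relations $[v,x]=hv^2$, $[u,x]=h(D-x^2)$, $[v,y]=hv^2$, $[u,y]=h(D-y^2)$, $[x,y]=h(xv-yv)$, $[v,u]=h(xv+vy)$, where $D=xy-uv-hxv$ is central, together with $D=1$. Its coproduct and counit are those of the matrix $\begin{pmatrix} x & u \\ v & y \end{pmatrix}$ (matrix coproduct; $\epsilon(x)=\epsilon(y)=1$, $\epsilon(u)=\epsilon(v)=0$). $h$ is the deformation parameter, and expressions such as logarithms are understood as power series in $h$. Dual algebra $\mathcal{U}_h(sl(2))$: generated by $J_0,J_\pm$ with $[J_0,J_\pm]=\pm2J_\pm$, $[J_+,J_-]=J_0$, and coproduct $\Delta=\mathcal{F}\Delta_0\mathcal{F}^{-1}$, where $\Delta_0(X)=X\otimes1+1\otimes X$ for $X\in sl(2)$, $\mathcal{F}=\exp(-\frac12J_0\otimes\sigma)$, $\sigma=-\ln(1-2hJ_+)$. Its spin-$j$ representation ($j\in\{0,\frac12,1,\dots\}$) has orthonormal basis $|jm\rangle$, $m=-j,\dots,j$, with $J_0|jm\rangle=2m|jm\rangle$, $J_\pm|jm\rangle=\sqrt{(j\mp m)(j\pm m+1)}\,|j\,m\pm1\rangle$. $D$-functions: $\mathcal{D}^{\,j}_{m',m}=\sum_\alpha x^\alpha\langle jm'|X_\alpha|jm\rangle\in SL_h(2)$, where $\{x^\alpha\}$ and $\{X_\alpha\}$ are dual bases of $SL_h(2)$ and $\mathcal{U}_h(sl(2))$ (product of one dual to coproduct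 of the other); i.e. $\mathcal{D}^{\,j}_{m',m}$ is the matrix coefficient $X\mapsto\langle jm'|X|jm\rangle$. In particular, for spin $\frac12$, with rows and columns ordered $\frac12,-\frac12$, $\left(\mathcal{D}^{\,1/2}_{m',m}\right)=\begin{pmatrix} x & u \\ v & y \end{pmatrix}$. *)

theory Defs
  imports "HOL-Computational_Algebra.Formal_Power_Series" "HOL-Library.Poly_Mapping"
begin

unbundle fps_syntax

section \<open>Presented algebras\<close>

text \<open>The monoid algebra over \<open>'k\<close> of a monoid \<open>'m\<close> (written additively) is \<open>'m \<Rightarrow>\<^sub>0 'k\<close>; the
  free algebra on \<open>'g\<close> is the case \<open>'m = 'g word\<close>. The type \<open>word\<close> is a copy of \<open>list\<close>, so that
  lists themselves do not get an additive structure.\<close>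

datatype 'g word = Word (letters: "'g list")

instantiation word :: (type) monoid_add
begin
definition "0 = Word []"
definition "v + w = Word (letters v @ letters w)"
instance
  by standard (simp_all add: zero_word_def plus_word_def)
end

lemma letters_0 [simp]: "letters 0 = []"
  by (simp add: zero_word_def)

lemma letters_plus [simp]: "letters (v + w) = letters v @ letters w"
  by (simp add: plus_word_def)

inductive_set tsideal :: "'a::ring_1 set \<Rightarrow> 'a set" for S where
  zero: "0 \<in> tsideal S"
| step: "p \<in> tsideal S \<Longrightarrow> s \<in> S \<Longrightarrow> p + a * s * b \<in> tsideal S"

lemma tsideal_add: "q \<in> tsideal S \<Longrightarrow> p \<in> tsideal S \<Longrightarrow> p + q \<in> tsideal S"
proof (induction rule: tsideal.induct)
  case (step q s a b)
  then have "(p + q) + a * s * b \<in> tsideal S"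
    by (intro tsideal.step) auto
  then show ?case by (simp add: add.assoc)
qed simp

lemma tsideal_base: "s \<in> S \<Longrightarrow> s \<in> tsideal S"
  using tsideal.step[OF tsideal.zero, of s S 1 1] by simp

lemma tsideal_mult: "p \<in> tsideal S \<Longrightarrow> c * p * d \<in> tsideal S"
proof (induction rule: tsideal.induct)
  case (step q s a b)
  then have "c * q * d + (c * a) * s * (b * d) \<in> tsideal S"
    by (intro tsideal.step) auto
  then show ?case by (simp add: algebra_simps)
qed (simp add: tsideal.zero)

lemma tsideal_uminus: "p \<in> tsideal S \<Longrightarrow> - p \<in> tsideal S"
  using tsideal_mult[of p S "-1" 1] by simp

lemma tsideal_diff: "p \<in> tsideal S \<Longrightarrow> q \<in> tsideal S \<Longrightarrow> p - q \<in> tsideal S"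
  using tsideal_add[OF tsideal_uminus, of q S p] by simp

lemma tsideal_equivp: "equivp (\<lambda>p q. p - q \<in> tsideal S)"
proof (rule equivpI)
  show "reflp (\<lambda>p q. p - q \<in> tsideal S)"
    by (auto simp: reflp_def tsideal.zero)
  show "symp (\<lambda>p q. p - q \<in> tsideal S)"
    by (metis (mono_tags, lifting) minus_diff_eq sympI tsideal_uminus)
  show "transp (\<lambda>p q. p - q \<in> tsideal S)"
  proof (rule transpI)
    fix x y z assume "x - y \<in> tsideal S" "y - z \<in> tsideal S"
    from tsideal_add[OF this(2,1)] show "x - z \<in> tsideal S" by simp
  qed
qed

lemma tsideal_cong_add:
  assumes "p - p' \<in> tsideal S" "q - q' \<in> tsideal S"
  shows "(p + q) - (p' + q') \<in> tsideal S"
  using tsideal_add[OF assms(2,1)] by (simp add: algebra_simps)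

lemma tsideal_cong_minus:
  assumes "p - p' \<in> tsideal S" "q - q' \<in> tsideal S"
  shows "(p - q) - (p' - q') \<in> tsideal S"
  using tsideal_diff[OF assms] by (simp add: algebra_simps)

lemma tsideal_cong_uminus:
  assumes "p - p' \<in> tsideal S"
  shows "(- p) - (- p') \<in> tsideal S"
  using tsideal_uminus[OF assms] by (simp add: algebra_simps)

lemma tsideal_cong_mult:
  assumes "p - p' \<in> tsideal S" "q - q' \<in> tsideal S"
  shows "p * q - p' * q' \<in> tsideal S"
proof -
  have "1 * (p - p') * q + p' * (q - q') * 1 \<in> tsideal S"
    by (intro tsideal_add tsideal_mult assms)
  then show ?thesis by (simp add: algebra_simps)
qed

lemma tsideal_hom_zero:
  fixes f :: "'a::ring_1 \<Rightarrow> 'b::ring_1"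
  assumes "p \<in> tsideal S" and "\<And>p q. f (p + q) = f p + f q" and "\<And>p q. f (p * q) = f p * f q"
    and "\<And>s. s \<in> S \<Longrightarrow> f s = 0"
  shows "f p = 0"
  using assms(1)
proof induction
  case zero
  have "f 0 = f 0 + f 0" using assms(2)[of 0 0] by simp
  then show ?case by simp
qed (simp add: assms)

text \<open>Linear extension along \<open>sc\<close> of a map on basis elements.\<close>

definition linext :: "('k::zero \<Rightarrow> 'r) \<Rightarrow> ('m \<Rightarrow> 'r) \<Rightarrow> ('m \<Rightarrow>\<^sub>0 'k) \<Rightarrow> 'r::semiring_0" where
  "linext sc g p = (\<Sum>k\<in>Poly_Mapping.keys p. sc (Poly_Mapping.lookup p k) * g k)"

lemma linext_super:
  assumes "finite A" "Poly_Mapping.keys p \<subseteq> A" "sc 0 = 0"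
  shows "linext sc g p = (\<Sum>k\<in>A. sc (Poly_Mapping.lookup p k) * g k)"
  unfolding linext_def
  by (rule sum.mono_neutral_left) (use assms in \<open>auto simp: in_keys_iff\<close>)

lemma linext_0 [simp]: "linext sc g 0 = 0"
  by (simp add: linext_def)

lemma linext_single:
  assumes "sc 0 = 0"
  shows "linext sc g (Poly_Mapping.single k c) = sc c * g k"
  using linext_super[of "{k}" "Poly_Mapping.single k c" sc g] assms by simp

lemma linext_add:
  assumes "\<And>a b. sc (a + b) = sc a + sc b" "sc 0 = 0"
  shows "linext sc g (p + q) = linext sc g p + linext sc g q"
proof -
  let ?A = "Poly_Mapping.keys p \<union> Poly_Mapping.keys q"
  have "Poly_Mapping.keys (p + q) \<subseteq> ?A" by (rule keys_add)
  then show ?thesis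
    by (simp add: linext_super[of ?A] assms lookup_add distrib_right sum.distrib)
qed

lemma poly_mapping_single_induct [case_names zero single add]:
  assumes "P 0" "\<And>k c. P (Poly_Mapping.single k c)"
    "\<And>p q. P p \<Longrightarrow> P q \<Longrightarrow> P (p + q :: 'a \<Rightarrow>\<^sub>0 'b::comm_monoid_add)"
  shows "P p"
proof (induction p rule: update_induct)
  case (update f a b)
  have "Poly_Mapping.update a b f = f + Poly_Mapping.single a b"
    using update(1) by (intro poly_mapping_eqI)
      (auto simp: lookup_update lookup_add lookup_single when_def in_keys_iff)
  with assms(3)[OF update(3) assms(2)] show ?case by simp
qed (rule assms)

lemma linext_mult:
  fixes sc :: "'k::ring_1 \<Rightarrow> 'r::ring_1"
  assumes "\<And>a b. sc (a + b) = sc a + sc b" "sc 0 = 0"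
    "\<And>a b. sc (a * b) = sc a * sc b" "\<And>a r. sc a * r = r * sc a"
    "\<And>k l. g (k + l) = g k * g l"
  shows "linext sc g (p * q) = linext sc g p * linext sc g q"
proof (induction p rule: poly_mapping_single_induct)
  case (single k c)
  show ?case
  proof (induction q rule: poly_mapping_single_induct)
    case (single l d)
    have "sc d * (g k * g l) = g k * (sc d * g l)"
      by (metis assms(4) mult.assoc)
    then show ?case
      by (simp add: mult_single linext_single assms(1-3,5) mult.assoc)
  qed (simp_all add: linext_add assms(1,2) distrib_left)
qed (simp_all add: linext_add assms(1,2) distrib_right)

definition freegen :: "'g \<Rightarrow> ('g word \<Rightarrow>\<^sub>0 'k::ring_1)" where
  "freegen g = Poly_Mapping.single (Word [g]) 1"

definition freescal :: "'k \<Rightarrow> ('m::monoid_add \<Rightarrow>\<^sub>0 'k::ring_1)" where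
  "freescal c = Poly_Mapping.single 0 c"

text \<open>Algebra homomorphism out of the free algebra with prescribed values on generators.\<close>

definition freehom :: "('k::ring_1 \<Rightarrow> 'r) \<Rightarrow> ('g \<Rightarrow> 'r) \<Rightarrow> ('g word \<Rightarrow>\<^sub>0 'k) \<Rightarrow> 'r::ring_1" where
  "freehom sc g = linext sc (\<lambda>w. prod_list (map g (letters w)))"

locale scalar_embedding =
  fixes sc :: "'k::ring_1 \<Rightarrow> 'r::ring_1"
  assumes sc_add: "sc (a + b) = sc a + sc b"
    and sc_mult: "sc (a * b) = sc a * sc b"
    and sc_1: "sc 1 = 1"
    and sc_central: "sc a * r = r * sc a"
begin

lemma sc_0: "sc 0 = 0"
  using sc_add[of 0 0] by simp

lemma freehom_0 [simp]: "freehom sc g 0 = 0"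
  by (simp add: freehom_def)

lemma freehom_add: "freehom sc g (p + q) = freehom sc g p + freehom sc g q"
  by (simp add: freehom_def linext_add sc_add sc_0)

lemma freehom_uminus: "freehom sc g (- p) = - freehom sc g p"
  using freehom_add[of g p "- p"] by (simp add: eq_neg_iff_add_eq_0 add.commute)

lemma freehom_diff: "freehom sc g (p - q) = freehom sc g p - freehom sc g q"
  using freehom_add[of g p "- q"] by (simp add: freehom_uminus)

lemma freehom_mult: "freehom sc g (p * q) = freehom sc g p * freehom sc g q"
  unfolding freehom_def
  by (rule linext_mult) (rule sc_add sc_0 sc_mult sc_central | simp)+

lemma freehom_gen: "freehom sc g (freegen a) = g a"
  by (simp add: freehom_def freegen_def linext_single sc_0 sc_1)

lemma freehom_scal: "freehom sc g (freescal c) = sc c"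
  by (simp add: freehom_def freescal_def linext_single sc_0)

lemma freehom_1: "freehom sc g 1 = 1"
  using freehom_scal[of g 1] by (simp add: freescal_def sc_1)

lemmas freehom_simps =
  freehom_0 freehom_add freehom_uminus freehom_diff freehom_mult freehom_gen freehom_scal freehom_1

lemma freehom_tsideal:
  assumes "p \<in> tsideal S" "\<And>s. s \<in> S \<Longrightarrow> freehom sc g s = 0"
  shows "freehom sc g p = 0"
  by (rule tsideal_hom_zero[OF assms(1)]) (simp_all add: freehom_add freehom_mult assms)

end

interpretation id_scalar: scalar_embedding "\<lambda>c::'k::comm_ring_1. c"
  by standard (simp_all add: mult.commute)

lemma freescal_add: "freescal (a + b) = freescal a + freescal b"
  by (simp add: freescal_def single_add)

lemma freescal_mult: "freescal (a * b) = freescal a * freescal b"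
  by (simp add: freescal_def mult_single)

lemma freescal_1: "freescal 1 = 1"
  by (simp add: freescal_def)

lemma freescal_central:
  fixes c :: "'k::comm_ring_1"
  shows "freescal c * p = p * freescal c"
  by (induction p rule: poly_mapping_single_induct)
    (simp_all add: freescal_def mult_single algebra_simps)


section \<open>The algebra \<open>U(sl(2))\<close> and its \<open>h\<close>-adic version\<close>

datatype sl2_gen = GJ0 | GJp | GJm

type_synonym sl2_free = "sl2_gen word \<Rightarrow>\<^sub>0 complex"

definition sl2_rels :: "sl2_free set" where
  "sl2_rels = (let J0 = freegen GJ0; Jp = freegen GJp; Jm = freegen GJm in
     {(J0 * Jp - Jp * J0) - freescal 2 * Jp,
      (J0 * Jm - Jm * J0) + freescal 2 * Jm,
      (Jp * Jm - Jm * Jp) - J0})"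

lemma sl2_relsE:
  assumes "s \<in> sl2_rels"
  obtains "s = (freegen GJ0 * freegen GJp - freegen GJp * freegen GJ0) - freescal 2 * freegen GJp"
  | "s = (freegen GJ0 * freegen GJm - freegen GJm * freegen GJ0) + freescal 2 * freegen GJm"
  | "s = (freegen GJp * freegen GJm - freegen GJm * freegen GJp) - freegen GJ0"
  using assms unfolding sl2_rels_def Let_def by blast

quotient_type usl2 = sl2_free / "\<lambda>p q. p - q \<in> tsideal sl2_rels"
  by (rule tsideal_equivp)

lemma one_notin_sl2_ideal: "1 \<notin> tsideal sl2_rels"
proof
  assume "1 \<in> tsideal sl2_rels"
  then have "freehom (\<lambda>c::complex. c) (\<lambda>_. 0) (1 :: sl2_free) = 0"
    by (rule id_scalar.freehom_tsideal) (auto simp: sl2_rels_def Let_def id_scalar.freehom_simps)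
  then show False by (simp add: id_scalar.freehom_1)
qed

instantiation usl2 :: ring_1
begin
lift_definition zero_usl2 :: usl2 is 0 .
lift_definition one_usl2 :: usl2 is 1 .
lift_definition plus_usl2 :: "usl2 \<Rightarrow> usl2 \<Rightarrow> usl2" is "(+)" by (rule tsideal_cong_add)
lift_definition minus_usl2 :: "usl2 \<Rightarrow> usl2 \<Rightarrow> usl2" is "(-)" by (rule tsideal_cong_minus)
lift_definition uminus_usl2 :: "usl2 \<Rightarrow> usl2" is "uminus" by (rule tsideal_cong_uminus)
lift_definition times_usl2 :: "usl2 \<Rightarrow> usl2 \<Rightarrow> usl2" is "(*)" by (rule tsideal_cong_mult)
instance
proof
  fix a b c :: usl2
  show "a * b * c = a * (b * c)"
    by transfer (simp add: mult.assoc tsideal.zero)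
  show "a + b + c = a + (b + c)"
    by transfer (simp add: add.assoc tsideal.zero)
  show "a + b = b + a"
    by transfer (simp add: add.commute tsideal.zero)
  show "0 + a = a"
    by transfer (simp add: tsideal.zero)
  show "- a + a = 0"
    by transfer (simp add: tsideal.zero)
  show "a - b = a + - b"
    by transfer (simp add: tsideal.zero)
  show "(a + b) * c = a * c + b * c"
    by transfer (simp add: distrib_right tsideal.zero)
  show "a * (b + c) = a * b + a * c"
    by transfer (simp add: distrib_left tsideal.zero)
  show "1 * a = a"
    by transfer (simp add: tsideal.zero)
  show "a * 1 = a"
    by transfer (simp add: tsideal.zero)
  show "(0::usl2) \<noteq> 1"
  proof transfer
    show "\<not> 0 - 1 \<in> tsideal sl2_rels"
      using tsideal_uminus[of "0 - 1" sl2_rels] one_notin_sl2_ideal by auto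
  qed
qed
end

lift_definition uscal :: "complex \<Rightarrow> usl2" is freescal .
lift_definition ugen :: "sl2_gen \<Rightarrow> usl2" is freegen .

interpretation uscal: scalar_embedding uscal
proof
  show "uscal (a + b) = uscal a + uscal b" for a b
    by transfer (simp add: freescal_add tsideal.zero)
  show "uscal (a * b) = uscal a * uscal b" for a b
    by transfer (simp add: freescal_mult tsideal.zero)
  show "uscal 1 = 1"
    by transfer (simp add: freescal_1 tsideal.zero)
  show "uscal a * r = r * uscal a" for a r
    by transfer (simp add: freescal_central tsideal.zero)
qed

lemma usl2_relations:
  "ugen GJ0 * ugen GJp - ugen GJp * ugen GJ0 = uscal 2 * ugen GJp"
  "ugen GJ0 * ugen GJm - ugen GJm * ugen GJ0 = - (uscal 2 * ugen GJm)"
  "ugen GJp * ugen GJm - ugen GJm * ugen GJp = ugen GJ0"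
  by (transfer, rule tsideal_base, simp add: sl2_rels_def Let_def)+

text \<open>\<open>U\<^sub>h(sl(2))\<close>: as an algebra it is undeformed, and since its coproduct involves power series in
  \<open>h\<close> it is taken to be \<open>U(sl(2))[[h]]\<close>; \<open>h\<close> is \<^const>\<open>fps_X\<close>.\<close>

type_synonym uh = "usl2 fps"


section \<open>The tensor product \<open>U(sl(2)) \<otimes> U(sl(2))\<close>\<close>

text \<open>The free vector space on pairs modulo bilinearity. The pairs carry the componentwise product
  (written additively), so that the free vector space is an algebra.\<close>

datatype 'a mpair = MPair 'a 'a

instantiation mpair :: (monoid_mult) monoid_add
begin
definition "0 = MPair 1 1"
fun plus_mpair :: "'a mpair \<Rightarrow> 'a mpair \<Rightarrow> 'a mpair" where
  "plus_mpair (MPair a b) (MPair c d) = MPair (a * c) (b * d)"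
instance
proof
  fix x y z :: "'a mpair"
  show "x + y + z = x + (y + z)"
    by (cases x; cases y; cases z) (simp add: mult.assoc)
  show "0 + x = x" "x + 0 = x"
    by (cases x; simp add: zero_mpair_def)+
qed
end

type_synonym upair_free = "usl2 mpair \<Rightarrow>\<^sub>0 complex"

definition fpair :: "usl2 \<Rightarrow> usl2 \<Rightarrow> upair_free" where
  "fpair a b = Poly_Mapping.single (MPair a b) 1"

definition bilinear_rels :: "upair_free set" where
  "bilinear_rels =
     {fpair (a + a') b - (fpair a b + fpair a' b) | a a' b. True} \<union>
     {fpair a (b + b') - (fpair a b + fpair a b') | a b b'. True} \<union>
     {fpair (uscal c * a) b - freescal c * fpair a b | c a b. True} \<union>
     {fpair a (uscal c * b) - freescal c * fpair a b | c a b. True}"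

text \<open>The bilinearity relations span a two-sided ideal already, as they are stable under
  multiplication by pairs.\<close>

quotient_type utens = upair_free / "\<lambda>p q. p - q \<in> tsideal bilinear_rels"
  by (rule tsideal_equivp)

definition ulinear :: "(usl2 \<Rightarrow> complex fps) \<Rightarrow> bool" where
  "ulinear f \<longleftrightarrow> (\<forall>a b. f (a + b) = f a + f b) \<and> (\<forall>c a. f (uscal c * a) = fps_const c * f a)"

fun pair_fun :: "(usl2 \<Rightarrow> complex fps) \<Rightarrow> (usl2 \<Rightarrow> complex fps) \<Rightarrow> usl2 mpair \<Rightarrow> complex fps" where
  "pair_fun f g (MPair a b) = f a * g b"

abbreviation tfun_free where
  "tfun_free f g \<equiv> linext fps_const (pair_fun f g)"

lemma tfun_free_add: "tfun_free f g (p + q) = tfun_free f g p + tfun_free f g q"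
  by (simp add: linext_add)

lemma tfun_free_uminus: "tfun_free f g (- p) = - tfun_free f g p"
  using tfun_free_add[of f g p "- p"] by (simp add: eq_neg_iff_add_eq_0 add.commute)

lemma tfun_free_diff: "tfun_free f g (p - q) = tfun_free f g p - tfun_free f g q"
  using tfun_free_add[of f g p "- q"] by (simp add: tfun_free_uminus)

lemma uscal_left: "a * (uscal c * b) = uscal c * (a * b)"
  by (metis mult.assoc uscal.sc_central)

lemma fps_const_left: "fps_const (a * b) * f = fps_const a * (fps_const b * f)" 
  for f :: "complex fps"
  by (simp flip: fps_const_mult add: mult.assoc)

lemma bilinear_relsE:
  assumes "s \<in> bilinear_rels"
  obtains a a' b where "s = fpair (a + a') b - (fpair a b + fpair a' b)"
  | a b b' where "s = fpair a (b + b') - (fpair a b + fpair a b')"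
  | c a b where "s = fpair (uscal c * a) b - freescal c * fpair a b"
  | c a b where "s = fpair a (uscal c * b) - freescal c * fpair a b"
  using assms unfolding bilinear_rels_def by blast

lemma tfun_free_bilinear:
  assumes "ulinear f" "ulinear g" "s \<in> bilinear_rels"
  shows "tfun_free f g (p * s * q) = 0"
proof -
  have *: "tfun_free f g (Poly_Mapping.single k c * s * Poly_Mapping.single l d) = 0" for k c l d
  proof -
    obtain k1 k2 l1 l2 where kl: "k = MPair k1 k2" "l = MPair l1 l2"
      by (cases k; cases l) blast
    have lin: "f (a + b) = f a + f b" "g (a + b) = g a + g b"
      "f (uscal e * a) = fps_const e * f a" "g (uscal e * a) = fps_const e * g a" for a b e
      using assms(1,2) by (auto simp: ulinear_def)
    note rules = kl fpair_def freescal_def zero_mpair_def mult_single distrib_left distrib_right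
      left_diff_distrib right_diff_distrib tfun_free_add tfun_free_diff linext_single
      lin uscal_left mult.assoc
    from assms(3) show ?thesis
      by (cases rule: bilinear_relsE) (simp_all add: rules, simp_all add: mult_ac)
  qed
  show ?thesis
  proof (induction p rule: poly_mapping_single_induct)
    case (single k c)
    show ?case
      by (induction q rule: poly_mapping_single_induct)
        (simp_all add: * distrib_left tfun_free_add)
  qed (simp_all add: distrib_right tfun_free_add)
qed

lemma tfun_free_tsideal:
  assumes "p \<in> tsideal bilinear_rels" "ulinear f" "ulinear g"
  shows "tfun_free f g p = 0"
  using assms by induction (simp_all add: tfun_free_add tfun_free_bilinear)

lift_definition ueps :: "usl2 \<Rightarrow> complex" is "freehom (\<lambda>c. c) (\<lambda>_. 0)"
proof -
  fix p q :: sl2_free assume "p - q \<in> tsideal sl2_rels"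
  then have "freehom (\<lambda>c. c) (\<lambda>_. 0) (p - q) = (0::complex)"
    by (rule id_scalar.freehom_tsideal) (auto simp: sl2_rels_def Let_def id_scalar.freehom_simps)
  then show "freehom (\<lambda>c. c) (\<lambda>_. 0) p = (freehom (\<lambda>c. c) (\<lambda>_. 0) q :: complex)"
    by (simp add: id_scalar.freehom_diff)
qed

lemma ulinear_ueps: "ulinear (\<lambda>a. fps_const (ueps a))"
proof -
  have "ueps (a + b) = ueps a + ueps b" for a b
    by transfer (rule id_scalar.freehom_add)
  moreover have "ueps (uscal c * a) = c * ueps a" for c a
    by transfer (simp add: id_scalar.freehom_mult id_scalar.freehom_scal)
  ultimately show ?thesis by (simp add: ulinear_def)
qed

lemma ueps_1: "ueps 1 = 1"
  by transfer (rule id_scalar.freehom_1)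

lemma one_notin_bilinear_ideal: "1 \<notin> tsideal bilinear_rels"
proof
  assume "1 \<in> tsideal bilinear_rels"
  from tfun_free_tsideal[OF this ulinear_ueps ulinear_ueps]
  have "tfun_free (\<lambda>a. fps_const (ueps a)) (\<lambda>a. fps_const (ueps a)) (Poly_Mapping.single 0 1) = 0"
    by simp
  then show False
    by (simp add: linext_single zero_mpair_def ueps_1 del: single_one)
qed

instantiation utens :: ring_1
begin
lift_definition zero_utens :: utens is 0 .
lift_definition one_utens :: utens is 1 .
lift_definition plus_utens :: "utens \<Rightarrow> utens \<Rightarrow> utens" is "(+)" by (rule tsideal_cong_add)
lift_definition minus_utens :: "utens \<Rightarrow> utens \<Rightarrow> utens" is "(-)" by (rule tsideal_cong_minus)
lift_definition uminus_utens :: "utens \<Rightarrow> utens" is "uminus" by (rule tsideal_cong_uminus)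
lift_definition times_utens :: "utens \<Rightarrow> utens \<Rightarrow> utens" is "(*)" by (rule tsideal_cong_mult)
instance
proof
  fix a b c :: utens
  show "a * b * c = a * (b * c)"
    by transfer (simp add: mult.assoc tsideal.zero)
  show "a + b + c = a + (b + c)"
    by transfer (simp add: add.assoc tsideal.zero)
  show "a + b = b + a"
    by transfer (simp add: add.commute tsideal.zero)
  show "0 + a = a"
    by transfer (simp add: tsideal.zero)
  show "- a + a = 0"
    by transfer (simp add: tsideal.zero)
  show "a - b = a + - b"
    by transfer (simp add: tsideal.zero)
  show "(a + b) * c = a * c + b * c"
    by transfer (simp add: distrib_right tsideal.zero)
  show "a * (b + c) = a * b + a * c"
    by transfer (simp add: distrib_left tsideal.zero)
  show "1 * a = a"
    by transfer (simp add: tsideal.zero)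
  show "a * 1 = a"
    by transfer (simp add: tsideal.zero)
  show "(0::utens) \<noteq> 1"
  proof transfer
    show "\<not> 0 - 1 \<in> tsideal bilinear_rels"
      using tsideal_uminus[of "0 - 1" bilinear_rels] one_notin_bilinear_ideal by auto
  qed
qed
end

lift_definition tscal :: "complex \<Rightarrow> utens" is freescal .

interpretation tscal: scalar_embedding tscal
proof
  show "tscal (a + b) = tscal a + tscal b" for a b
    by transfer (simp add: freescal_add tsideal.zero)
  show "tscal (a * b) = tscal a * tscal b" for a b
    by transfer (simp add: freescal_mult tsideal.zero)
  show "tscal 1 = 1"
    by transfer (simp add: freescal_1 tsideal.zero)
  show "tscal a * r = r * tscal a" for a r
    by transfer (simp add: freescal_central tsideal.zero)
qed

lift_definition tensor :: "usl2 \<Rightarrow> usl2 \<Rightarrow> utens" (infixl \<open>\<otimes>\<close> 75) is fpair .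

lemma tensor_bilinear:
  "(a + a') \<otimes> b = a \<otimes> b + a' \<otimes> b"
  "a \<otimes> (b + b') = a \<otimes> b + a \<otimes> b'"
  "(uscal c * a) \<otimes> b = tscal c * (a \<otimes> b)"
  "a \<otimes> (uscal c * b) = tscal c * (a \<otimes> b)"
  by (transfer, rule tsideal_base, unfold bilinear_rels_def, blast)+

lemma tensor_mult: "(a \<otimes> b) * (c \<otimes> d) = (a * c) \<otimes> (b * d)"
  by transfer (simp add: fpair_def mult_single tsideal.zero)

text \<open>For linear \<open>f\<close>, \<open>g\<close> this is the functional \<open>f \<otimes> g\<close>.\<close>

lift_definition tensor_fun :: "(usl2 \<Rightarrow> complex fps) \<Rightarrow> (usl2 \<Rightarrow> complex fps) \<Rightarrow> utens \<Rightarrow> complex fps"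
  is "\<lambda>f g p. if ulinear f \<and> ulinear g then tfun_free f g p else 0"
  using tfun_free_tsideal by (fastforce simp: tfun_free_diff)

lemma tensor_fun_tensor: "ulinear f \<Longrightarrow> ulinear g \<Longrightarrow> tensor_fun f g (a \<otimes> b) = f a * g b"
  by transfer (simp add: fpair_def linext_single)


section \<open>The twisted coproduct\<close>

definition Delta0_gen :: "sl2_gen \<Rightarrow> utens" where
  "Delta0_gen g = ugen g \<otimes> 1 + 1 \<otimes> ugen g"

lift_definition Delta0 :: "usl2 \<Rightarrow> utens" is "freehom tscal Delta0_gen"
proof -
  have neg: "(- a) \<otimes> b = - (a \<otimes> b)" "a \<otimes> (- b) = - (a \<otimes> b)" for a b
    using tensor_bilinear(1)[of a "- a" b] tensor_bilinear(1)[of 0 0 b]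
      tensor_bilinear(2)[of a b "- b"] tensor_bilinear(2)[of a 0 0]
    by (simp_all add: eq_neg_iff_add_eq_0 add.commute)
  have comm: "Delta0_gen g * Delta0_gen g' - Delta0_gen g' * Delta0_gen g =
      (ugen g * ugen g' - ugen g' * ugen g) \<otimes> 1 + 1 \<otimes> (ugen g * ugen g' - ugen g' * ugen g)" for g g'
    using tensor_bilinear(1)[of "ugen g * ugen g'" "- (ugen g' * ugen g)" 1]
      tensor_bilinear(2)[of 1 "ugen g * ugen g'" "- (ugen g' * ugen g)"]
    by (simp add: Delta0_gen_def distrib_left distrib_right tensor_mult neg)
  fix p q :: sl2_free assume "p - q \<in> tsideal sl2_rels"
  then have "freehom tscal Delta0_gen (p - q) = 0"
  proof (rule tscal.freehom_tsideal)
    fix s assume "s \<in> sl2_rels"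
    then show "freehom tscal Delta0_gen s = 0"
    proof (cases rule: sl2_relsE)
      case 1
      show ?thesis
        by (simp only: 1 tscal.freehom_simps comm usl2_relations)
          (simp add: Delta0_gen_def neg tensor_bilinear distrib_left)
    next
      case 2
      show ?thesis
        by (simp only: 2 tscal.freehom_simps comm usl2_relations)
          (simp add: Delta0_gen_def neg tensor_bilinear distrib_left)
    next
      case 3
      show ?thesis
        by (simp only: 3 tscal.freehom_simps comm usl2_relations)
          (simp add: Delta0_gen_def)
    qed
  qed
  then show "freehom tscal Delta0_gen p = freehom tscal Delta0_gen q"
    by (simp add: tscal.freehom_diff)
qed

text \<open>Substitution of \<open>a\<close>, with zero constant term and coefficients in a noncommutative algebra, into a
  power series with scalar coefficients; \<^const>\<open>fps_compose\<close> needs both over the same ring.\<close>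

definition fps_subst :: "(complex \<Rightarrow> 'r::ring_1) \<Rightarrow> complex fps \<Rightarrow> 'r fps \<Rightarrow> 'r fps" where
  "fps_subst sc f a = Abs_fps (\<lambda>n. \<Sum>i\<le>n. sc (f $ i) * (a ^ i) $ n)"

text \<open>\<^term>\<open>fps_ln 1\<close> is the series of \<open>ln (1 + t)\<close>.\<close>

definition sigma :: uh where
  "sigma = - fps_subst uscal (fps_ln 1) (- (fps_const (uscal 2 * ugen GJp) * fps_X))"

definition twist_exponent :: "utens fps" where
  "twist_exponent = Abs_fps (\<lambda>n. - (tscal (1/2) * (ugen GJ0 \<otimes> (sigma $ n))))"

definition twist :: "utens fps" where
  "twist = fps_subst tscal (fps_exp 1) twist_exponent"

definition twist_inv :: "utens fps" where
  "twist_inv = fps_subst tscal (fps_exp 1) (- twist_exponent)"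

definition Delta :: "uh \<Rightarrow> utens fps" where
  "Delta X = twist * Abs_fps (\<lambda>n. Delta0 (X $ n)) * twist_inv"


section \<open>The dual of \<open>U\<^sub>h(sl(2))\<close>\<close>

text \<open>The \<open>\<complex>[[h]]\<close>-linear extension of a linear map to power series.\<close>

definition hext :: "('v \<Rightarrow> complex fps) \<Rightarrow> 'v fps \<Rightarrow> complex fps" where
  "hext f X = Abs_fps (\<lambda>n. \<Sum>i\<le>n. f (X $ i) $ (n - i))"

text \<open>The product dual to the coproduct, \<open>(f g)(X) = (f \<otimes> g)(\<Delta> X)\<close>. A \<open>\<complex>[[h]]\<close>-linear functional on
  \<open>U(sl(2))[[h]]\<close> is determined by its restriction to \<open>U(sl(2))\<close>, whence the use of \<^const>\<open>fps_const\<close>.\<close>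

definition convolution :: "(uh \<Rightarrow> complex fps) \<Rightarrow> (uh \<Rightarrow> complex fps) \<Rightarrow> uh \<Rightarrow> complex fps" where
  "convolution f g X = hext (tensor_fun (\<lambda>a. f (fps_const a)) (\<lambda>b. g (fps_const b))) (Delta X)"

definition counit :: "uh \<Rightarrow> complex fps" where
  "counit X = Abs_fps (\<lambda>n. ueps (X $ n))"


section \<open>Spin representations\<close>

text \<open>The set \<open>{-j, -j + 1, \<dots>, j}\<close> for \<open>j \<in> {0, 1/2, 1, \<dots>}\<close>.\<close>

definition weights :: "real \<Rightarrow> real set" where
  "weights j = {m. j + m \<in> \<nat> \<and> j - m \<in> \<nat>}"

lemma finite_weights: "finite (weights j)"
proof -
  have "weights j \<subseteq> (\<lambda>i. real i - j) ` {..nat \<lfloor>2 * j\<rfloor>}"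
  proof
    fix m assume "m \<in> weights j"
    then obtain a b where ab: "j + m = real a" "j - m = real b"
      by (auto simp: weights_def Nats_def)
    then have "2 * j = real (a + b)" by simp
    then have "a \<le> nat \<lfloor>2 * j\<rfloor>" by simp
    moreover have "m = real a - j" using ab by simp
    ultimately show "m \<in> (\<lambda>i. real i - j) ` {..nat \<lfloor>2 * j\<rfloor>}" by blast
  qed
  then show ?thesis by (rule finite_subset) simp
qed

fun spin_gen :: "real \<Rightarrow> sl2_gen \<Rightarrow> real \<Rightarrow> real \<Rightarrow> complex" where
  "spin_gen j GJ0 m' m = (if m' = m then of_real (2 * m) else 0)"
| "spin_gen j GJp m' m = (if m' = m + 1 then of_real (sqrt ((j - m) * (j + m + 1))) else 0)"
| "spin_gen j GJm m' m = (if m' = m - 1 then of_real (sqrt ((j + m) * (j - m + 1))) else 0)"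

fun spin_word :: "real \<Rightarrow> sl2_gen list \<Rightarrow> real \<Rightarrow> real \<Rightarrow> complex" where
  "spin_word j [] m' m = (if m' = m then 1 else 0)"
| "spin_word j (g # gs) m' m = (\<Sum>l\<in>weights j. spin_gen j g m' l * spin_word j gs l m)"

definition spin_free :: "real \<Rightarrow> real \<Rightarrow> real \<Rightarrow> sl2_free \<Rightarrow> complex" where
  "spin_free j m' m = linext (\<lambda>c. c) (\<lambda>w. spin_word j (letters w) m' m)"

lemma spin_free_add: "spin_free j m' m (p + q) = spin_free j m' m p + spin_free j m' m q"
  by (simp add: spin_free_def linext_add)

lemma spin_free_uminus: "spin_free j m' m (- p) = - spin_free j m' m p"
  using spin_free_add[of j m' m p "- p"] by (simp add: spin_free_def eq_neg_iff_add_eq_0 add.commute)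

lemma spin_free_diff: "spin_free j m' m (p - q) = spin_free j m' m p - spin_free j m' m q"
  using spin_free_add[of j m' m p "- q"] by (simp add: spin_free_uminus)

lemma spin_word_append:
  assumes "m' \<in> weights j"
  shows "spin_word j (v @ w) m' m = (\<Sum>l\<in>weights j. spin_word j v m' l * spin_word j w l m)"
  using assms
proof (induction v arbitrary: m')
  case Nil
  have "(\<Sum>l\<in>weights j. spin_word j [] m' l * spin_word j w l m)
      = (\<Sum>l\<in>weights j. if m' = l then spin_word j w l m else 0)"
    by (intro sum.cong) auto
  also have "\<dots> = spin_word j w m' m"
    using Nil finite_weights by simp
  finally show ?case by simp
next
  case (Cons g v)
  have "spin_word j ((g # v) @ w) m' m =
      (\<Sum>k\<in>weights j. \<Sum>l\<in>weights j. spin_gen j g m' k * spin_word j v k l * spin_word j w l m)"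
    by (simp add: Cons.IH sum_distrib_left mult.assoc)
  also have "\<dots> = (\<Sum>l\<in>weights j. spin_word j (g # v) m' l * spin_word j w l m)"
    by (subst sum.swap) (simp add: sum_distrib_right)
  finally show ?case .
qed

lemma spin_free_mult:
  assumes "m' \<in> weights j"
  shows "spin_free j m' m (p * q) = (\<Sum>l\<in>weights j. spin_free j m' l p * spin_free j l m q)"
proof (induction p rule: poly_mapping_single_induct)
  case zero
  show ?case by (simp add: spin_free_def)
next
  case (single v c)
  show ?case
  proof (induction q rule: poly_mapping_single_induct)
    case zero
    show ?case by (simp add: spin_free_def)
  next
    case (single w d)
    show ?case
      by (simp add: spin_free_def mult_single linext_single spin_word_append[OF assms]
          sum_distrib_left mult_ac)
  next
    case (add p q)
    then show ?case by (simp add: spin_free_add distrib_left sum.distrib)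
  qed
next
  case (add p q)
  then show ?case by (simp add: spin_free_add distrib_right sum.distrib)
qed

lemma spin_free_gen:
  assumes "m \<in> weights j"
  shows "spin_free j m' m (freegen g) = spin_gen j g m' m"
proof -
  have "spin_free j m' m (freegen g) = (\<Sum>l\<in>weights j. if l = m then spin_gen j g m' l else 0)"
    by (simp add: spin_free_def freegen_def linext_single if_distrib cong: if_cong)
  also have "\<dots> = spin_gen j g m' m"
    using assms finite_weights by simp
  finally show ?thesis .
qed

lemma spin_free_scal_mult: "spin_free j m' m (freescal c * p) = c * spin_free j m' m p"
  by (induction p rule: poly_mapping_single_induct)
    (simp_all add: freescal_def spin_free_def mult_single linext_single linext_add distrib_left)

lemma spin_gen_comp:
  assumes "m' \<in> weights j" "m \<in> weights j"
  shows "(\<Sum>l\<in>weights j. spin_gen j GJ0 m' l * spin_gen j g l m) = of_real (2 * m') * spin_gen j g m' m"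
    and "(\<Sum>l\<in>weights j. spin_gen j g m' l * spin_gen j GJ0 l m) = of_real (2 * m) * spin_gen j g m' m"
proof -
  have "(\<Sum>l\<in>weights j. spin_gen j GJ0 m' l * spin_gen j g l m)
      = (\<Sum>l\<in>weights j. if m' = l then of_real (2 * m') * spin_gen j g l m else 0)"
    by (intro sum.cong) auto
  then show "(\<Sum>l\<in>weights j. spin_gen j GJ0 m' l * spin_gen j g l m) = of_real (2 * m') * spin_gen j g m' m"
    using assms finite_weights by simp
  have "(\<Sum>l\<in>weights j. spin_gen j g m' l * spin_gen j GJ0 l m)
      = (\<Sum>l\<in>weights j. if l = m then of_real (2 * m) * spin_gen j g m' l else 0)"
    by (intro sum.cong) auto
  then show "(\<Sum>l\<in>weights j. spin_gen j g m' l * spin_gen j GJ0 l m) = of_real (2 * m) * spin_gen j g m' m"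
    using assms finite_weights by simp
qed

lemma weights_pred:
  assumes "m \<in> weights j" "m - 1 \<notin> weights j"
  shows "j + m = 0"
proof -
  from assms(1) obtain a b where ab: "j + m = real a" "j - m = real b"
    by (auto simp: weights_def Nats_def)
  show ?thesis
  proof (cases a)
    case (Suc a')
    then have "j + (m - 1) = real a'" "j - (m - 1) = real (Suc b)"
      using ab by auto
    then have "m - 1 \<in> weights j"
      unfolding weights_def by (metis (mono_tags, lifting) mem_Collect_eq of_nat_in_Nats)
    with assms(2) show ?thesis by simp
  qed (use ab in simp)
qed

lemma weights_uminus: "- m \<in> weights j \<longleftrightarrow> m \<in> weights j"
  by (auto simp: weights_def)

lemma weights_succ:
  assumes "m \<in> weights j" "m + 1 \<notin> weights j"
  shows "j - m = 0"
  using weights_pred[of "- m" j] weights_uminus[of m j] weights_uminus[of "m + 1" j] assms by simp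

lemma weights_bounds: "m \<in> weights j \<Longrightarrow> 0 \<le> j + m \<and> 0 \<le> j - m"
  by (auto simp: weights_def Nats_def)

lemma spin_gen_updown:
  assumes "m \<in> weights j"
  shows "(\<Sum>l\<in>weights j. spin_gen j GJp m' l * spin_gen j GJm l m)
           = (if m' = m then of_real ((j + m) * (j - m + 1)) else 0)"
    and "(\<Sum>l\<in>weights j. spin_gen j GJm m' l * spin_gen j GJp l m)
           = (if m' = m then of_real ((j - m) * (j + m + 1)) else 0)"
proof -
  let ?c = "(j + m) * (j - m + 1)" and ?d = "(j - m) * (j + m + 1)"
  have nonneg: "0 \<le> ?c" "0 \<le> ?d"
    using weights_bounds[OF assms] by auto
  have sq: "complex_of_real (sqrt r) * complex_of_real (sqrt r) = of_real r" if "0 \<le> r" for r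
    using that by (simp flip: of_real_mult)
  have "(\<Sum>l\<in>weights j. spin_gen j GJp m' l * spin_gen j GJm l m)
      = (\<Sum>l\<in>weights j. if l = m - 1 then (if m' = m then of_real ?c else 0) else 0)"
  proof (intro sum.cong refl)
    fix l
    show "spin_gen j GJp m' l * spin_gen j GJm l m
        = (if l = m - 1 then (if m' = m then of_real ?c else 0) else 0)"
    proof (cases "l = m - 1 \<and> m' = m")
      case True
      have "(j - (m - 1)) * (j + (m - 1) + 1) = ?c" by (simp add: algebra_simps)
      then have "spin_gen j GJp m (m - 1) = of_real (sqrt ?c)" "spin_gen j GJm (m - 1) m = of_real (sqrt ?c)"
        by (simp_all only: spin_gen.simps) simp_all
      with True have "spin_gen j GJp m' l = of_real (sqrt ?c)" "spin_gen j GJm l m = of_real (sqrt ?c)"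
        by simp_all
      then show ?thesis
        by (simp only: sq[OF nonneg(1)] True simp_thms if_True)
    qed auto
  qed
  also have "\<dots> = (if m - 1 \<in> weights j then (if m' = m then of_real ?c else 0) else 0)"
    using finite_weights by simp
  also have "\<dots> = (if m' = m then of_real ?c else 0)"
  proof (cases "m - 1 \<in> weights j")
    case False
    then have "?c = 0" using weights_pred[OF assms] by simp
    then show ?thesis by (simp only: of_real_0 if_cancel)
  qed simp
  finally show "(\<Sum>l\<in>weights j. spin_gen j GJp m' l * spin_gen j GJm l m)
      = (if m' = m then of_real ?c else 0)" .
  have "(\<Sum>l\<in>weights j. spin_gen j GJm m' l * spin_gen j GJp l m)
      = (\<Sum>l\<in>weights j. if l = m + 1 then (if m' = m then of_real ?d else 0) else 0)"
  proof (intro sum.cong refl)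
    fix l
    show "spin_gen j GJm m' l * spin_gen j GJp l m
        = (if l = m + 1 then (if m' = m then of_real ?d else 0) else 0)"
    proof (cases "l = m + 1 \<and> m' = m")
      case True
      have "(j + (m + 1)) * (j - (m + 1) + 1) = ?d" by (simp add: algebra_simps)
      then have "spin_gen j GJm m (m + 1) = of_real (sqrt ?d)" "spin_gen j GJp (m + 1) m = of_real (sqrt ?d)"
        by (simp_all only: spin_gen.simps) simp_all
      with True have "spin_gen j GJm m' l = of_real (sqrt ?d)" "spin_gen j GJp l m = of_real (sqrt ?d)"
        by simp_all
      then show ?thesis
        by (simp only: sq[OF nonneg(2)] True simp_thms if_True)
    qed auto
  qed
  also have "\<dots> = (if m + 1 \<in> weights j then (if m' = m then of_real ?d else 0) else 0)"
    using finite_weights by simp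
  also have "\<dots> = (if m' = m then of_real ?d else 0)"
  proof (cases "m + 1 \<in> weights j")
    case False
    then have "?d = 0" using weights_succ[OF assms] by simp
    then show ?thesis by (simp only: of_real_0 if_cancel)
  qed simp
  finally show "(\<Sum>l\<in>weights j. spin_gen j GJm m' l * spin_gen j GJp l m)
      = (if m' = m then of_real ?d else 0)" .
qed

lemma spin_free_gen_gen:
  assumes "m' \<in> weights j" "m \<in> weights j"
  shows "spin_free j m' m (freegen g * freegen g') = (\<Sum>l\<in>weights j. spin_gen j g m' l * spin_gen j g' l m)"
  using assms by (simp add: spin_free_mult spin_free_gen)

lemma spin_free_rels:
  assumes "s \<in> sl2_rels" "m' \<in> weights j" "m \<in> weights j"
  shows "spin_free j m' m s = 0"
proof -
  note e = spin_free_add spin_free_diff spin_free_scal_mult spin_free_gen_gen[OF assms(2,3)]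
    spin_free_gen[OF assms(3)]
  from assms(1) show ?thesis
  proof (cases rule: sl2_relsE)
    case 1
    then show ?thesis
      by (simp only: e spin_gen_comp[OF assms(2,3)]) (cases "m' = m + 1"; simp add: algebra_simps)
  next
    case 2
    then show ?thesis
      by (simp only: e spin_gen_comp[OF assms(2,3)]) (cases "m = m' + 1"; simp add: algebra_simps)
  next
    case 3
    then show ?thesis
      by (simp only: e spin_gen_updown[OF assms(3)]) (simp add: algebra_simps)
  qed
qed

lemma spin_free_tsideal:
  assumes "p \<in> tsideal sl2_rels" "m' \<in> weights j" "m \<in> weights j"
  shows "spin_free j m' m p = 0"
  using assms
proof induction
  case zero
  show ?case by (simp add: spin_free_def)
next
  case (step p s a b)
  then show ?case by (simp add: spin_free_add spin_free_mult spin_free_rels)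
qed

text \<open>The matrix element \<open>\<langle>j m'|X|j m\<rangle>\<close>, first for \<open>X\<close> in \<open>U(sl(2))\<close>, then in \<open>U\<^sub>h(sl(2))\<close>.\<close>

lift_definition spin :: "real \<Rightarrow> real \<Rightarrow> real \<Rightarrow> usl2 \<Rightarrow> complex"
  is "\<lambda>j m' m p. if m' \<in> weights j \<and> m \<in> weights j then spin_free j m' m p else 0"
  using spin_free_tsideal by (fastforce simp: spin_free_diff)

definition spin_coeff :: "real \<Rightarrow> real \<Rightarrow> real \<Rightarrow> uh \<Rightarrow> complex fps" where
  "spin_coeff j m' m X = Abs_fps (\<lambda>n. spin j m' m (X $ n))"


section \<open>The algebra \<open>SL\<^sub>h(2)\<close>\<close>

datatype slh_gen = GX | GU | GV | GY

type_synonym slh_free = "slh_gen word \<Rightarrow>\<^sub>0 complex fps"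

definition slh_rels :: "slh_free set" where
  "slh_rels =
    (let x = freegen GX; u = freegen GU; v = freegen GV; y = freegen GY;
         h = freescal fps_X; D = x * y - u * v - h * x * v in
     {(v * x - x * v) - h * v^2,
      (u * x - x * u) - h * (D - x^2),
      (v * y - y * v) - h * v^2,
      (u * y - y * u) - h * (D - y^2),
      (x * y - y * x) - h * (x * v - y * v),
      (v * u - u * v) - h * (x * v + v * y),
      D - 1})"

quotient_type slh2 = slh_free / "\<lambda>p q. p - q \<in> tsideal slh_rels"
  by (rule tsideal_equivp)

lemma one_notin_slh_ideal: "1 \<notin> tsideal slh_rels"
proof
  assume "1 \<in> tsideal slh_rels"
  then have "freehom (\<lambda>c. c) (case_slh_gen 1 0 0 1) (1 :: slh_free) = (0 :: complex fps)"
    by (rule id_scalar.freehom_tsideal)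
      (auto simp: slh_rels_def Let_def id_scalar.freehom_simps power2_eq_square)
  then show False by (simp add: id_scalar.freehom_1)
qed

instantiation slh2 :: ring_1
begin
lift_definition zero_slh2 :: slh2 is 0 .
lift_definition one_slh2 :: slh2 is 1 .
lift_definition plus_slh2 :: "slh2 \<Rightarrow> slh2 \<Rightarrow> slh2" is "(+)" by (rule tsideal_cong_add)
lift_definition minus_slh2 :: "slh2 \<Rightarrow> slh2 \<Rightarrow> slh2" is "(-)" by (rule tsideal_cong_minus)
lift_definition uminus_slh2 :: "slh2 \<Rightarrow> slh2" is "uminus" by (rule tsideal_cong_uminus)
lift_definition times_slh2 :: "slh2 \<Rightarrow> slh2 \<Rightarrow> slh2" is "(*)" by (rule tsideal_cong_mult)
instance
proof
  fix a b c :: slh2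
  show "a * b * c = a * (b * c)"
    by transfer (simp add: mult.assoc tsideal.zero)
  show "a + b + c = a + (b + c)"
    by transfer (simp add: add.assoc tsideal.zero)
  show "a + b = b + a"
    by transfer (simp add: add.commute tsideal.zero)
  show "0 + a = a"
    by transfer (simp add: tsideal.zero)
  show "- a + a = 0"
    by transfer (simp add: tsideal.zero)
  show "a - b = a + - b"
    by transfer (simp add: tsideal.zero)
  show "(a + b) * c = a * c + b * c"
    by transfer (simp add: distrib_right tsideal.zero)
  show "a * (b + c) = a * b + a * c"
    by transfer (simp add: distrib_left tsideal.zero)
  show "1 * a = a"
    by transfer (simp add: tsideal.zero)
  show "a * 1 = a"
    by transfer (simp add: tsideal.zero)
  show "(0::slh2) \<noteq> 1"
  proof transfer
    show "\<not> 0 - 1 \<in> tsideal slh_rels"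
      using tsideal_uminus[of "0 - 1" slh_rels] one_notin_slh_ideal by auto
  qed
qed
end

lift_definition sscal :: "complex fps \<Rightarrow> slh2" is freescal .

interpretation sscal: scalar_embedding sscal
proof
  show "sscal (a + b) = sscal a + sscal b" for a b
    by transfer (simp add: freescal_add tsideal.zero)
  show "sscal (a * b) = sscal a * sscal b" for a b
    by transfer (simp add: freescal_mult tsideal.zero)
  show "sscal 1 = 1"
    by transfer (simp add: freescal_1 tsideal.zero)
  show "sscal a * r = r * sscal a" for a r
    by transfer (simp add: freescal_central tsideal.zero)
qed

lift_definition slgen :: "slh_gen \<Rightarrow> slh2" is freegen .

abbreviation slx :: slh2 where "slx \<equiv> slgen GX"
abbreviation slu :: slh2 where "slu \<equiv> slgen GU"
abbreviation slv :: slh2 where "slv \<equiv> slgen GV"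
abbreviation sly :: slh2 where "sly \<equiv> slgen GY"

definition slh :: slh2 where "slh = sscal fps_X"

definition slreal :: "real \<Rightarrow> slh2" where "slreal r = sscal (fps_const (of_real r))"


section \<open>Duality and the \<open>D\<close>-functions\<close>

text \<open>The matrix \<open>(x, u; v, y)\<close> is paired with \<open>U\<^sub>h(sl(2))\<close> through the spin \<open>1/2\<close> representation. Since
  that is a representation, the matrix coproduct of \<open>SL\<^sub>h(2)\<close> is automatically dual to the product of
  \<open>U\<^sub>h(sl(2))\<close>.\<close>

fun gen_fun :: "slh_gen \<Rightarrow> uh \<Rightarrow> complex fps" where
  "gen_fun GX = spin_coeff (1/2) (1/2) (1/2)"
| "gen_fun GU = spin_coeff (1/2) (1/2) (-1/2)"
| "gen_fun GV = spin_coeff (1/2) (-1/2) (1/2)"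
| "gen_fun GY = spin_coeff (1/2) (-1/2) (-1/2)"

fun word_fun :: "slh_gen list \<Rightarrow> uh \<Rightarrow> complex fps" where
  "word_fun [] = counit"
| "word_fun (g # gs) = convolution (gen_fun g) (word_fun gs)"

definition free_pairing :: "slh_free \<Rightarrow> uh \<Rightarrow> complex fps" where
  "free_pairing p X = linext (\<lambda>c. c) (\<lambda>w. word_fun (letters w) X) p"

text \<open>The functionals \<^term>\<open>gen_fun\<close> satisfy the relations of \<open>SL\<^sub>h(2)\<close> with \<^const>\<open>convolution\<close> as product, so the
  choice of a representative does not matter.\<close>

definition pairing :: "slh2 \<Rightarrow> uh \<Rightarrow> complex fps" where
  "pairing a = free_pairing (rep_slh2 a)"

definition dfun :: "real \<Rightarrow> real \<Rightarrow> real \<Rightarrow> slh2" where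
  "dfun j m' m =
     (if m' \<in> weights j \<and> m \<in> weights j
      then (THE a. \<forall>X. pairing a X = spin_coeff j m' m X) else 0)"

end

theory Submission
  imports Defs
begin

text \<open>The recurrence relations are the Clebsch-Gordan relations for the product of a spin \<open>l = j \<plusminus> 1/2\<close>
and a spin \<open>1/2\<close> representation, corrected by the twist. Let \<open>\<Theta>\<^sub>c\<^sub>d(X)\<close> be the entry \<open>(c, d)\<close> of
\<open>\<Delta>\<^sub>0(X)\<close> with its second factor in the spin \<open>1/2\<close> representation. The functional
\<open>X \<mapsto> \<langle>l p|\<Theta>\<^sub>c\<^sub>d(X)|l q\<rangle>\<close> is a matrix element of the untwisted tensor product, and the intertwiners
between that tensor product and spin \<open>j\<close> combine these functionals into spin \<open>j\<close> matrix elements,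
by rows (\<open>clebsch_gordan\<close>) and by columns (\<open>clebsch_gordan_transposed\<close>). In spin \<open>1/2\<close> the square
of \<open>J\<^sub>+\<close> vanishes, so with its second factor there the twist is \<open>1 - h J\<^sub>0 \<otimes> J\<^sub>+\<close>. As \<open>J\<^sub>0\<close> acts
on weight vectors by \<open>2p\<close> and \<open>2q\<close>, conjugation by the twist changes the untwisted functionals by
multiples of \<open>2ph\<close> and \<open>2qh\<close> only (\<open>spin_coeff_right_slice\<close>); these are the \<open>h\<close>-terms of the
recurrences.

This computes with functionals on \<open>U\<^sub>h(sl(2))\<close>. To turn it into identities in the presented
algebra \<open>SL\<^sub>h(2)\<close>, the pairing has to be understood.

\<^item> A word in the generators is paired by convolving with one generator after the other from the
left, whereas the recurrences multiply by generators on the right. Both kinds of convolution are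
compositions with a slice of the coproduct, and left slices commute with right slices
(\<open>left_slice_right_slice_commute\<close>). This is coassociativity for the twist; through the cocycle
property it comes down to the differential equation of the powers of \<open>1 - 2hJ\<^sub>+\<close>.

\<^item> Since a word can be built up from both ends, a relation of \<open>SL\<^sub>h(2)\<close> has to be tested only by
itself, not inside a longer word. What is left is quadratic in the spin \<open>1/2\<close> matrix elements and
follows from their commutativity under the untwisted product and from their determinant being the
counit (\<open>free_pairing_relations\<close>).

\<^item> The pairing is injective (\<open>pairing_injective\<close>). The relations reduce every word to normal words
\<open>x\<^sup>a y\<^sup>b u\<^sup>c\<close> and \<open>x\<^sup>a y\<^sup>b v\<^sup>c\<close>. The functional of a word of length \<open>n\<close> has a nonzero component at
one spin \<open>n/2\<close> matrix element, and its other components are of lower spin or at matrix elements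
with smaller \<open>m' - m\<close>. Different normal words have different leading matrix elements, so a
triangularity argument shows that they are independent.

\<^item> Every spin \<open>j\<close> matrix element is the functional of some element of \<open>SL\<^sub>h(2)\<close>
(\<open>spin_coeff_represented\<close>), by induction on \<open>j\<close> along the Clebsch-Gordan relations.

So the \<open>D\<close>-functions are the elements paired to the spin matrix elements, and an equation between
elements of \<open>SL\<^sub>h(2)\<close> may be checked on functionals, where it is the computation above.\<close>

section \<open>Matrix elements of \<open>U(sl(2))\<close>\<close>

lemma free_algebra_induct [case_names scalar gen add mult]:
  fixes p :: "'g word \<Rightarrow>\<^sub>0 'k::comm_ring_1"
  assumes scalar: "\<And>c. P (freescal c)" and gen: "\<And>g. P (freegen g)"
    and add: "\<And>p q. P p \<Longrightarrow> P q \<Longrightarrow> P (p + q)" and mult: "\<And>p q. P p \<Longrightarrow> P q \<Longrightarrow> P (p * q)"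
  shows "P p"
proof (induction p rule: poly_mapping_single_induct)
  case zero
  show ?case using scalar[of 0] by (simp add: freescal_def)
next
  case (single w c)
  have "P (Poly_Mapping.single (Word gs) c)" for gs
  proof (induction gs)
    case Nil
    show ?case using scalar[of c] by (simp add: freescal_def zero_word_def)
  next
    case (Cons g gs)
    have "Poly_Mapping.single (Word (g # gs)) c = freegen g * Poly_Mapping.single (Word gs) c"
      by (simp add: freegen_def mult_single plus_word_def)
    then show ?case using mult[OF gen Cons] by simp
  qed
  then show ?case by (metis word.collapse)
qed (rule add)

lemma usl2_induct [case_names scalar gen add mult]:
  assumes "\<And>c. P (uscal c)" "\<And>g. P (ugen g)"
    and "\<And>x y. P x \<Longrightarrow> P y \<Longrightarrow> P (x + y)" "\<And>x y. P x \<Longrightarrow> P y \<Longrightarrow> P (x * y)"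
  shows "P x"
proof -
  have "P (abs_usl2 p)" for p
    by (induction p rule: free_algebra_induct)
      (use assms in \<open>simp_all flip: uscal.abs_eq ugen.abs_eq plus_usl2.abs_eq times_usl2.abs_eq\<close>)
  then show ?thesis by (metis Quotient_abs_rep Quotient_usl2)
qed

lemma spin_add: "spin j m' m (x + y) = spin j m' m x + spin j m' m y"
  by transfer (simp add: spin_free_add)

lemma spin_outside: "m' \<notin> weights j \<or> m \<notin> weights j \<Longrightarrow> spin j m' m x = 0"
  by transfer auto

lemma spin_mult: "spin j m' m (x * y) = (\<Sum>l\<in>weights j. spin j m' l x * spin j l m y)"
  by transfer (auto simp: spin_free_mult)

lemma spin_uscal: "spin j m' m (uscal c) = (if m' = m \<and> m \<in> weights j then c else 0)"
  by transfer (auto simp: spin_free_def freescal_def linext_single)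

lemma spin_ugen:
  "spin j m' m (ugen g) = (if m' \<in> weights j \<and> m \<in> weights j then spin_gen j g m' m else 0)"
  by transfer (auto simp: spin_free_gen)

lemma spin_uscal_mult: "spin j m' m (uscal c * x) = c * spin j m' m x"
proof (cases "m' \<in> weights j")
  case True
  have "spin j m' m (uscal c * x) = (\<Sum>l\<in>weights j. if m' = l then c * spin j l m x else 0)"
    unfolding spin_mult spin_uscal by (intro sum.cong) auto
  then show ?thesis using True finite_weights by simp
qed (simp add: spin_outside)

lemma spin_1: "spin j m' m 1 = (if m' = m \<and> m \<in> weights j then 1 else 0)"
  using spin_uscal[of j m' m 1] by (simp add: uscal.sc_1)

lemma spin_0 [simp]: "spin j m' m 0 = 0"
  using spin_uscal[of j m' m 0] by (simp add: uscal.sc_0)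

lemma spin_uminus: "spin j m' m (- x) = - spin j m' m x"
  using spin_add[of j m' m x "- x"] by (simp add: eq_neg_iff_add_eq_0 add.commute)

lemma spin_diff: "spin j m' m (x - y) = spin j m' m x - spin j m' m y"
  using spin_add[of j m' m x "- y"] by (simp add: spin_uminus)

lemma spin_sum: "spin j m' m (\<Sum>i\<in>I. f i) = (\<Sum>i\<in>I. spin j m' m (f i))"
  by (induction I rule: infinite_finite_induct) (simp_all add: spin_add)

text \<open>The weights of the spin \<open>1/2\<close> representation are indexed by booleans, so that sums over them split
by computation.\<close>

definition half :: "bool \<Rightarrow> real" where
  "half s = (if s then 1/2 else -1/2)"

lemma half_simps [simp]: "half True = 1/2" "half False = -1/2"
  by (simp_all add: half_def)

lemma half_in_weights [simp]: "half s \<in> weights (1/2)"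
  by (cases s) (simp_all add: weights_def)

lemma weights_half: "weights (1/2) = range half"
proof
  show "weights (1/2) \<subseteq> range half"
  proof
    fix m :: real assume "m \<in> weights (1/2)"
    then obtain a b where ab: "1/2 + m = real a" "1/2 - m = real b"
      by (auto simp: weights_def Nats_def)
    then have "real (a + b) = 1" by simp
    then have "a + b = 1" using of_nat_eq_1_iff by blast
    then have "a = 0 \<or> a = 1" by auto
    then have "m = half False \<or> m = half True" using ab by auto
    then show "m \<in> range half" by blast
  qed
qed auto

lemma inj_half: "inj half"
  by (auto simp: inj_def half_def split: if_splits)

definition fund :: "bool \<Rightarrow> bool \<Rightarrow> usl2 \<Rightarrow> complex" where
  "fund a b = spin (1/2) (half a) (half b)"

lemma fund_add: "fund a b (x + y) = fund a b x + fund a b y"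
  by (simp add: fund_def spin_add)

lemma fund_uscal_mult: "fund a b (uscal c * x) = c * fund a b x"
  by (simp add: fund_def spin_uscal_mult)

lemma fund_mult: "fund a b (x * y) = (\<Sum>c\<in>UNIV. fund a c x * fund c b y)"
  by (simp add: fund_def spin_mult weights_half sum.reindex[OF inj_half, unfolded o_def])

lemma fund_uscal: "fund a b (uscal c) = (if a = b then c else 0)"
  by (auto simp: fund_def spin_uscal inj_eq[OF inj_half])

lemma fund_1: "fund a b 1 = (if a = b then 1 else 0)"
  by (auto simp: fund_def spin_1 inj_eq[OF inj_half])

lemma fund_gen:
  "fund a b (ugen GJ0) = (if a = b then of_real (2 * half a) else 0)"
  "fund a b (ugen GJp) = (if a \<and> \<not> b then 1 else 0)"
  "fund a b (ugen GJm) = (if \<not> a \<and> b then 1 else 0)"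
  by (auto simp: fund_def spin_ugen inj_eq[OF inj_half])

section \<open>Linear functionals on \<open>U\<^sub>h(sl(2))\<close>\<close>

lemma fps_shift_decomp:
  fixes X :: "'a::ring_1 fps"
  shows "X = fps_const (X $ 0) + fps_X * fps_shift 1 X"
  by (rule fps_ext) (auto simp: fps_mult_fps_X_commute)

text \<open>Commuting with \<open>h\<close> takes the place of continuity: peeling off the constant term \<open>n + 1\<close> times
determines the coefficient of \<open>h\<^sup>n\<close> of the value.\<close>

lemma fps_additive_eqI:
  fixes F F' :: "'a::ring_1 fps \<Rightarrow> 'b::ring_1 fps"
  assumes add: "\<And>X Y. F (X + Y) = F X + F Y" "\<And>X Y. F' (X + Y) = F' X + F' Y"
    and X: "\<And>X. F (fps_X * X) = fps_X * F X" "\<And>X. F' (fps_X * X) = fps_X * F' X"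
    and const: "\<And>a. F (fps_const a) = F' (fps_const a)"
  shows "F X = F' X"
proof -
  have "F X $ n = F' X $ n" for n
  proof (induction n arbitrary: X)
    case 0
    show ?case
      by (subst (1 2) fps_shift_decomp[of X]) (simp add: add X const)
  next
    case (Suc n)
    show ?case
      by (subst (1 2) fps_shift_decomp[of X]) (simp add: add X const Suc)
  qed
  then show ?thesis by (rule fps_ext)
qed

text \<open>In contrast to the defining property \<open>f = hext (f \<circ> fps_const)\<close> of a \<open>\<complex>[[h]]\<close>-linear functional
(\<open>hext_hlinear\<close>), this form is evidently inherited by composition with maps that commute with
scalars and \<open>h\<close>.\<close>

definition hlinear :: "(uh \<Rightarrow> complex fps) \<Rightarrow> bool" where
  "hlinear f \<longleftrightarrow> (\<forall>X Y. f (X + Y) = f X + f Y) \<and> (\<forall>X. f (fps_X * X) = fps_X * f X) \<and>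
     (\<forall>c X. f (fps_const (uscal c) * X) = fps_const c * f X)"

lemma hlinearD:
  assumes "hlinear f"
  shows "f (X + Y) = f X + f Y" "f (fps_X * X) = fps_X * f X"
    "f (fps_const (uscal c) * X) = fps_const c * f X"
  using assms by (auto simp: hlinear_def)

lemma hext_add:
  assumes "\<And>x y. f (x + y) = f x + f y"
  shows "hext f (X + Y) = hext f X + hext f Y"
  by (rule fps_ext) (simp add: hext_def assms sum.distrib)

lemma hext_fps_X:
  fixes f :: "'v::ring_1 \<Rightarrow> complex fps"
  assumes "\<And>x y. f (x + y) = f x + f y"
  shows "hext f (fps_X * X) = fps_X * hext f X"
proof (rule fps_ext)
  fix n
  have f0: "f 0 = 0" using assms[of 0 0] by simp
  show "hext f (fps_X * X) $ n = (fps_X * hext f X) $ n"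
  proof (cases n)
    case 0 then show ?thesis by (simp add: hext_def f0)
  next
    case (Suc k)
    show ?thesis
      unfolding Suc hext_def
      by (simp add: sum.atMost_Suc_shift f0 del: sum.atMost_Suc)
  qed
qed

lemma hext_const:
  assumes "f 0 = 0"
  shows "hext f (fps_const a) = f a"
proof (rule fps_ext)
  fix n
  have "(\<Sum>i\<le>n. f (fps_const a $ i) $ (n - i)) = (\<Sum>i\<le>n. if i = 0 then f a $ n else 0)"
    by (intro sum.cong) (auto simp: assms)
  then show "hext f (fps_const a) $ n = f a $ n" by (simp add: hext_def)
qed

lemma hext_hlinear:
  assumes "hlinear f"
  shows "hext (\<lambda>a. f (fps_const a)) = f"
proof
  fix X
  have add: "f (fps_const (x + y)) = f (fps_const x) + f (fps_const y)" for x y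
    using hlinearD(1)[OF assms, of "fps_const x" "fps_const y"] by simp
  have "f (fps_const 0) = 0" using add[of 0 0] by simp
  then show "hext (\<lambda>a. f (fps_const a)) X = f X"
    using fps_additive_eqI[of "hext (\<lambda>a. f (fps_const a))" f X]
      hext_add[of "\<lambda>a. f (fps_const a)"] hext_fps_X[of "\<lambda>a. f (fps_const a)"]
      hext_const[of "\<lambda>a. f (fps_const a)"] hlinearD(1,2)[OF assms] add by blast
qed

lemma hlinear_ulinear: "hlinear f \<Longrightarrow> ulinear (\<lambda>a. f (fps_const a))"
  unfolding ulinear_def fps_const_add[symmetric] fps_const_mult[symmetric] by (simp only: hlinearD) blast

lemma hlinear_coeffwise:
  assumes "\<And>x y. f (x + y) = f x + f y" "\<And>c x. f (uscal c * x) = c * f x"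
  shows "hlinear (\<lambda>X. Abs_fps (\<lambda>n. f (X $ n)))"
proof -
  have "f 0 = 0" using assms(1)[of 0 0] by simp
  then show ?thesis
    unfolding hlinear_def by (auto intro!: fps_ext simp: assms)
qed

lemma hlinear_spin_coeff: "hlinear (spin_coeff j m' m)"
  using hlinear_coeffwise[of "spin j m' m"] unfolding spin_coeff_def
  by (simp add: spin_add spin_uscal_mult)

lemma ueps_add: "ueps (x + y) = ueps x + ueps y"
  by transfer (rule id_scalar.freehom_add)

lemma ueps_mult: "ueps (x * y) = ueps x * ueps y"
  by transfer (rule id_scalar.freehom_mult)

lemma ueps_uscal: "ueps (uscal c) = c"
  by transfer (rule id_scalar.freehom_scal)

lemma ueps_ugen: "ueps (ugen g) = 0"
  by transfer (rule id_scalar.freehom_gen)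

lemma hlinear_counit: "hlinear counit"
  using hlinear_coeffwise[of ueps] unfolding counit_def
  by (simp add: ueps_add ueps_mult ueps_uscal)

section \<open>Contracting a tensor factor with the spin \<open>1/2\<close> representation\<close>

text \<open>Scalars are absorbed into the first tensor factor.\<close>

lemma tensor_induct [case_names tensor add]:
  assumes tensor: "\<And>x y. P (x \<otimes> y)"
    and add: "\<And>s t. P s \<Longrightarrow> P t \<Longrightarrow> P (s + t)"
  shows "P t"
proof -
  have "P (abs_utens p)" for p
  proof (induction p rule: poly_mapping_single_induct)
    case zero
    have "0 \<otimes> 0 = 0" using tensor_bilinear(1)[of 0 0 0] by simp
    then show ?case using tensor[of 0 0] by (simp add: zero_utens.abs_eq)
  next
    case (single k c)
    obtain x y where k: "k = MPair x y" by (cases k)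
    have "Poly_Mapping.single k c = freescal c * fpair x y"
      by (simp add: k freescal_def fpair_def mult_single)
    then have "abs_utens (Poly_Mapping.single k c) = tscal c * (x \<otimes> y)"
      by (simp add: tscal.abs_eq tensor.abs_eq times_utens.abs_eq)
    also have "\<dots> = (uscal c * x) \<otimes> y"
      by (rule tensor_bilinear(3)[symmetric])
    finally have "abs_utens (Poly_Mapping.single k c) = (uscal c * x) \<otimes> y" .
    then show ?case using tensor by simp
  next
    case (add p q)
    then show ?case using assms(2) by (simp add: plus_utens.abs_eq[symmetric])
  qed
  then show ?thesis by (metis Quotient_abs_rep Quotient_utens)
qed

text \<open>The functionals of \<^const>\<open>tensor_fun\<close> contract both factors of the tensor square. To see how they act
on products, a single factor has to be contracted, which leaves a value in \<open>U(sl(2))\<close>.\<close>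

definition ubilinear :: "(usl2 \<Rightarrow> usl2 \<Rightarrow> usl2) \<Rightarrow> bool" where
  "ubilinear \<beta> \<longleftrightarrow>
     (\<forall>x x' y. \<beta> (x + x') y = \<beta> x y + \<beta> x' y) \<and> (\<forall>x y y'. \<beta> x (y + y') = \<beta> x y + \<beta> x y') \<and>
     (\<forall>c x y. \<beta> (uscal c * x) y = uscal c * \<beta> x y) \<and> (\<forall>c x y. \<beta> x (uscal c * y) = uscal c * \<beta> x y)"

fun pair_bilinear :: "(usl2 \<Rightarrow> usl2 \<Rightarrow> usl2) \<Rightarrow> usl2 mpair \<Rightarrow> usl2" where
  "pair_bilinear \<beta> (MPair x y) = \<beta> x y"

abbreviation tlift_free where
  "tlift_free \<beta> \<equiv> linext uscal (pair_bilinear \<beta>)"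

lemma tlift_free_add: "tlift_free \<beta> (p + q) = tlift_free \<beta> p + tlift_free \<beta> q"
  by (simp add: linext_add uscal.sc_add uscal.sc_0)

lemma tlift_free_diff: "tlift_free \<beta> (p - q) = tlift_free \<beta> p - tlift_free \<beta> q"
  using tlift_free_add[of \<beta> "p - q" q] by simp

lemma uscal_uscal: "uscal c * (uscal d * x) = uscal (c * d) * x"
  by (simp add: uscal.sc_mult mult.assoc)

text \<open>The relations are multiplied by arbitrary elements here since the map defined by \<open>\<beta>\<close> is not
multiplicative.\<close>

lemma tlift_free_bilinear:
  assumes "ubilinear \<beta>" "s \<in> bilinear_rels"
  shows "tlift_free \<beta> (p * s * q) = 0"
proof -
  have *: "tlift_free \<beta> (Poly_Mapping.single k c * s * Poly_Mapping.single l d) = 0" for k c l d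
  proof -
    obtain k1 k2 l1 l2 where kl: "k = MPair k1 k2" "l = MPair l1 l2"
      by (cases k; cases l) blast
    have lin: "\<beta> (x + x') y = \<beta> x y + \<beta> x' y" "\<beta> x (y + y') = \<beta> x y + \<beta> x y'"
      "\<beta> (uscal e * x) y = uscal e * \<beta> x y" "\<beta> x (uscal e * y) = uscal e * \<beta> x y" for e x x' y y'
      using assms(1) by (auto simp: ubilinear_def)
    note rules = kl fpair_def freescal_def zero_mpair_def mult_single distrib_left distrib_right
      left_diff_distrib right_diff_distrib tlift_free_add tlift_free_diff linext_single
      lin uscal_left[of k1] uscal_left[of k2] mult.assoc uscal.sc_0 uscal_uscal
    from assms(2) show ?thesis
      by (cases rule: bilinear_relsE) (simp_all add: rules mult_ac)
  qed
  show ?thesis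
  proof (induction p rule: poly_mapping_single_induct)
    case (single k c)
    show ?case
      by (induction q rule: poly_mapping_single_induct)
        (simp_all add: * distrib_left tlift_free_add)
  qed (simp_all add: distrib_right tlift_free_add)
qed

lemma tlift_free_tsideal:
  assumes "p \<in> tsideal bilinear_rels" "ubilinear \<beta>"
  shows "tlift_free \<beta> p = 0"
  using assms by induction (simp_all add: tlift_free_add tlift_free_bilinear)

lift_definition tlift :: "(usl2 \<Rightarrow> usl2 \<Rightarrow> usl2) \<Rightarrow> utens \<Rightarrow> usl2"
  is "\<lambda>\<beta> p. if ubilinear \<beta> then tlift_free \<beta> p else 0"
  using tlift_free_tsideal by (fastforce simp: tlift_free_diff)

lemma tlift_add: "tlift \<beta> (s + t) = tlift \<beta> s + tlift \<beta> t"
  by transfer (simp add: tlift_free_add tsideal.zero)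

lemma tlift_tensor: "ubilinear \<beta> \<Longrightarrow> tlift \<beta> (x \<otimes> y) = \<beta> x y"
  by transfer (simp add: fpair_def linext_single uscal.sc_0 uscal.sc_1 tsideal.zero)

lemma tensor_fun_add: "tensor_fun f g (s + t) = tensor_fun f g s + tensor_fun f g t"
  by transfer (simp add: tfun_free_add)

definition fund_left :: "bool \<Rightarrow> bool \<Rightarrow> utens \<Rightarrow> usl2" where
  "fund_left a b = tlift (\<lambda>x y. uscal (fund a b x) * y)"

lemma ubilinear_fund: "ubilinear (\<lambda>x y. uscal (fund a b x) * y)"
  unfolding ubilinear_def
  by (simp add: fund_add fund_uscal_mult uscal.sc_add uscal_uscal distrib_left distrib_right mult.commute)

lemma fund_left_tensor: "fund_left a b (x \<otimes> y) = uscal (fund a b x) * y"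
  unfolding fund_left_def by (rule tlift_tensor) (rule ubilinear_fund)

lemma fund_left_add: "fund_left a b (s + t) = fund_left a b s + fund_left a b t"
  by (simp add: fund_left_def tlift_add)

text \<open>The spin \<open>1/2\<close> matrices of the first factors multiply as matrices while the second factors
multiply in \<open>U(sl(2))\<close>.\<close>

lemma fund_left_mult: "fund_left a b (s * t) = (\<Sum>c\<in>UNIV. fund_left a c s * fund_left c b t)"
proof (induction s rule: tensor_induct)
  case (tensor x y)
  show ?case
  proof (induction t rule: tensor_induct)
    case (tensor x' y')
    then show ?case
      by (simp add: tensor_mult fund_left_tensor fund_mult UNIV_bool uscal.sc_add uscal_uscal
          distrib_right mult.assoc uscal_left[of y])
  qed (simp add: distrib_left fund_left_add sum.distrib)
qed (simp add: distrib_right fund_left_add sum.distrib)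

lemma tensor_1: "1 \<otimes> 1 = (1 :: utens)"
  by transfer (simp add: fpair_def flip: single_one add: zero_mpair_def tsideal.zero)

lemma tscal_tensor': "tscal c = 1 \<otimes> uscal c"
  using tensor_bilinear(4)[of 1 c 1] by (simp add: tensor_1)

lemma fund_left_tscal: "fund_left a b (tscal c) = (if a = b then uscal c else 0)"
  by (simp add: tscal_tensor' fund_left_tensor fund_1 uscal.sc_0 uscal.sc_1)

lemma Delta0_add: "Delta0 (x + y) = Delta0 x + Delta0 y"
  by transfer (rule tscal.freehom_add)

lemma Delta0_mult: "Delta0 (x * y) = Delta0 x * Delta0 y"
  by transfer (rule tscal.freehom_mult)

lemma Delta0_uscal: "Delta0 (uscal c) = tscal c"
  by transfer (rule tscal.freehom_scal)

lemma Delta0_ugen: "Delta0 (ugen g) = ugen g \<otimes> 1 + 1 \<otimes> ugen g"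
  unfolding Delta0_gen_def[symmetric] by transfer (rule tscal.freehom_gen)

text \<open>As \<open>\<Delta>\<^sub>0\<close> is cocommutative, this is also the entry \<open>(a, b)\<close> of \<open>\<Delta>\<^sub>0\<close> with its second factor in the
spin \<open>1/2\<close> representation.\<close>

definition Theta :: "bool \<Rightarrow> bool \<Rightarrow> usl2 \<Rightarrow> usl2" where
  "Theta a b x = fund_left a b (Delta0 x)"

lemma Theta_add: "Theta a b (x + y) = Theta a b x + Theta a b y"
  by (simp add: Theta_def Delta0_add fund_left_add)

lemma Theta_mult: "Theta a b (x * y) = (\<Sum>c\<in>UNIV. Theta a c x * Theta c b y)"
  by (simp add: Theta_def Delta0_mult fund_left_mult)

lemma Theta_uscal: "Theta a b (uscal c) = (if a = b then uscal c else 0)"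
  by (simp add: Theta_def Delta0_uscal fund_left_tscal)

lemma Theta_ugen: "Theta a b (ugen g) = (if a = b then ugen g else 0) + uscal (fund a b (ugen g))"
  by (simp add: Theta_def Delta0_ugen fund_left_add fund_left_tensor fund_1 uscal.sc_0 uscal.sc_1
      add.commute)

lemma Theta_uscal_mult: "Theta a b (uscal c * x) = uscal c * Theta a b x"
  by (cases a; cases b; simp add: Theta_mult Theta_uscal UNIV_bool)

text \<open>Coassociativity and cocommutativity of \<open>\<Delta>\<^sub>0\<close>: both sides are contractions of the iterated
coproduct.\<close>

lemma Theta_commute: "Theta a b (Theta c d x) = Theta c d (Theta a b x)"
proof (induction x arbitrary: a b c d rule: usl2_induct)
  case (scalar z)
  have "Theta a b 0 = 0" for a b using Theta_uscal[of a b 0] by (simp add: uscal.sc_0)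
  then show ?case by (simp add: Theta_uscal)
next
  case (gen g)
  have 0: "Theta a b 0 = 0" for a b using Theta_uscal[of a b 0] by (simp add: uscal.sc_0)
  show ?case by (simp add: Theta_ugen Theta_add Theta_uscal 0 uscal.sc_0 add_ac)
next
  case (add x y)
  then show ?case by (simp add: Theta_add)
next
  case (mult x y)
  show ?case 
    unfolding Theta_mult UNIV_bool
    by (simp add: Theta_add Theta_mult UNIV_bool mult add_ac)
qed

text \<open>Contracting both factors is contracting the first one and applying the functional to the result.\<close>

lemma hext_tensor_left:
  assumes "hlinear f"
  shows "hext (tensor_fun (\<lambda>x. fps_const (fund a b x)) (\<lambda>y. f (fps_const y))) T
      = f (Abs_fps (\<lambda>n. fund_left a b (T $ n)))"
proof -
  have ul: "ulinear (\<lambda>x. fps_const (fund a b x))"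
    by (simp add: ulinear_def fund_add fund_uscal_mult)
  have lin: "f (fps_const (x + y)) = f (fps_const x) + f (fps_const y)"
    "f (fps_const (uscal c * x)) = fps_const c * f (fps_const x)" for c x y
    using hlinear_ulinear[OF assms] by (auto simp: ulinear_def)
  have "tensor_fun (\<lambda>x. fps_const (fund a b x)) (\<lambda>y. f (fps_const y)) t
      = f (fps_const (fund_left a b t))" for t
    by (induction t rule: tensor_induct)
      (simp_all add: tensor_fun_tensor[OF ul hlinear_ulinear[OF assms]] tensor_fun_add
        fund_left_tensor fund_left_add lin)
  then have "hext (tensor_fun (\<lambda>x. fps_const (fund a b x)) (\<lambda>y. f (fps_const y))) T
      = hext (\<lambda>y. f (fps_const y)) (Abs_fps (\<lambda>n. fund_left a b (T $ n)))"
    by (simp only: hext_def fps_nth_Abs_fps)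
  then show ?thesis
    by (simp only: hext_hlinear[OF assms])
qed

section \<open>Power series in \<open>h J\<^sub>+\<close>\<close>

definition coeffwise :: "('a::zero \<Rightarrow> 'b) \<Rightarrow> 'a fps \<Rightarrow> 'b fps" where
  "coeffwise E X = Abs_fps (\<lambda>n. E (X $ n))"

lemma coeffwise_nth [simp]: "coeffwise E X $ n = E (X $ n)"
  by (simp add: coeffwise_def)

lemma coeffwise_mult:
  fixes E :: "bool \<Rightarrow> bool \<Rightarrow> 'a::ring_1 \<Rightarrow> 'b::ring_1"
  assumes add: "\<And>a b x y. E a b (x + y) = E a b x + E a b y"
    and mult: "\<And>a b x y. E a b (x * y) = (\<Sum>c\<in>UNIV. E a c x * E c b y)"
  shows "coeffwise (E a b) (X * Y) = (\<Sum>c\<in>UNIV. coeffwise (E a c) X * coeffwise (E c b) Y)"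
proof (rule fps_ext)
  fix n
  have E0: "E a b 0 = 0" using add[of a b 0 0] by simp
  have Esum: "E a b (sum f I) = (\<Sum>i\<in>I. E a b (f i))" for f and I :: "nat set"
    by (induction I rule: infinite_finite_induct) (simp_all add: add E0)
  show "coeffwise (E a b) (X * Y) $ n = (\<Sum>c\<in>UNIV. coeffwise (E a c) X * coeffwise (E c b) Y) $ n"
    by (simp add: fps_mult_nth Esum mult UNIV_bool sum.distrib)
qed

text \<open>Substitution of \<open>h J\<^sub>+\<close> for the variable. It embeds the commutative algebra of scalar power
series, where \<open>\<sigma>\<close> and the powers of \<open>1 - 2hJ\<^sub>+\<close> can be handled by the calculus of formal power
series.\<close>

definition hJp :: "complex fps \<Rightarrow> uh" where
  "hJp f = Abs_fps (\<lambda>n. uscal (f $ n) * ugen GJp ^ n)"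

lemma hJp_nth [simp]: "hJp f $ n = uscal (f $ n) * ugen GJp ^ n"
  by (simp add: hJp_def)

lemma hJp_add: "hJp (f + g) = hJp f + hJp g"
  by (rule fps_ext) (simp add: uscal.sc_add distrib_right)

lemma uscal_uminus: "uscal (- c) = - uscal c"
  using uscal.sc_add[of c "- c"] by (simp add: uscal.sc_0 eq_neg_iff_add_eq_0 add.commute)

lemma hJp_uminus: "hJp (- f) = - hJp f"
  by (rule fps_ext) (simp add: uscal_uminus)

lemma uscal_sum: "uscal (sum f I) = (\<Sum>i\<in>I. uscal (f i))"
  by (induction I rule: infinite_finite_induct) (simp_all add: uscal.sc_add uscal.sc_0)

lemma hJp_mult: "hJp (f * g) = hJp f * hJp g"
proof (rule fps_ext)
  fix n
  have *: "uscal a * x * (uscal b * y) = uscal (a * b) * (x * y)" for a b x y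
    by (metis mult.assoc uscal_left uscal.sc_mult)
  show "hJp (f * g) $ n = (hJp f * hJp g) $ n"
    by (simp add: fps_mult_nth uscal_sum sum_distrib_right * flip: power_add)
qed

lemma hJp_const: "hJp (fps_const c) = fps_const (uscal c)"
  by (rule fps_ext) (simp add: uscal.sc_0)

lemma hJp_1: "hJp 1 = 1"
  using hJp_const[of 1] by (simp add: uscal.sc_1)

lemma hJp_fps_X: "hJp fps_X = fps_const (ugen GJp) * fps_X"
  by (rule fps_ext) (simp add: fps_X_def uscal.sc_0 uscal.sc_1)

lemma hJp_power: "hJp (f ^ n) = hJp f ^ n"
  by (induction n) (simp_all add: hJp_1 hJp_mult)

lemma fps_subst_hJp: "fps_subst uscal f (hJp g) = hJp (f oo g)"
  by (rule fps_ext)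
    (simp add: fps_subst_def fps_compose_nth uscal_sum sum_distrib_right uscal.sc_mult mult.assoc
      atMost_atLeast0 flip: hJp_power)

lemma J0_Jp_power:
  "ugen GJ0 * ugen GJp ^ n = ugen GJp ^ n * ugen GJ0 + uscal (of_nat (2 * n)) * ugen GJp ^ n"
proof (induction n)
  case (Suc n)
  have c: "ugen GJ0 * ugen GJp = ugen GJp * ugen GJ0 + uscal 2 * ugen GJp"
    using usl2_relations(1) by (simp add: algebra_simps)
  have "ugen GJ0 * ugen GJp ^ Suc n = ugen GJp * (ugen GJ0 * ugen GJp ^ n) + uscal 2 * ugen GJp ^ Suc n"
    by (simp add: c distrib_right mult.assoc flip: mult.assoc[of "ugen GJ0"])
  also have "\<dots> = ugen GJp ^ Suc n * ugen GJ0 + (uscal (of_nat (2 * n)) + uscal 2) * ugen GJp ^ Suc n"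
    by (simp add: Suc distrib_left distrib_right mult.assoc uscal_left)
  also have "uscal (of_nat (2 * n)) + uscal 2 = uscal (of_nat (2 * Suc n))"
    by (simp flip: uscal.sc_add add: algebra_simps)
  finally show ?case .
qed (simp add: uscal.sc_0)

abbreviation J0h :: uh where "J0h \<equiv> fps_const (ugen GJ0)"

text \<open>By \<open>[J\<^sub>0, J\<^sub>+\<^sup>n] = 2n J\<^sub>+\<^sup>n\<close>, the derivation \<open>[J\<^sub>0, \<cdot>]\<close> is twice the Euler operator on series in
\<open>h J\<^sub>+\<close>.\<close>

lemma J0_hJp: "J0h * hJp f = hJp f * J0h + hJp (2 * (fps_X * fps_deriv f))"
proof (rule fps_ext)
  fix n
  have "(2 * (fps_X * fps_deriv f)) $ n = f $ n * of_nat (2 * n)"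
    by (cases n) (simp_all add: numeral_fps_const)
  then show "(J0h * hJp f) $ n = (hJp f * J0h + hJp (2 * (fps_X * fps_deriv f))) $ n"
    by (simp add: uscal_left[of "ugen GJ0"] J0_Jp_power distrib_left uscal_uscal mult.assoc del: of_nat_mult)
qed

lemma Theta_Jp_power:
  "Theta a b (ugen GJp ^ n) =
     (if a = b then ugen GJp ^ n else if a then uscal (of_nat n) * ugen GJp ^ (n - 1) else 0)"
proof (induction n arbitrary: a b)
  case 0
  show ?case using Theta_uscal[of a b 1] by (simp add: uscal.sc_1 uscal.sc_0)
next
  case (Suc n)
  have "uscal (of_nat n) * (ugen GJp * ugen GJp ^ (n - 1)) = uscal (of_nat n) * ugen GJp ^ n"
    by (cases n) (simp_all add: uscal.sc_0)
  then show ?case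
    by (auto simp: Theta_mult UNIV_bool Suc Theta_ugen fund_gen uscal.sc_0 uscal.sc_1
        uscal_left[of "ugen GJp"]
        uscal.sc_add distrib_right)
qed

definition Thetah :: "bool \<Rightarrow> bool \<Rightarrow> uh \<Rightarrow> uh" where
  "Thetah a b = coeffwise (Theta a b)"

lemma Thetah_mult: "Thetah a b (X * Y) = (\<Sum>c\<in>UNIV. Thetah a c X * Thetah c b Y)"
  unfolding Thetah_def by (rule coeffwise_mult) (rule Theta_add Theta_mult)+

lemma Thetah_add: "Thetah a b (X + Y) = Thetah a b X + Thetah a b Y"
  by (rule fps_ext) (simp add: Thetah_def Theta_add)

lemma Theta_0: "Theta a b 0 = 0"
  using Theta_uscal[of a b 0] by (simp add: uscal.sc_0)

lemma Thetah_fps_const: "Thetah a b (fps_const x) = fps_const (Theta a b x)"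
  by (rule fps_ext) (simp add: Thetah_def Theta_0)

lemma Thetah_fps_X: "Thetah a b (fps_X * X) = fps_X * Thetah a b X"
  by (rule fps_ext) (simp add: Thetah_def Theta_0)

text \<open>The entries of \<open>\<Delta>\<^sub>0(J\<^sub>+)\<close> form the matrix of \<open>J\<^sub>+ + E\<close> with \<open>E\<close> commuting with \<open>J\<^sub>+\<close> and of square
zero, so a power series in it is given by its first order Taylor expansion.\<close>

lemma Thetah_hJp:
  "Thetah a b (hJp f) =
     (if a = b then hJp f else if a then fps_X * hJp (fps_deriv f) else 0)"
proof (rule fps_ext)
  fix n
  have "Thetah a b (hJp f) $ n = uscal (f $ n) *
      (if a = b then ugen GJp ^ n else if a then uscal (of_nat n) * ugen GJp ^ (n - 1) else 0)"
    by (simp only: Thetah_def coeffwise_nth hJp_nth Theta_uscal_mult Theta_Jp_power)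
  also have "\<dots> = (if a = b then hJp f else if a then fps_X * hJp (fps_deriv f) else 0) $ n"
    by (cases n) (simp_all add: uscal_uscal uscal.sc_0 mult.commute)
  finally show "Thetah a b (hJp f) $ n =
      (if a = b then hJp f else if a then fps_X * hJp (fps_deriv f) else 0) $ n" .
qed

text \<open>The power series of \<open>(1 - 2h)\<^sup>r\<close>, in the form in which it arises from exponentiating \<open>- r \<sigma>\<close>.\<close>

definition hpow :: "real \<Rightarrow> complex fps" where
  "hpow r = fps_exp 1 oo (fps_const (of_real r) * (fps_ln 1 oo (fps_const (-2) * fps_X)))"

lemma hpow_ode: "(1 - 2 * fps_X) * fps_deriv (hpow r) = fps_const (of_real (- 2 * r)) * hpow r"
proof -
  let ?b = "fps_const (-2) * fps_X :: complex fps"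
  let ?L = "fps_ln 1 oo ?b"
  have b: "(1 - 2 * fps_X :: complex fps) = (1 + fps_X) oo ?b"
    by (simp add: fps_compose_add_distrib numeral_fps_const flip: fps_const_neg)
  have "(1 - 2 * fps_X) * (inverse (1 + fps_X) oo ?b) = ((1 + fps_X) * inverse (1 + fps_X)) oo ?b"
    unfolding b by (rule fps_compose_mult_distrib[symmetric]) simp
  also have "\<dots> = (1 :: complex fps)"
    by (simp add: inverse_mult_eq_1')
  finally have L: "(1 - 2 * fps_X) * fps_deriv ?L = fps_const (-2)"
    by (simp add: fps_compose_deriv fps_ln_deriv flip: mult.assoc)
  have "(1 - 2 * fps_X) * fps_deriv (hpow r)
      = (1 - 2 * fps_X) * (hpow r * (fps_const (of_real r) * fps_deriv ?L))"
    unfolding hpow_def by (subst fps_compose_deriv) simp_all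
  also have "\<dots> = hpow r * (fps_const (of_real r) * ((1 - 2 * fps_X) * fps_deriv ?L))"
    by (simp only: mult_ac)
  also have "\<dots> = fps_const (of_real (- 2 * r)) * hpow r"
    unfolding L by (simp add: mult_ac)
  finally show ?thesis .
qed

lemma hpow_0: "hpow r $ 0 = 1"
  by (simp add: hpow_def)

text \<open>By the differential equation the product has derivative zero.\<close>

lemma hpow_inverse: "hpow r * hpow (- r) = 1"
proof -
  let ?D = "fps_deriv (hpow r * hpow (- r))"
  have "(1 - 2 * fps_X) * ?D = hpow r * ((1 - 2 * fps_X) * fps_deriv (hpow (- r)))
      + ((1 - 2 * fps_X) * fps_deriv (hpow r)) * hpow (- r)"
    by (simp add: algebra_simps)
  also have "\<dots> = fps_const (of_real (- 2 * - r)) * (hpow r * hpow (- r))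
      + fps_const (of_real (- 2 * r)) * (hpow r * hpow (- r))"
    by (simp only: hpow_ode) (simp only: mult_ac)
  also have "\<dots> = (fps_const (of_real (- 2 * - r)) + fps_const (of_real (- 2 * r))) * (hpow r * hpow (- r))"
    by (simp only: distrib_right)
  also have "\<dots> = 0" by simp
  finally have "(1 - 2 * fps_X) * ?D = 0" .
  moreover have "(1 - 2 * fps_X :: complex fps) \<noteq> 0"
  proof
    assume "(1 - 2 * fps_X :: complex fps) = 0"
    then have "(1 - 2 * fps_X :: complex fps) $ 0 = 0" by simp
    then show False by simp
  qed
  ultimately have "?D = 0" using mult_eq_0_iff by blast
  then have "hpow r * hpow (- r) = fps_const ((hpow r * hpow (- r)) $ 0)"
    unfolding fps_deriv_eq_0_iff .
  then show ?thesis by (simp add: hpow_0)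
qed

lemma hJp_hpow_inverse: "hJp (hpow r) * hJp (hpow (- r)) = 1" "hJp (hpow (- r)) * hJp (hpow r) = 1"
  using hpow_inverse[of r] hpow_inverse[of "- r"] by (simp_all flip: hJp_mult add: hJp_1)

text \<open>The form in which the differential equation enters the cocycle property of the twist.\<close>

lemma hpow_shift:
  "hJp (fps_deriv (hpow r)) = J0h * hJp (hpow r) - hJp (hpow r) * (J0h + fps_const (uscal (of_real (2 * r))))"
proof -
  have "fps_deriv (hpow r) = 2 * (fps_X * fps_deriv (hpow r)) - hpow r * fps_const (of_real (2 * r))"
    using hpow_ode[of r] by (simp add: algebra_simps flip: fps_const_neg)
  then have "hJp (fps_deriv (hpow r))
      = hJp (2 * (fps_X * fps_deriv (hpow r))) - hJp (hpow r) * fps_const (uscal (of_real (2 * r)))"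
    by (metis diff_conv_add_uminus hJp_add hJp_const hJp_mult hJp_uminus)
  then show ?thesis
    by (simp add: J0_hJp distrib_left flip: fps_const_add)
qed

section \<open>The twist with one factor in the spin \<open>1/2\<close> representation\<close>

lemma sigma_eq: "sigma = - hJp (fps_ln 1 oo (fps_const (-2) * fps_X))"
proof -
  have "- (fps_const (uscal 2 * ugen GJp) * fps_X) = hJp (fps_const (-2) * fps_X)"
    by (simp add: hJp_mult hJp_const hJp_uminus hJp_fps_X uscal_uminus flip: mult.assoc fps_const_neg)
  then show ?thesis by (simp add: sigma_def fps_subst_hJp)
qed

lemma fund_left_tscal_mult: "fund_left a b (tscal c * t) = uscal c * fund_left a b t"
  by (cases a; cases b; simp add: fund_left_mult fund_left_tscal UNIV_bool)

lemma fund_left_0 [simp]: "fund_left a b 0 = 0"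
  using fund_left_add[of a b 0 0] by simp

lemma fund_left_sum: "fund_left a b (sum f I) = (\<Sum>i\<in>I. fund_left a b (f i))"
  by (induction I rule: infinite_finite_induct) (simp_all add: fund_left_add)

lemma fund_left_uminus: "fund_left a b (- t) = - fund_left a b t"
  using fund_left_add[of a b t "- t"] by (simp add: eq_neg_iff_add_eq_0 add.commute)

lemma coeffwise_1: "E 0 = 0 \<Longrightarrow> coeffwise E 1 = fps_const (E 1)"
  by (rule fps_ext) simp

lemma fund_left_1: "fund_left a b 1 = (if a = b then 1 else 0)"
  using fund_left_tscal[of a b 1] by (simp add: tscal.sc_1 uscal.sc_1)

lemma fund_left_power:
  assumes "\<And>a b. coeffwise (fund_left a b) W = (if a = b then hJp (s a) else 0)"
  shows "coeffwise (fund_left a b) (W ^ i) = (if a = b then hJp (s a ^ i) else 0)"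
proof (induction i arbitrary: a b)
  case 0
  show ?case by (simp add: coeffwise_1 fund_left_1 hJp_1)
next
  case (Suc i)
  have "coeffwise (fund_left a b) (W * W ^ i)
      = (\<Sum>c\<in>UNIV. coeffwise (fund_left a c) W * coeffwise (fund_left c b) (W ^ i))"
    by (rule coeffwise_mult) (rule fund_left_add fund_left_mult)+
  then show ?case
    by (cases a; cases b; simp add: assms Suc UNIV_bool hJp_mult)
qed

text \<open>A diagonal matrix stays diagonal under substitution into a power series.\<close>

lemma fund_left_subst:
  assumes "\<And>a b. coeffwise (fund_left a b) W = (if a = b then hJp (s a) else 0)"
  shows "coeffwise (fund_left a b) (fps_subst tscal f W) = (if a = b then hJp (f oo s a) else 0)"
proof (rule fps_ext)
  fix n
  have "fund_left a b ((W ^ i) $ n) = (if a = b then hJp (s a ^ i) $ n else 0)" for i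
    using arg_cong[OF fund_left_power[OF assms, of a b i], of "\<lambda>X. X $ n"] by (simp split: if_splits)
  then have "coeffwise (fund_left a b) (fps_subst tscal f W) $ n
      = (if a = b then fps_subst uscal f (hJp (s a)) $ n else 0)"
    by (simp add: fps_subst_def fund_left_sum fund_left_tscal_mult flip: hJp_power)
  then show "coeffwise (fund_left a b) (fps_subst tscal f W) $ n
      = (if a = b then hJp (f oo s a) else 0) $ n"
    by (simp add: fps_subst_hJp del: hJp_nth split: if_splits)
qed

lemma fund_left_twist_exponent:
  "coeffwise (fund_left a b) twist_exponent
    = (if a = b then hJp (fps_const (of_real (half a)) * (fps_ln 1 oo (fps_const (-2) * fps_X))) else 0)"
proof (rule fps_ext)
  fix n
  let ?L = "fps_ln 1 oo (fps_const (-2) * fps_X) :: complex fps"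
  have "coeffwise (fund_left a b) twist_exponent $ n
      = uscal (1/2 * fund a b (ugen GJ0)) * (uscal (?L $ n) * ugen GJp ^ n)"
    by (simp add: twist_exponent_def fund_left_uminus fund_left_tscal_mult fund_left_tensor
        sigma_eq uscal_uscal del: fps_nth_compose_linear)
  also have "\<dots> = (if a = b then hJp (fps_const (of_real (half a)) * ?L) else 0) $ n"
    by (simp add: fund_gen uscal_uscal uscal.sc_0 del: fps_nth_compose_linear)
  finally show "coeffwise (fund_left a b) twist_exponent $ n
      = (if a = b then hJp (fps_const (of_real (half a)) * ?L) else 0) $ n" .
qed

text \<open>In the representation of spin \<open>1/2\<close>, \<open>J\<^sub>0\<close> is diagonal with eigenvalues \<open>2 a\<close> for \<open>a = \<plusminus>1/2\<close>, so
the twist \<open>exp(- J\<^sub>0 \<otimes> \<sigma> / 2)\<close> becomes diagonal with entries \<open>exp(- a \<sigma>) = (1 - 2hJ\<^sub>+)\<^sup>a\<close>.\<close>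

lemma fund_left_twist:
  "coeffwise (fund_left a b) twist = (if a = b then hJp (hpow (half a)) else 0)"
  unfolding twist_def hpow_def by (rule fund_left_subst) (rule fund_left_twist_exponent)

lemma fund_left_twist_inv:
  "coeffwise (fund_left a b) twist_inv = (if a = b then hJp (hpow (- half a)) else 0)"
  unfolding twist_inv_def hpow_def
proof (rule fund_left_subst)
  fix a b
  have "coeffwise (fund_left a b) (- twist_exponent) = - coeffwise (fund_left a b) twist_exponent"
    by (rule fps_ext) (simp add: fund_left_uminus)
  then show "coeffwise (fund_left a b) (- twist_exponent) = (if a = b then
      hJp (fps_const (of_real (- half a)) * (fps_ln 1 oo (fps_const (-2) * fps_X))) else 0)"
    by (simp add: fund_left_twist_exponent flip: hJp_uminus fps_const_neg)
qed

definition hJ0 :: uh where "hJ0 = fps_X * J0h"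

text \<open>The twist with its second factor in the spin \<open>1/2\<close> representation: \<open>J\<^sub>+\<close> is the matrix unit \<open>E\<close>
there, whence \<open>\<sigma> = 2hE\<close> and \<open>exp(- J\<^sub>0 \<otimes> \<sigma> / 2) = 1 - hJ\<^sub>0 \<otimes> E\<close>.\<close>

definition right_twist :: "bool \<Rightarrow> bool \<Rightarrow> uh" where
  "right_twist a b = (if a = b then 1 else if a then - hJ0 else 0)"

definition right_twist_inv :: "bool \<Rightarrow> bool \<Rightarrow> uh" where
  "right_twist_inv a b = (if a = b then 1 else if a then hJ0 else 0)"

lemma fps_X_comm: "X * fps_X = fps_X * (X :: 'a::ring_1 fps)"
  by (rule fps_ext) (simp add: fps_mult_fps_X_commute)

text \<open>The entries of \<open>\<Delta>\<close> with the first factor in the spin \<open>1/2\<close> representation, obtained by conjugating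
\<^const>\<open>Thetah\<close> with the twist, and in \<open>right_slice\<close> with the second factor there. Convolution with a
generator on the left or on the right is composition with these slices.\<close>

definition left_slice :: "bool \<Rightarrow> bool \<Rightarrow> uh \<Rightarrow> uh" where
  "left_slice a b X = hJp (hpow (half a)) * Thetah a b X * hJp (hpow (- half b))"

definition right_slice :: "bool \<Rightarrow> bool \<Rightarrow> uh \<Rightarrow> uh" where
  "right_slice a b X = (\<Sum>c\<in>UNIV. \<Sum>d\<in>UNIV. right_twist a c * Thetah c d X * right_twist_inv d b)"

lemma fund_left_Delta: "coeffwise (fund_left a b) (Delta X) = left_slice a b X"
proof -
  have mult: "coeffwise (fund_left a b) (X * Y)
      = (\<Sum>c\<in>UNIV. coeffwise (fund_left a c) X * coeffwise (fund_left c b) Y)" for a b X Y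
    by (rule coeffwise_mult) (rule fund_left_add fund_left_mult)+
  have "coeffwise (fund_left a b) (Abs_fps (\<lambda>n. Delta0 (X $ n))) = Thetah a b X" for a b
    by (rule fps_ext) (simp add: Thetah_def Theta_def)
  then show ?thesis
    by (cases a; cases b; simp add: Delta_def mult fund_left_twist fund_left_twist_inv UNIV_bool
        left_slice_def)
qed

text \<open>The generators as entries of the matrix \<open>(x, u; v, y)\<close>.\<close>

definition entry :: "bool \<Rightarrow> bool \<Rightarrow> slh_gen" where
  "entry a b = (if a then if b then GX else GU else if b then GV else GY)"

lemma gen_fun_entry: "gen_fun (entry a b) = spin_coeff (1/2) (half a) (half b)"
  by (simp add: entry_def half_def)

lemma spin_coeff_const: "spin_coeff j m' m (fps_const x) = fps_const (spin j m' m x)"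
  by (rule fps_ext) (simp add: spin_coeff_def)

lemma convolution_entry_left:
  assumes "hlinear f"
  shows "convolution (gen_fun (entry a b)) f X = f (left_slice a b X)"
  using hext_tensor_left[OF assms, of a b "Delta X"] fund_left_Delta[of a b X]
  by (simp add: convolution_def gen_fun_entry spin_coeff_const fund_def coeffwise_def)

section \<open>Coassociativity of the twisted coproduct\<close>

lemma fps_const_uscal_central: "fps_const (uscal c) * X = X * fps_const (uscal c)"
  by (rule fps_ext) (simp add: uscal.sc_central)

lemma Thetah_1: "Thetah a b 1 = (if a = b then 1 else 0)"
  using Thetah_fps_const[of a b 1] Theta_uscal[of a b 1] by (simp add: uscal.sc_1)

lemma Thetah_scal: "Thetah a b (fps_const (uscal c) * X) = fps_const (uscal c) * Thetah a b X"
  by (cases a; cases b; simp add: Thetah_mult UNIV_bool Thetah_fps_const Theta_uscal)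

lemma Thetah_commute: "Thetah a b (Thetah c d X) = Thetah c d (Thetah a b X)"
  by (rule fps_ext) (simp add: Thetah_def Theta_commute)

lemma fps_X_left: "Y * (fps_X * Z) = fps_X * (Y * (Z :: 'a::ring_1 fps))"
  by (metis mult.assoc fps_X_comm)

lemma scal_left: "Y * (fps_const (uscal c) * Z) = fps_const (uscal c) * (Y * Z)"
  by (metis mult.assoc fps_const_uscal_central)

lemma left_slice_add: "left_slice a b (X + Y) = left_slice a b X + left_slice a b Y"
  by (simp add: left_slice_def Thetah_add distrib_left distrib_right)

lemma left_slice_fps_X: "left_slice a b (fps_X * X) = fps_X * left_slice a b X"
  by (simp add: left_slice_def Thetah_fps_X fps_X_left mult.assoc)

lemma left_slice_scal:
  "left_slice a b (fps_const (uscal c) * X) = fps_const (uscal c) * left_slice a b X"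
  by (simp add: left_slice_def Thetah_scal scal_left mult.assoc)

lemma left_slice_mult: "left_slice a b (X * Y) = (\<Sum>c\<in>UNIV. left_slice a c X * left_slice c b Y)"
proof -
  have "P * Z * R * (R' * Z' * P') = P * (Z * Z') * P'"
    if "R * R' = 1" for P Z R R' Z' P' :: uh
    by (metis that mult.assoc mult_1_left)
  note * = this[OF hJp_hpow_inverse(2)]
  show ?thesis
    by (simp add: left_slice_def Thetah_mult UNIV_bool *[of _ _ "1/2"] *[of _ _ "-1/2", simplified]
        distrib_left distrib_right)
qed

lemma left_slice_uminus: "left_slice a b (- X) = - left_slice a b X"
  using left_slice_add[of a b X "- X"] left_slice_add[of a b 0 0]
  by (simp add: eq_neg_iff_add_eq_0 add.commute)

lemma left_slice_0 [simp]: "left_slice a b 0 = 0"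
  using left_slice_add[of a b 0 0] by simp

lemma left_slice_1: "left_slice a b 1 = (if a = b then 1 else 0)"
  by (simp add: left_slice_def Thetah_1 hJp_hpow_inverse)

lemma left_slice_hJ0:
  "left_slice a b hJ0 = (if a = b then fps_X * (hJp (hpow (half a)) *
      (J0h + fps_const (uscal (of_real (2 * half a)))) * hJp (hpow (- half a))) else 0)"
  unfolding hJ0_def left_slice_fps_X
  by (simp add: left_slice_def Thetah_fps_const Theta_ugen fund_gen uscal.sc_0)

text \<open>The cocycle property of the twist with the outer two factors in the spin \<open>1/2\<close> representation. The
left factor contributes the power \<open>(1 - 2hJ\<^sub>+)\<^sup>a\<close> and the right factor the unipotent matrix
\<^const>\<open>right_twist\<close>; the one nontrivial entry is \<open>hpow_shift\<close>.\<close>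

lemma cocycle_left:
  "(\<Sum>i\<in>UNIV. right_twist c i * Thetah i c' (hJp (hpow (half a))))
    = left_slice a a (right_twist c c') * hJp (hpow (half a))"
proof -
  let ?q = "hJp (hpow (half a))" and ?q' = "hJp (hpow (- half a))"
      and ?z = "fps_const (uscal (of_real (2 * half a)))"
  have "left_slice a a hJ0 * ?q = fps_X * (?q * (J0h + ?z) * (?q' * ?q))"
    by (simp only: left_slice_hJ0 refl if_True mult.assoc)
  also have "\<dots> = fps_X * (J0h * ?q - hJp (fps_deriv (hpow (half a))))"
    unfolding hJp_hpow_inverse hpow_shift by simp
  finally have *: "left_slice a a hJ0 * ?q = hJ0 * ?q - fps_X * hJp (fps_deriv (hpow (half a)))"
    by (simp add: right_diff_distrib hJ0_def mult.assoc)
  show ?thesis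
    by (cases c; cases c'; simp add: UNIV_bool right_twist_def Thetah_hJp left_slice_1 left_slice_uminus *)
qed

text \<open>The same for the inverse twist.\<close>

lemma cocycle_right:
  "(\<Sum>i\<in>UNIV. Thetah d' i (hJp (hpow (- half b))) * right_twist_inv i d)
    = hJp (hpow (- half b)) * left_slice b b (right_twist_inv d' d)"
proof -
  let ?q = "hJp (hpow (half b))" and ?q' = "hJp (hpow (- half b))"
      and ?z = "fps_const (uscal (of_real (2 * half b)))"
  have "?q' * left_slice b b hJ0 = fps_X * ((?q' * ?q) * ((J0h + ?z) * ?q'))"
    by (simp only: left_slice_hJ0 refl if_True mult.assoc fps_X_left)
  also have "\<dots> = fps_X * (J0h * ?q' + ?q' * ?z)"
    unfolding hJp_hpow_inverse by (simp add: distrib_right fps_const_uscal_central del: fps_const_add)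
  also have "\<dots> = fps_X * (hJp (fps_deriv (hpow (- half b))) + ?q' * J0h)"
  proof -
    have "fps_const (uscal (of_real (2 * - half b))) = - ?z"
      by (simp add: uscal_uminus)
    then show ?thesis
      unfolding hpow_shift[of "- half b"]
      by (simp add: distrib_left right_diff_distrib uscal_uminus flip: fps_const_neg fps_const_add
          fps_const_sub)
  qed
  finally have *: "?q' * left_slice b b hJ0 = fps_X * hJp (fps_deriv (hpow (- half b))) + ?q' * hJ0"
    by (simp add: distrib_left hJ0_def fps_X_left)
  show ?thesis
    by (cases d; cases d'; simp add: UNIV_bool right_twist_inv_def Thetah_hJp left_slice_1 *)
qed

lemma left_slice_right_twist_offdiag:
  "a \<noteq> b \<Longrightarrow> left_slice a b (right_twist c d) = 0"
  "a \<noteq> b \<Longrightarrow> left_slice a b (right_twist_inv c d) = 0"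
  by (simp_all add: right_twist_def right_twist_inv_def left_slice_1 left_slice_uminus left_slice_hJ0)

text \<open>Both sides are conjugates of the matrix of iterated untwisted slices, which commute by
\<open>Thetah_commute\<close>. The conjugating matrices agree by the cocycle property.\<close>

lemma left_slice_right_slice_commute:
  "left_slice a b (right_slice c d X) = right_slice c d (left_slice a b X)"
proof -
  let ?q = "\<lambda>a. hJp (hpow (half a))" and ?q' = "\<lambda>a. hJp (hpow (- half a))"
  let ?M = "\<lambda>i j. Thetah i j (Thetah a b X)"
  have diag: "left_slice a b (right_twist c i * Y * right_twist_inv j d)
      = left_slice a a (right_twist c i) * left_slice a b Y * left_slice b b (right_twist_inv j d)" for i j Y
    by (cases a; cases b; simp add: left_slice_mult UNIV_bool left_slice_right_twist_offdiag)
  have "left_slice a b (right_slice c d X)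
      = (\<Sum>i\<in>UNIV. \<Sum>j\<in>UNIV. left_slice a a (right_twist c i) * left_slice a b (Thetah i j X) * left_slice b b
          (right_twist_inv j d))"
    by (simp add: right_slice_def UNIV_bool left_slice_add diag)
  also have "\<dots> = (\<Sum>i\<in>UNIV. \<Sum>j\<in>UNIV. (left_slice a a (right_twist c i) * ?q a) * ?M i j *
      (?q' b * left_slice b b (right_twist_inv j d)))"
    by (simp add: left_slice_def[of a b] Thetah_commute[of a b] mult.assoc)
  also have "\<dots> = (\<Sum>i\<in>UNIV. \<Sum>j\<in>UNIV. (\<Sum>k\<in>UNIV. right_twist c k * Thetah k i (?q a)) * ?M i j *
      (\<Sum>l\<in>UNIV. Thetah j l (?q' b) * right_twist_inv l d))"
    unfolding cocycle_left cocycle_right ..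
  also have "\<dots> = right_slice c d (left_slice a b X)"
    by (simp add: right_slice_def left_slice_def Thetah_mult UNIV_bool distrib_left distrib_right mult.assoc
        add_ac)
  finally show ?thesis .
qed

lemma entry_cases: obtains a b where "g = entry a b"
proof -
  have "g = entry True True \<or> g = entry True False \<or> g = entry False True \<or> g = entry False False"
    by (cases g) (simp_all add: entry_def)
  then show ?thesis using that by blast
qed

lemma hlinear_left_slice: "hlinear f \<Longrightarrow> hlinear (\<lambda>X. f (left_slice a b X))"
  by (simp add: hlinear_def left_slice_add left_slice_fps_X left_slice_scal)

lemma hlinear_word_fun: "hlinear (word_fun w)"
proof (induction w)
  case (Cons g w)
  obtain a b where "g = entry a b" by (rule entry_cases)
  then have "word_fun (g # w) = (\<lambda>X. word_fun w (left_slice a b X))"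
    by (simp add: fun_eq_iff convolution_entry_left[OF Cons])
  then show ?case using hlinear_left_slice[OF Cons] by simp
qed (simp add: hlinear_counit)

lemma word_fun_Cons: "word_fun (entry a b # w) X = word_fun w (left_slice a b X)"
  by (simp add: convolution_entry_left[OF hlinear_word_fun])

lemma ueps_Theta: "ueps (Theta a b x) = fund a b x"
proof (induction x arbitrary: a b rule: usl2_induct)
  case (scalar c)
  have "ueps 0 = 0" using ueps_uscal[of 0] by (simp add: uscal.sc_0)
  then show ?case by (simp add: Theta_uscal fund_uscal ueps_uscal)
next
  case (gen g)
  have "ueps 0 = 0" using ueps_uscal[of 0] by (simp add: uscal.sc_0)
  then show ?case by (simp add: Theta_ugen ueps_add ueps_uscal ueps_ugen)
next
  case (add x y)
  then show ?case by (simp add: Theta_add ueps_add fund_add)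
next
  case (mult x y)
  then show ?case by (simp add: Theta_mult UNIV_bool ueps_add ueps_mult fund_mult)
qed

lemma counit_mult: "counit (X * Y) = counit X * counit Y"
proof (rule fps_ext)
  fix n
  have 0: "ueps 0 = 0" using ueps_uscal[of 0] by (simp add: uscal.sc_0)
  have "ueps (sum f I) = (\<Sum>i\<in>I. ueps (f i))" for f and I :: "nat set"
    by (induction I rule: infinite_finite_induct) (simp_all add: ueps_add 0)
  then show "counit (X * Y) $ n = (counit X * counit Y) $ n"
    by (simp add: counit_def fps_mult_nth ueps_mult)
qed

lemma ueps_power: "ueps (x ^ n) = ueps x ^ n"
  by (induction n) (simp_all add: ueps_1 ueps_mult)

lemma counit_hJp: "counit (hJp f) = fps_const (f $ 0)"
  by (rule fps_ext) (simp add: counit_def ueps_mult ueps_uscal ueps_power ueps_ugen)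

lemma counit_Thetah: "counit (Thetah a b X) = gen_fun (entry a b) X"
  by (rule fps_ext) (simp add: counit_def Thetah_def ueps_Theta gen_fun_entry spin_coeff_def fund_def)

lemma counit_1: "counit 1 = 1"
  using counit_hJp[of 1] by (simp add: hJp_1)

lemma counit_0: "counit 0 = 0"
  using hlinearD(1)[OF hlinear_counit, of 0 0] by simp

lemma counit_hJ0: "counit hJ0 = 0"
  by (rule fps_ext) (auto simp: hJ0_def counit_def ueps_ugen ueps_uscal[of 0, unfolded uscal.sc_0])

lemma counit_left_slice: "counit (left_slice a b X) = gen_fun (entry a b) X"
  by (simp add: left_slice_def counit_mult counit_hJp hpow_0 counit_Thetah)

lemma counit_right_slice: "counit (right_slice a b X) = gen_fun (entry a b) X"
proof -
  have "counit (right_twist a b) = (if a = b then 1 else 0)"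
      "counit (right_twist_inv a b) = (if a = b then 1 else 0)" for a b
    using hlinearD(1)[OF hlinear_counit, of hJ0 "- hJ0"]
    by (simp_all add: right_twist_def right_twist_inv_def counit_0 counit_1 counit_hJ0)
  then show ?thesis
    by (cases a; cases b; simp add: right_slice_def UNIV_bool hlinearD(1)[OF hlinear_counit] counit_mult
        counit_Thetah)
qed

text \<open>The functional of a word is defined by convolving its letters from the left. As left and right
slices commute, its last letter can be split off as a right slice; on the empty word both slices
give the matrix element of the letter.\<close>

lemma word_fun_snoc: "word_fun (w @ [entry c d]) X = word_fun w (right_slice c d X)"
proof (induction w arbitrary: X)
  case Nil
  show ?case using word_fun_Cons[of c d "[]" X] by (simp add: counit_left_slice counit_right_slice)
next
  case (Cons g w)
  obtain a b where "g = entry a b" by (rule entry_cases)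
  then show ?case
    using Cons[of "left_slice a b X"] by (simp only: append_Cons word_fun_Cons left_slice_right_slice_commute)
qed

section \<open>Clebsch-Gordan relations\<close>

text \<open>The coefficient of \<open>|l, k - c\<rangle> \<otimes> |1/2, c\<rangle>\<close> in the vector of weight \<open>k\<close> of the spin \<open>j\<close> summand of
\<open>l \<otimes> 1/2\<close>, up to a common factor, for \<open>l = j - 1/2\<close> (if \<open>up\<close>) and \<open>l = j + 1/2\<close> (otherwise). In
both cases \<open>l = j - half up\<close>.\<close>

definition cg :: "bool \<Rightarrow> real \<Rightarrow> bool \<Rightarrow> real \<Rightarrow> real" where
  "cg up j c k = (if up then if c then sqrt (j + k) else sqrt (j - k)
                  else if c then sqrt (j - k + 1) else - sqrt (j + k + 1))"

lemma Nats_real_cases: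
  assumes "(x::real) \<in> \<nat>" obtains "x = 0" | "x - 1 \<in> \<nat>"
proof -
  from assms obtain n where n: "x = real n" by (auto simp: Nats_def)
  show ?thesis
  proof (cases n)
    case (Suc k)
    then have "x - 1 = real k" using n by simp
    then show ?thesis using that(2) by simp
  qed (use that n in simp)
qed

lemma Nats_add1: "(x::real) \<in> \<nat> \<Longrightarrow> x + 1 \<in> \<nat>"
  by (intro Nats_add Nats_1)

text \<open>The coefficients vanish where one of the two weights leaves its range while the other one does
not. This allows the relations below to be stated for arbitrary real weights.\<close>

lemma cg_support:
  assumes "(k \<in> weights j) \<noteq> (k - half c \<in> weights (j - half up))"
  shows "cg up j c k = 0"
proof -
  consider "up" "c" | "up" "\<not> c" | "\<not> up" "c" | "\<not> up" "\<not> c" by blast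
  then show ?thesis
  proof cases
    case 1
    then have "(j + k \<in> \<nat> \<and> j - k \<in> \<nat>) \<noteq> (j + k - 1 \<in> \<nat> \<and> j - k \<in> \<nat>)"
      using assms by (simp add: weights_def algebra_simps)
    then have "j + k = 0" using Nats_real_cases[of "j + k"] Nats_add1[of "j + k - 1"] by auto
    then show ?thesis using 1 by (simp add: cg_def)
  next
    case 2
    then have "(j + k \<in> \<nat> \<and> j - k \<in> \<nat>) \<noteq> (j + k \<in> \<nat> \<and> j - k - 1 \<in> \<nat>)"
      using assms by (simp add: weights_def algebra_simps)
    then have "j - k = 0" using Nats_real_cases[of "j - k"] Nats_add1[of "j - k - 1"] by auto
    then show ?thesis using 2 by (simp add: cg_def)
  next
    case 3
    then have "(j + k \<in> \<nat> \<and> j - k \<in> \<nat>) \<noteq> (j + k \<in> \<nat> \<and> j - k + 1 \<in> \<nat>)"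
      using assms by (simp add: weights_def algebra_simps)
    then have "j - k + 1 = 0" using Nats_real_cases[of "j - k + 1"] Nats_add1[of "j - k"] by auto
    then show ?thesis using 3 by (simp add: cg_def)
  next
    case 4
    then have "(j + k \<in> \<nat> \<and> j - k \<in> \<nat>) \<noteq> (j + k + 1 \<in> \<nat> \<and> j - k \<in> \<nat>)"
      using assms by (simp add: weights_def algebra_simps)
    then have "j + k + 1 = 0" using Nats_real_cases[of "j + k + 1"] Nats_add1[of "j + k"] by auto
    then show ?thesis using 4 by (simp add: cg_def)
  qed
qed

text \<open>Compatibility of the coefficients with \<open>J\<^sub>+\<close>, acting on the two factors and on the summand;
\<open>cg_lower\<close> is the same for \<open>J\<^sub>-\<close>.\<close>

lemma cg_raise:
  fixes j m :: real and up :: bool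
  defines "l \<equiv> j - half up"
  assumes "m \<in> weights j"
  shows "cg up j True m * sqrt ((l - (m - 1/2)) * (l + (m - 1/2) + 1)) + cg up j False m
      = cg up j True (m + 1) * sqrt ((j - m) * (j + m + 1))"
    and "cg up j False m * sqrt ((l - (m + 1/2)) * (l + (m + 1/2) + 1))
      = cg up j False (m + 1) * sqrt ((j - m) * (j + m + 1))"
proof -
  define a b where "a = j + m" and "b = j - m"
  have ab: "0 \<le> a" "0 \<le> b" using weights_bounds[OF assms(2)] by (simp_all add: a_def b_def)
  have sub: "j + m = a" "j - m = b" "j + (m + 1) = a + 1" "j - (m + 1) = b - 1"
    "l - (m - 1/2) = (if up then b else b + 1)" "l + (m - 1/2) + 1 = (if up then a else a + 1)"
    "l - (m + 1/2) = (if up then b - 1 else b)" "l + (m + 1/2) + 1 = (if up then a + 1 else a + 2)"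
    by (simp_all add: a_def b_def l_def)
  have sq: "sqrt x * (y * sqrt x) = x * y" "sqrt x * (sqrt x * y) = x * y" if "0 \<le> x" for x y
    using that by (simp_all add: mult.left_commute flip: mult.assoc)
  have "0 \<le> a + 1" "0 \<le> b + 1" using ab by auto
  note sq = sq[OF ab(1)] sq[OF ab(2)] sq[OF this(1)] sq[OF this(2)]
  show "cg up j True m * sqrt ((l - (m - 1/2)) * (l + (m - 1/2) + 1)) + cg up j False m
      = cg up j True (m + 1) * sqrt ((j - m) * (j + m + 1))"
    unfolding cg_def sub by (cases up) (simp_all add: real_sqrt_mult sq, simp_all add: algebra_simps)
  show "cg up j False m * sqrt ((l - (m + 1/2)) * (l + (m + 1/2) + 1))
      = cg up j False (m + 1) * sqrt ((j - m) * (j + m + 1))"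
    unfolding cg_def sub by (cases up) (simp_all add: real_sqrt_mult add.assoc)
qed

lemma cg_lower:
  fixes j m :: real and up :: bool
  defines "l \<equiv> j - half up"
  assumes "m \<in> weights j"
  shows "cg up j False m * sqrt ((l + (m + 1/2)) * (l - (m + 1/2) + 1)) + cg up j True m
      = cg up j False (m - 1) * sqrt ((j + m) * (j - m + 1))"
    and "cg up j True m * sqrt ((l + (m - 1/2)) * (l - (m - 1/2) + 1))
      = cg up j True (m - 1) * sqrt ((j + m) * (j - m + 1))"
proof -
  define a b where "a = j + m" and "b = j - m"
  have ab: "0 \<le> a" "0 \<le> b" using weights_bounds[OF assms(2)] by (simp_all add: a_def b_def)
  have sub: "j + m = a" "j - m = b" "j + (m - 1) = a - 1" "j - (m - 1) = b + 1"
    "l + (m + 1/2) = (if up then a else a + 1)" "l - (m + 1/2) + 1 = (if up then b else b + 1)"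
    "l + (m - 1/2) = (if up then a - 1 else a)" "l - (m - 1/2) + 1 = (if up then b + 1 else b + 2)"
    by (simp_all add: a_def b_def l_def)
  have sq: "sqrt x * (y * sqrt x) = x * y" "sqrt x * (sqrt x * y) = x * y" if "0 \<le> x" for x y
    using that by (simp_all add: mult.left_commute flip: mult.assoc)
  have "0 \<le> a + 1" "0 \<le> b + 1" using ab by auto
  note sq = sq[OF ab(1)] sq[OF ab(2)] sq[OF this(1)] sq[OF this(2)]
  show "cg up j False m * sqrt ((l + (m + 1/2)) * (l - (m + 1/2) + 1)) + cg up j True m
      = cg up j False (m - 1) * sqrt ((j + m) * (j - m + 1))"
    unfolding cg_def sub by (cases up) (simp_all add: real_sqrt_mult sq, simp_all add: algebra_simps)
  show "cg up j True m * sqrt ((l + (m - 1/2)) * (l - (m - 1/2) + 1))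
      = cg up j True (m - 1) * sqrt ((j + m) * (j - m + 1))"
    unfolding cg_def sub by (cases up) (simp_all add: real_sqrt_mult add.assoc)
qed

text \<open>Matrix elements of the untwisted product of the representations of spin \<open>l\<close> and \<open>1/2\<close>.\<close>

definition tensor_coeff :: "real \<Rightarrow> real \<Rightarrow> bool \<Rightarrow> real \<Rightarrow> bool \<Rightarrow> usl2 \<Rightarrow> complex" where
  "tensor_coeff l p c q d x = spin l p q (Theta c d x)"

lemma tensor_coeff_outside: "p \<notin> weights l \<or> q \<notin> weights l \<Longrightarrow> tensor_coeff l p c q d x = 0"
  by (simp add: tensor_coeff_def spin_outside)

lemma tensor_coeff_add:
  "tensor_coeff l p c q d (x + y) = tensor_coeff l p c q d x + tensor_coeff l p c q d y"
  by (simp add: tensor_coeff_def Theta_add spin_add)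

lemma tensor_coeff_mult:
  "tensor_coeff l p c q d (x * y) = (\<Sum>e\<in>UNIV. \<Sum>r\<in>weights l. tensor_coeff l p c r e x * tensor_coeff l r e q d
      y)"
  by (simp add: tensor_coeff_def Theta_mult spin_sum spin_mult)

lemma tensor_coeff_uscal:
  "tensor_coeff l p c q d (uscal z) = (if p = q \<and> c = d \<and> p \<in> weights l then z else 0)"
  by (auto simp: tensor_coeff_def Theta_uscal spin_uscal)

lemma tensor_coeff_ugen:
  assumes "p \<in> weights l" "q \<in> weights l"
  shows "tensor_coeff l p c q d (ugen g)
      = (if c = d then spin_gen l g p q else 0) + (if p = q then fund c d (ugen g) else 0)"
  using assms by (simp add: tensor_coeff_def Theta_ugen spin_add spin_ugen spin_uscal)

text \<open>The vectors with coefficients \<^const>\<open>cg\<close> span a copy of the spin \<open>j\<close> representation; on the generators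
this is what the identities of coefficients above say.\<close>

lemma cg_intertwines_gen:
  assumes p: "p \<in> weights (j - half up)" and m: "m \<in> weights j"
  shows "(\<Sum>d\<in>UNIV. of_real (cg up j d m) * ((if c = d then spin_gen (j - half up) g p (m - half d) else 0)
          + (if p = m - half d then fund c d (ugen g) else 0)))
      = of_real (cg up j c (p + half c)) * spin_gen j g (p + half c) m"
proof (cases g)
  case GJ0
  then show ?thesis
    by (cases c) (auto simp: UNIV_bool fund_gen algebra_simps)
next
  case GJp
  show ?thesis
  proof (cases c)
    case True
    show ?thesis
    proof (cases "p = m + 1/2")
      case p: True
      show ?thesis
        using cg_raise(1)[OF m, of up, THEN arg_cong[where f = complex_of_real]] True p GJp
        by (simp add: UNIV_bool fund_gen add.commute)
    qed (use GJp True in \<open>auto simp: UNIV_bool fund_gen\<close>)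
  next
    case False
    show ?thesis
    proof (cases "p = m + 3/2")
      case p: True
      have p': "p + half c = m + 1" "p = m + 1/2 + 1" using False p by simp_all
      show ?thesis
        unfolding p'(1) using cg_raise(2)[OF m, of up, THEN arg_cong[where f = complex_of_real]] False p'(2)
            GJp
        by (simp add: UNIV_bool fund_gen)
    qed (use GJp False in \<open>auto simp: UNIV_bool fund_gen\<close>)
  qed
next
  case GJm
  show ?thesis
  proof (cases c)
    case False
    show ?thesis
    proof (cases "p = m - 1/2")
      case p: True
      show ?thesis
        using cg_lower(1)[OF m, of up, THEN arg_cong[where f = complex_of_real]] False p GJm
        by (simp add: UNIV_bool fund_gen add.commute)
    qed (use GJm False in \<open>auto simp: UNIV_bool fund_gen\<close>)
  next
    case True
    show ?thesis
    proof (cases "p = m - 3/2")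
      case p: True
      have p': "p + half c = m - 1" "p = m - 1/2 - 1" using True p by simp_all
      show ?thesis
        unfolding p'(1) using cg_lower(2)[OF m, of up, THEN arg_cong[where f = complex_of_real]] True p'(2)
            GJm
        by (simp add: UNIV_bool fund_gen)
    qed (use GJm True in \<open>auto simp: UNIV_bool fund_gen\<close>)
  qed
qed

text \<open>Being an intertwiner passes from the generators to products, since the support of the coefficients
allows summation over the weights of \<open>l\<close> to be exchanged with summation over the weights of \<open>j\<close>.\<close>

lemma clebsch_gordan:
  "(\<Sum>d\<in>UNIV. of_real (cg up j d m) * tensor_coeff (j - half up) p c (m - half d) d x)
    = of_real (cg up j c (p + half c)) * spin j (p + half c) m x"
proof (induction x arbitrary: p c m rule: usl2_induct)
  case (scalar z)
  have "(m - half c = p \<and> p \<in> weights (j - half up) \<longrightarrow> m \<in> weights j \<or> cg up j c m = 0) \<and>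
      (m - half c = p \<and> m \<in> weights j \<longrightarrow> p \<in> weights (j - half up) \<or> cg up j c m = 0)"
    using cg_support[of m j c up] by auto
  then show ?case
    by (cases c) (auto simp: UNIV_bool tensor_coeff_uscal spin_uscal)
next
  case (gen g)
  show ?case
  proof (cases "p \<in> weights (j - half up) \<and> m \<in> weights j")
    case True
    have "of_real (cg up j d m) * tensor_coeff (j - half up) p c (m - half d) d (ugen g)
      = of_real (cg up j d m) * ((if c = d then spin_gen (j - half up) g p (m - half d) else 0)
          + (if p = m - half d then fund c d (ugen g) else 0))" for d
    proof (cases "m - half d \<in> weights (j - half up)")
      case q: True
      show ?thesis by (simp only: tensor_coeff_ugen[OF conjunct1[OF True] q])
    next
      case False
      then have "cg up j d m = 0" using cg_support[of m j d up] True by blast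
      then show ?thesis by simp
    qed
    moreover have "of_real (cg up j c (p + half c)) * spin j (p + half c) m (ugen g)
      = of_real (cg up j c (p + half c)) * spin_gen j g (p + half c) m"
      using cg_support[of "p + half c" j c up] True by (auto simp: spin_ugen)
    ultimately show ?thesis
      using cg_intertwines_gen[of p j up m c g] True by (simp only: simp_thms)
  next
    case False
    then have "of_real (cg up j d m) * tensor_coeff (j - half up) p c (m - half d) d (ugen g) = 0" for d
      using cg_support[of m j d up] tensor_coeff_outside[of p "j - half up" "m - half d" c d "ugen g"]
      by (cases "m - half d \<in> weights (j - half up)") auto
    moreover have "of_real (cg up j c (p + half c)) * spin j (p + half c) m (ugen g) = 0"
      using False cg_support[of "p + half c" j c up] spin_outside[of "p + half c" j m "ugen g"]
      by (cases "p + half c \<in> weights j") auto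
    ultimately show ?thesis by (simp only: sum.neutral_const)
  qed
next
  case (add x y)
  then show ?case by (simp add: tensor_coeff_add spin_add distrib_left sum.distrib)
next
  case (mult x y)
  let ?l = "j - half up" and ?K = "\<lambda>d k. complex_of_real (cg up j d k)"
  have reindex: "(\<Sum>r\<in>weights ?l. tensor_coeff ?l p c r e x * (?K e (r + half e) * spin j (r + half e) m y))
      = (\<Sum>k\<in>weights j. tensor_coeff ?l p c (k - half e) e x * (?K e k * spin j k m y))" for e
    by (rule sum.reindex_bij_witness_not_neutral[where i = "\<lambda>k. k - half e" and j = "\<lambda>r. r + half e"
        and S' = "{r \<in> weights ?l. r + half e \<notin> weights j}" and T' = "{k \<in> weights j. k
            - half e \<notin> weights ?l}"])
      (auto simp: finite_weights spin_outside tensor_coeff_outside)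
  have "(\<Sum>d\<in>UNIV. ?K d m * tensor_coeff ?l p c (m - half d) d (x * y))
      = (\<Sum>e\<in>UNIV. \<Sum>r\<in>weights ?l. tensor_coeff ?l p c r e x *
          (\<Sum>d\<in>UNIV. ?K d m * tensor_coeff ?l r e (m - half d) d y))"
    by (simp add: tensor_coeff_mult UNIV_bool sum_distrib_left distrib_left sum.distrib mult_ac)
  also have "\<dots> = (\<Sum>e\<in>UNIV. \<Sum>k\<in>weights j. tensor_coeff ?l p c (k - half e) e x * (?K e k * spin j k m y))"
    unfolding mult(2) reindex ..
  also have "\<dots> = (\<Sum>k\<in>weights j. (\<Sum>e\<in>UNIV. ?K e k * tensor_coeff ?l p c (k - half e) e x) * spin j k m y)"
    by (simp add: UNIV_bool sum.distrib distrib_left distrib_right mult_ac)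
  also have "\<dots> = ?K c (p + half c) * spin j (p + half c) m (x * y)"
    unfolding mult(1) by (simp add: spin_mult sum_distrib_left mult.assoc)
  finally show ?case .
qed

text \<open>The anti-automorphism that exchanges \<open>J\<^sub>+\<close> and \<open>J\<^sub>-\<close> transposes all representations at once,
because their matrices are real and \<open>J\<^sub>+\<close>, \<open>J\<^sub>-\<close> are transposes of each other.\<close>

lemma transpose_exists:
  "\<exists>y. (\<forall>j m' m. spin j m' m y = spin j m m' x) \<and> (\<forall>l p c q d. tensor_coeff l p c q d y
      = tensor_coeff l q d p c x)"
proof (induction x rule: usl2_induct)
  case (scalar z)
  show ?case by (rule exI[of _ "uscal z"]) (auto simp: spin_uscal tensor_coeff_uscal)
next
  case (gen g)
  define g' where "g' = (case g of GJ0 \<Rightarrow> GJ0 | GJp \<Rightarrow> GJm | GJm \<Rightarrow> GJp)"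
  have "spin_gen j g' m' m = spin_gen j g m m'" for j m' m
    by (cases g) (auto simp: g'_def)
  then have 1: "spin j m' m (ugen g') = spin j m m' (ugen g)" for j m' m
    by (simp add: spin_ugen)
  then have "fund a b (ugen g') = fund b a (ugen g)" for a b
    by (simp add: fund_def)
  then have "tensor_coeff l p c q d (ugen g') = tensor_coeff l q d p c (ugen g)" for l p c q d
    using 1 by (auto simp: tensor_coeff_def Theta_ugen spin_add spin_uscal)
  with 1 show ?case by blast
next
  case (add x y)
  then obtain x' y' where
    "\<forall>j m' m. spin j m' m x' = spin j m m' x"
        "\<forall>l p c q d. tensor_coeff l p c q d x' = tensor_coeff l q d p c x"
    "\<forall>j m' m. spin j m' m y' = spin j m m' y"
        "\<forall>l p c q d. tensor_coeff l p c q d y' = tensor_coeff l q d p c y"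
    by blast
  then show ?case by (intro exI[of _ "x' + y'"]) (simp add: spin_add tensor_coeff_add)
next
  case (mult x y)
  then obtain x' y' where
    "\<forall>j m' m. spin j m' m x' = spin j m m' x"
        "\<forall>l p c q d. tensor_coeff l p c q d x' = tensor_coeff l q d p c x"
    "\<forall>j m' m. spin j m' m y' = spin j m m' y"
        "\<forall>l p c q d. tensor_coeff l p c q d y' = tensor_coeff l q d p c y"
    by blast
  then show ?case by (intro exI[of _ "y' * x'"]) (simp add: spin_mult tensor_coeff_mult mult.commute)
qed

lemma clebsch_gordan_transposed:
  "(\<Sum>c\<in>UNIV. of_real (cg up j c m) * tensor_coeff (j - half up) (m - half c) c q d x)
    = of_real (cg up j d (q + half d)) * spin j m (q + half d) x"
proof -
  obtain y where "\<forall>j m' m. spin j m' m y = spin j m m' x"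
      "\<forall>l p c q d. tensor_coeff l p c q d y = tensor_coeff l q d p c x"
    using transpose_exists by blast
  then show ?thesis using clebsch_gordan[of up j m q d y] by simp
qed

section \<open>The pairing respects the relations of \<open>SL\<^sub>h(2)\<close>\<close>

lemma free_pairing_add: "free_pairing (p + q) X = free_pairing p X + free_pairing q X"
  by (simp add: free_pairing_def linext_add)

lemma free_pairing_0 [simp]: "free_pairing 0 X = 0"
  by (simp add: free_pairing_def)

lemma free_pairing_single: "free_pairing (Poly_Mapping.single w c) X = c * word_fun (letters w) X"
  by (simp add: free_pairing_def linext_single)

lemma free_pairing_uminus: "free_pairing (- p) X = - free_pairing p X"
  using free_pairing_add[of p "- p" X] by (simp add: eq_neg_iff_add_eq_0 add.commute)

lemma free_pairing_diff: "free_pairing (p - q) X = free_pairing p X - free_pairing q X"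
  using free_pairing_add[of p "- q" X] by (simp add: free_pairing_uminus)

lemma free_pairing_scal: "free_pairing (freescal c * p) X = c * free_pairing p X"
  by (induction p rule: poly_mapping_single_induct)
    (simp_all add: freescal_def mult_single free_pairing_single free_pairing_add distrib_left mult.assoc)

lemma free_pairing_gen_right:
  "free_pairing (p * freegen (entry a b)) X = free_pairing p (right_slice a b X)"
  by (induction p rule: poly_mapping_single_induct)
    (simp_all add: freegen_def mult_single free_pairing_single free_pairing_add distrib_right word_fun_snoc)

lemma free_pairing_gen_left:
  "free_pairing (freegen (entry a b) * p) X = free_pairing p (left_slice a b X)"
  by (induction p rule: poly_mapping_single_induct)
    (simp_all add: freegen_def mult_single free_pairing_single free_pairing_add distrib_left
      word_fun_Cons del: word_fun.simps)

lemma free_pairing_1: "free_pairing 1 X = counit X"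
  using free_pairing_single[of 0 1 X] by simp

lemma free_pairing_gen: "free_pairing (freegen (entry a b)) X = gen_fun (entry a b) X"
  using free_pairing_gen_right[of 1 a b X] by (simp add: free_pairing_1 counit_right_slice)

text \<open>Multiplying an element on either side replaces its functional by a composition with slices.\<close>

lemma free_pairing_ideal:
  assumes "\<And>X. free_pairing s X = 0"
  shows "free_pairing (p * s * q) X = 0"
proof -
  have right: "\<forall>s. (\<forall>X. free_pairing s X = 0) \<longrightarrow> (\<forall>X. free_pairing (s * q) X = 0)"
  proof (induction q rule: free_algebra_induct)
    case (scalar c)
    show ?case by (simp add: free_pairing_scal flip: freescal_central)
  next
    case (gen g)
    show ?case by (rule entry_cases[of g]) (simp add: free_pairing_gen_right)
  next
    case (mult q q')
    then show ?case by (simp flip: mult.assoc)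
  qed (simp add: distrib_left free_pairing_add)
  have left: "\<forall>s. (\<forall>X. free_pairing s X = 0) \<longrightarrow> (\<forall>X. free_pairing (p * s) X = 0)"
  proof (induction p rule: free_algebra_induct)
    case (scalar c)
    show ?case by (simp add: free_pairing_scal)
  next
    case (gen g)
    show ?case by (rule entry_cases[of g]) (simp add: free_pairing_gen_left)
  next
    case (mult p p')
    then show ?case by (simp add: mult.assoc)
  qed (simp add: distrib_right free_pairing_add)
  show ?thesis using left right assms by blast
qed

definition fps_real :: "real \<Rightarrow> complex fps" where "fps_real r = fps_const (of_real r)"

lemma spin_coeff_add: "spin_coeff j m' m (X + Y) = spin_coeff j m' m X + spin_coeff j m' m Y"
  by (rule hlinearD(1)[OF hlinear_spin_coeff])

lemma spin_coeff_fps_X: "spin_coeff j m' m (fps_X * X) = fps_X * spin_coeff j m' m X"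
  by (rule hlinearD(2)[OF hlinear_spin_coeff])

lemma spin_coeff_0 [simp]: "spin_coeff j m' m 0 = 0"
  using spin_coeff_add[of j m' m 0 0] by simp

lemma spin_coeff_uminus: "spin_coeff j m' m (- X) = - spin_coeff j m' m X"
  using spin_coeff_add[of j m' m X "- X"] by (simp add: eq_neg_iff_add_eq_0 add.commute)

lemma spin_coeff_diff: "spin_coeff j m' m (X - Y) = spin_coeff j m' m X - spin_coeff j m' m Y"
  using spin_coeff_add[of j m' m X "- Y"] by (simp add: spin_coeff_uminus)

lemma spin_J0_left: "spin j m' m (ugen GJ0 * x) = of_real (2 * m') * spin j m' m x"
proof (cases "m' \<in> weights j")
  case True
  have "spin j m' m (ugen GJ0 * x)
      = (\<Sum>l\<in>weights j. if m' = l then of_real (2 * l) * spin j l m x else 0)"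
    unfolding spin_mult by (intro sum.cong) (auto simp: spin_ugen)
  then show ?thesis using True finite_weights by simp
qed (simp add: spin_outside)

lemma spin_J0_right: "spin j m' m (x * ugen GJ0) = of_real (2 * m) * spin j m' m x"
proof (cases "m \<in> weights j")
  case True
  have "spin j m' m (x * ugen GJ0)
      = (\<Sum>l\<in>weights j. if l = m then of_real (2 * l) * spin j m' l x else 0)"
    unfolding spin_mult using True by (intro sum.cong) (auto simp: spin_ugen)
  then show ?thesis using True finite_weights by simp
qed (simp add: spin_outside)

lemma spin_coeff_hJ0_left:
  "spin_coeff j m' m (hJ0 * X) = fps_X * fps_real (2 * m') * spin_coeff j m' m X"
proof -
  have "spin_coeff j m' m (J0h * X) = fps_real (2 * m') * spin_coeff j m' m X"
    by (rule fps_ext) (simp add: spin_coeff_def spin_J0_left fps_real_def)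
  then show ?thesis by (simp add: hJ0_def mult.assoc spin_coeff_fps_X)
qed

lemma spin_coeff_hJ0_right:
  "spin_coeff j m' m (X * hJ0) = fps_X * fps_real (2 * m) * spin_coeff j m' m X"
proof -
  have "spin_coeff j m' m (X * J0h) = fps_real (2 * m) * spin_coeff j m' m X"
    by (rule fps_ext) (simp add: spin_coeff_def spin_J0_right fps_real_def)
  then show ?thesis by (simp add: hJ0_def mult.assoc fps_X_left spin_coeff_fps_X)
qed

definition htensor_coeff :: "real \<Rightarrow> real \<Rightarrow> bool \<Rightarrow> real \<Rightarrow> bool \<Rightarrow> uh \<Rightarrow> complex fps" where
  "htensor_coeff l p c q d X = spin_coeff l p q (Thetah c d X)"

text \<open>The origin of all terms with \<open>h\<close> in the recurrence relations: the twist acts on the weight vectors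
of spin \<open>l\<close> through \<open>J\<^sub>0\<close> alone.\<close>

lemma spin_coeff_right_slice:
  "spin_coeff l p q (right_slice False True X) = htensor_coeff l p False q True X"
  "spin_coeff l p q (right_slice True True X) = htensor_coeff l p True q True X
     - fps_X * fps_real (2 * p) * htensor_coeff l p False q True X"
  "spin_coeff l p q (right_slice False False X) = htensor_coeff l p False q False X
     + fps_X * fps_real (2 * q) * htensor_coeff l p False q True X"
  "spin_coeff l p q (right_slice True False X) = htensor_coeff l p True q False X
     - fps_X * fps_real (2 * p) * htensor_coeff l p False q False X
     + fps_X * fps_real (2 * q) * (htensor_coeff l p True q True X - fps_X * fps_real (2 * p) * htensor_coeff
         l p False q True X)"
  by (simp_all add: right_slice_def right_twist_def right_twist_inv_def UNIV_bool spin_coeff_add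
      spin_coeff_uminus spin_coeff_diff
      spin_coeff_hJ0_left spin_coeff_hJ0_right htensor_coeff_def mult.assoc right_diff_distrib)

lemma htensor_coeff_nth: "htensor_coeff l p c q d X $ n = tensor_coeff l p c q d (X $ n)"
  by (simp add: htensor_coeff_def spin_coeff_def Thetah_def tensor_coeff_def)

lemma htensor_coeff_row:
  "(\<Sum>d\<in>UNIV. fps_real (cg up j d m) * htensor_coeff (j - half up) p c (m - half d) d X)
    = fps_real (cg up j c (p + half c)) * spin_coeff j (p + half c) m X"
  by (rule fps_ext) (simp add: fps_sum_nth fps_real_def htensor_coeff_nth clebsch_gordan spin_coeff_def)

lemma htensor_coeff_column:
  "(\<Sum>c\<in>UNIV. fps_real (cg up j c m) * htensor_coeff (j - half up) (m - half c) c q d X)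
    = fps_real (cg up j d (q + half d)) * spin_coeff j m (q + half d) X"
  by (rule fps_ext) (simp add: fps_sum_nth fps_real_def htensor_coeff_nth clebsch_gordan_transposed
      spin_coeff_def)

lemma weights_0: "weights 0 = {0}"
  by (auto simp: weights_def Nats_def)

lemma spin_0_ueps: "spin 0 0 0 x = ueps x"
proof (induction x rule: usl2_induct)
  case (scalar c)
  show ?case by (simp add: spin_uscal weights_0 ueps_uscal)
next
  case (gen g)
  show ?case by (cases g) (simp_all add: spin_ugen weights_0 ueps_ugen)
qed (simp_all add: spin_add spin_mult weights_0 ueps_add ueps_mult)

lemma counit_spin_coeff: "counit = spin_coeff 0 0 0"
  by (simp add: counit_def spin_coeff_def spin_0_ueps fun_eq_iff)

text \<open>The untwisted product of two spin \<open>1/2\<close> matrix elements.\<close>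

definition fund_pair :: "bool \<Rightarrow> bool \<Rightarrow> bool \<Rightarrow> bool \<Rightarrow> uh \<Rightarrow> complex fps" where
  "fund_pair a b c d X = counit (Thetah a b (Thetah c d X))"

lemma fund_pair_commute: "fund_pair a b c d X = fund_pair c d a b X"
  by (simp add: fund_pair_def Thetah_commute)

lemma htensor_coeff_half: "htensor_coeff (1/2) (half a) c (half b) d X = fund_pair a b c d X"
  by (simp add: htensor_coeff_def fund_pair_def counit_Thetah gen_fun_entry)

text \<open>The Clebsch-Gordan relation for the trivial summand of \<open>1/2 \<otimes> 1/2\<close>.\<close>

lemma fund_pair_determinant:
  "fund_pair True True False False X - fund_pair True False False True X = counit X"
proof -
  have "fund_pair True False False True X - fund_pair True True False False X = - counit X"
    using htensor_coeff_row[of False 0 0 "1/2" False X] htensor_coeff_half[of True False True False X]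
      htensor_coeff_half[of True False False True X]
    by (simp add: UNIV_bool cg_def fps_real_def counit_spin_coeff flip: fps_const_neg)
  then show ?thesis by (metis minus_diff_eq minus_minus)
qed

lemma free_pairing_entry:
  "free_pairing (p * freegen GX) X = free_pairing p (right_slice True True X)"
  "free_pairing (p * freegen GU) X = free_pairing p (right_slice True False X)"
  "free_pairing (p * freegen GV) X = free_pairing p (right_slice False True X)"
  "free_pairing (p * freegen GY) X = free_pairing p (right_slice False False X)"
  using free_pairing_gen_right[of p True True X] free_pairing_gen_right[of p True False X]
    free_pairing_gen_right[of p False True X] free_pairing_gen_right[of p False False X]
  by (simp_all add: entry_def)

lemma free_pairing_letter:
  "free_pairing (freegen GX) X = spin_coeff (1/2) (half True) (half True) X"
  "free_pairing (freegen GU) X = spin_coeff (1/2) (half True) (half False) X"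
  "free_pairing (freegen GV) X = spin_coeff (1/2) (half False) (half True) X"
  "free_pairing (freegen GY) X = spin_coeff (1/2) (half False) (half False) X"
  using free_pairing_gen[of True True X] free_pairing_gen[of True False X]
    free_pairing_gen[of False True X] free_pairing_gen[of False False X]
  by (simp_all add: entry_def)

text \<open>Expanding every product by \<open>spin_coeff_right_slice\<close> turns a relation into a linear identity
between untwisted products, which only uses that these commute and have determinant \<open>1\<close>.\<close>

lemma free_pairing_relations:
  assumes "s \<in> slh_rels"
  shows "free_pairing s X = 0"
proof -
  have sym: "fund_pair True False True True X = fund_pair True True True False X"
    "fund_pair False True True True X = fund_pair True True False True X"
    "fund_pair False False True True X = fund_pair True True False False X"
    "fund_pair False True True False X = fund_pair True False False True X"
    "fund_pair False False True False X = fund_pair True False False False X"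
    "fund_pair False False False True X = fund_pair False True False False X"
    by (rule fund_pair_commute)+
  have det: "fund_pair True True False False X = fund_pair True False False True X + counit X"
    using fund_pair_determinant[of X] by (simp add: algebra_simps)
  have r: "fps_real (2 * half True) = 1" "fps_real (2 * half False) = - 1"
    by (simp_all add: fps_real_def flip: fps_const_neg)
  note rules = power2_eq_square free_pairing_diff free_pairing_add free_pairing_scal free_pairing_entry
    free_pairing_letter free_pairing_1 spin_coeff_right_slice htensor_coeff_half r sym det
        mult.assoc[of "freescal fps_X"]
  from assms show ?thesis
    unfolding slh_rels_def Let_def
    by (auto simp only: insert_iff empty_iff rules) (simp_all add: algebra_simps)
qed

lemma free_pairing_tsideal:
  assumes "p \<in> tsideal slh_rels"
  shows "free_pairing p X = 0"
  using assms by induction (simp_all add: free_pairing_add free_pairing_ideal free_pairing_relations)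

lemma pairing_abs: "pairing (abs_slh2 p) X = free_pairing p X"
proof -
  have "rep_slh2 (abs_slh2 p) - p \<in> tsideal slh_rels"
    using Quotient_rep_abs[OF Quotient_slh2, of p] by (simp add: tsideal.zero)
  from free_pairing_tsideal[OF this, of X] show ?thesis
    by (simp add: pairing_def free_pairing_diff)
qed

lemma slh2_abs_cases: obtains p where "a = abs_slh2 p"
  by (metis Quotient_abs_rep Quotient_slh2)

lemma pairing_add: "pairing (a + b) X = pairing a X + pairing b X"
  by (rule slh2_abs_cases[of a], rule slh2_abs_cases[of b])
    (simp add: plus_slh2.abs_eq pairing_abs free_pairing_add)

lemma pairing_0 [simp]: "pairing 0 X = 0"
  using pairing_add[of 0 0 X] by simp

lemma pairing_uminus: "pairing (- a) X = - pairing a X"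
  using pairing_add[of a "- a" X] by (simp add: eq_neg_iff_add_eq_0 add.commute)

lemma pairing_diff: "pairing (a - b) X = pairing a X - pairing b X"
  using pairing_add[of a "- b" X] by (simp add: pairing_uminus)

lemma pairing_sscal: "pairing (sscal c * a) X = c * pairing a X"
  by (rule slh2_abs_cases[of a])
    (simp add: sscal.abs_eq times_slh2.abs_eq pairing_abs free_pairing_scal)

lemma pairing_1: "pairing 1 X = counit X"
  by (simp add: one_slh2.abs_eq pairing_abs free_pairing_1)

lemma pairing_slgen: "pairing (a * slgen (entry c d)) X = pairing a (right_slice c d X)"
  by (rule slh2_abs_cases[of a])
    (simp add: slgen.abs_eq times_slh2.abs_eq pairing_abs free_pairing_gen_right)

section \<open>Separating matrix elements\<close>

definition casimir :: usl2 where
  "casimir = ugen GJm * ugen GJp + uscal (1/4) * (ugen GJ0 * ugen GJ0) + uscal (1/2) * ugen GJ0"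

lemma spin_casimir: "spin j m' m (casimir * x) = of_real (j * (j + 1)) * spin j m' m x"
proof (cases "m' \<in> weights j")
  case True
  have "spin j m' l casimir = (if m' = l then of_real (j * (j + 1)) else 0)" if l: "l \<in> weights j" for l
  proof -
    have "spin j m' l (ugen GJm * ugen GJp)
        = (\<Sum>k\<in>weights j. spin_gen j GJm m' k * spin_gen j GJp k l)"
      unfolding spin_mult by (intro sum.cong refl) (simp only: spin_ugen True l simp_thms if_True)
    then have 1: "spin j m' l (ugen GJm * ugen GJp) = (if m' = l then of_real ((j - l) * (j + l + 1)) else 0)"
      by (simp only: spin_gen_updown(2)[OF l])
    have "spin j m' l (ugen GJ0) = (if m' = l then of_real (2 * l) else 0)"
      using True l by (simp add: spin_ugen)
    then show ?thesis
      unfolding casimir_def spin_add 1 spin_uscal_mult spin_J0_left by (simp add: algebra_simps)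
  qed
  then have "spin j m' m (casimir * x)
      = (\<Sum>l\<in>weights j. if m' = l then of_real (j * (j + 1)) * spin j l m x else 0)"
    unfolding spin_mult by (intro sum.cong refl) simp
  then show ?thesis using True finite_weights by simp
qed (simp add: spin_outside)

lemma spin_raise_neq_0:
  assumes "q \<in> weights j" "q + real n \<in> weights j"
  shows "spin j (q + real n) q (ugen GJp ^ n) \<noteq> 0"
  using assms(2)
proof (induction n)
  case 0
  then show ?case by (simp add: spin_1)
next
  case (Suc n)
  \<comment> \<open>A number between two weights at integral distance from them is a weight.\<close>
  have "j + (q + real n) = (j + q) + real n" "j - (q + real n) = (j - (q + real (Suc n))) + 1" by simp_all
  then have n: "q + real n \<in> weights j"
    using assms(1) Suc.prems unfolding weights_def mem_Collect_eq by (metis Nats_add Nats_1 of_nat_in_Nats)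
  have "spin j (q + real (Suc n)) q (ugen GJp ^ Suc n) = (\<Sum>l\<in>weights j. if l = q + real n
      then spin_gen j GJp (q + real (Suc n)) l * spin j l q (ugen GJp ^ n) else 0)"
    unfolding power_Suc spin_mult using Suc.prems by (intro sum.cong) (auto simp: spin_ugen)
  also have "\<dots> = spin_gen j GJp (q + real (Suc n)) (q + real n) * spin j (q + real n) q (ugen GJp ^ n)"
    using n finite_weights by simp
  also have "\<dots> \<noteq> 0"
  proof -
    have "0 < (j - (q + real n)) * (j + (q + real n) + 1)"
      using weights_bounds[OF n] weights_bounds[OF Suc.prems] by (intro mult_pos_pos) auto
    then have "sqrt ((j - (q + real n)) * (j + (q + real n) + 1)) \<noteq> 0"
      by (metis less_irrefl real_sqrt_gt_0_iff)
    moreover have "spin_gen j GJp (q + real (Suc n)) (q + real n)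
        = of_real (sqrt ((j - (q + real n)) * (j + (q + real n) + 1)))"
      by (simp del: real_sqrt_mult)
    ultimately show ?thesis using Suc.IH[OF n] by (metis mult_eq_0_iff of_real_eq_0_iff)
  qed
  finally show ?case .
qed

lemma spin_neq_0:
  assumes "p \<in> weights j" "q \<in> weights j"
  shows "\<exists>x. spin j p q x \<noteq> 0"
proof -
  have *: "\<exists>x. spin j p q x \<noteq> 0" if "p \<in> weights j" "q \<in> weights j" "q \<le> p" for p q
  proof -
    obtain a b where "j + p = real a" "j + q = real b"
      using \<open>p \<in> weights j\<close> \<open>q \<in> weights j\<close> by (auto simp: weights_def Nats_def)
    then have "p = q + real (a - b)" using \<open>q \<le> p\<close> by simp
    then show ?thesis using spin_raise_neq_0[of q j "a - b"] that by metis
  qed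
  show ?thesis
  proof (cases "q \<le> p")
    case False
    then obtain x where "spin j q p x \<noteq> 0" using *[of q p] assms by auto
    then show ?thesis using transpose_exists[of x] by metis
  qed (use * assms in blast)
qed

abbreviation spin3 :: "real \<times> real \<times> real \<Rightarrow> usl2 \<Rightarrow> complex" where
  "spin3 t \<equiv> spin (fst t) (fst (snd t)) (snd (snd t))"

definition weight_triples :: "(real \<times> real \<times> real) set" where
  "weight_triples = {(j, p, q). p \<in> weights j \<and> q \<in> weights j}"

text \<open>Left and right multiplication by \<open>J\<^sub>0\<close> and multiplication by the Casimir element act on a matrix
element by scalars, and together these scalars determine the indices. So a further matrix element
can be made to vanish by subtracting its eigenvalue from a suitable one of the three operators.\<close>

lemma spin_separate:
  assumes "finite S" "S \<subseteq> weight_triples" "t \<in> weight_triples" "t \<notin> S"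
  shows "\<exists>x. spin3 t x \<noteq> 0 \<and> (\<forall>s\<in>S. spin3 s x = 0)"
  using assms
proof (induction S rule: finite_induct)
  case empty
  then show ?case using spin_neq_0 by (auto simp: weight_triples_def)
next
  case (insert s S)
  then obtain x where x: "spin3 t x \<noteq> 0" "\<forall>s\<in>S. spin3 s x = 0" by auto
  obtain j p q i p' q' where ts: "t = (j, p, q)" "s = (i, p', q')" by (cases t; cases s) auto
  have nonneg: "0 \<le> j" "0 \<le> i"
    using insert.prems weights_bounds[of p j] weights_bounds[of p' i] by (auto simp: ts weight_triples_def)
  have j: "j * (j + 1) \<noteq> i * (i + 1)" if "i \<noteq> j"
  proof -
    have "j * (j + 1) - i * (i + 1) = (j - i) * (j + i + 1)" by (simp add: algebra_simps)
    moreover have "(j - i) * (j + i + 1) \<noteq> 0" using that nonneg by auto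
    ultimately show ?thesis by linarith
  qed
  note eig = spin_diff spin_uscal_mult spin_casimir spin_J0_left spin_J0_right ts
  consider "i \<noteq> j" | "p' \<noteq> p" | "q' \<noteq> q" using insert.prems by (auto simp: ts)
  then show ?case
  proof cases
    case 1
    show ?thesis
      by (rule exI[of _ "casimir * x - uscal (of_real (i * (i + 1))) * x"])
        (use x j[OF 1] in \<open>auto simp: eig simp flip: of_real_mult of_real_add\<close>)
  next
    case 2
    show ?thesis
      by (rule exI[of _ "ugen GJ0 * x - uscal (of_real (2 * p')) * x"])
        (use x 2 in \<open>auto simp: eig\<close>)
  next
    case 3
    show ?thesis
      by (rule exI[of _ "x * ugen GJ0 - uscal (of_real (2 * q')) * x"])
        (use x 3 in \<open>auto simp: eig\<close>)
  qed
qed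

lemma finite_weight_triples: "finite {t \<in> weight_triples. fst t \<le> real N}"
proof -
  have "{t \<in> weight_triples. fst t \<le> real N} \<subseteq> (\<Union>i\<in>(\<lambda>n. real n / 2) ` {..2 * N}. {i} \<times> weights i \<times> weights i)"
  proof
    fix t assume t: "t \<in> {t \<in> weight_triples. fst t \<le> real N}"
    obtain i p q where ipq: "t = (i, p, q)" by (cases t)
    with t have p: "p \<in> weights i" "q \<in> weights i" and i: "i \<le> real N" by (auto simp: weight_triples_def)
    obtain a b where "i + p = real a" "i - p = real b"
      using p(1) by (auto simp: weights_def Nats_def)
    then have "i = real (a + b) / 2" by simp
    moreover from this i have "real (a + b) \<le> real (2 * N)" by simp
    then have "a + b \<le> 2 * N" by (simp only: of_nat_le_iff)
    ultimately have "i \<in> (\<lambda>n. real n / 2) ` {..2 * N}" by blast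
    then show "t \<in> (\<Union>i\<in>(\<lambda>n. real n / 2) ` {..2 * N}. {i} \<times> weights i \<times> weights i)"
      using p ipq by blast
  qed
  then show ?thesis by (rule finite_subset) (auto intro: finite_weights)
qed

section \<open>Leading matrix elements of words\<close>

lemma fps_real_mult: "fps_real a * fps_real b = fps_real (a * b)"
  by (simp add: fps_real_def)

lemma fps_real_add: "fps_real a + fps_real b = fps_real (a + b)"
  by (simp add: fps_real_def)

lemma fps_real_uminus: "fps_real (- a) = - fps_real a"
  by (simp add: fps_real_def)

lemma fps_real_eq_0: "fps_real a = 0 \<longleftrightarrow> a = 0"
  by (simp add: fps_real_def fps_const_eq_0_iff)

text \<open>The matrix of Clebsch-Gordan coefficients is orthogonal up to the factor \<open>2l + 1\<close>, which inverts
the relations \<open>htensor_coeff_row\<close> for the two values of \<open>j\<close>.\<close>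

lemma htensor_coeff_expand:
  assumes "q \<in> weights l"
  shows "fps_real (2 * l + 1) * htensor_coeff l p c q d X =
      fps_real (cg True (l + 1/2) d (q + half d) * cg True (l + 1/2) c (p + half c))
        * spin_coeff (l + 1/2) (p + half c) (q + half d) X
    + fps_real (cg False (l - 1/2) d (q + half d) * cg False (l - 1/2) c (p + half c))
        * spin_coeff (l - 1/2) (p + half c) (q + half d) X"
proof -
  define m where "m = q + half d"
  define A B where "A = cg True (l + 1/2) True m" and "B = cg True (l + 1/2) False m"
  \<comment> \<open>For \<open>l - 1/2\<close> the same two numbers occur, exchanged and with one sign changed.\<close>
  have AB: "cg False (l - 1/2) True m = B" "cg False (l - 1/2) False m = - A"
    by (simp_all add: A_def B_def cg_def algebra_simps)
  let ?T = "\<lambda>d. htensor_coeff l p c (m - half d) d X"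
  have 1: "fps_real A * ?T True + fps_real B * ?T False
      = fps_real (cg True (l + 1/2) c (p + half c)) * spin_coeff (l + 1/2) (p + half c) m X"
    using htensor_coeff_row[of True "l + 1/2" m p c X] by (simp add: UNIV_bool A_def B_def add.commute)
  have 2: "fps_real B * ?T True - fps_real A * ?T False
      = fps_real (cg False (l - 1/2) c (p + half c)) * spin_coeff (l - 1/2) (p + half c) m X"
    using htensor_coeff_row[of False "l - 1/2" m p c X] by (simp add: UNIV_bool AB fps_real_uminus)
  have "0 \<le> l + 1/2 + m" "0 \<le> l + 1/2 - m"
    using weights_bounds[OF assms] by (cases d; simp add: m_def)+
  then have sq: "A * A + B * B = 2 * l + 1"
    by (simp add: A_def B_def cg_def)
  have "fps_real A * (fps_real A * ?T True + fps_real B * ?T False) + fps_real B * (fps_real B * ?T True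
      - fps_real A * ?T False)
      = (fps_real A * fps_real A + fps_real B * fps_real B) * ?T True"
    "fps_real B * (fps_real A * ?T True + fps_real B * ?T False) - fps_real A * (fps_real B * ?T True
        - fps_real A * ?T False)
      = (fps_real A * fps_real A + fps_real B * fps_real B) * ?T False"
    by (simp_all add: algebra_simps)
  then have *: "fps_real (2 * l + 1) * ?T True = fps_real A * (fps_real A * ?T True + fps_real B * ?T False)
        + fps_real B * (fps_real B * ?T True - fps_real A * ?T False)"
    "fps_real (2 * l + 1) * ?T False = fps_real B * (fps_real A * ?T True + fps_real B * ?T False)
        - fps_real A * (fps_real B * ?T True - fps_real A * ?T False)"
    by (simp_all add: fps_real_mult fps_real_add sq)
  have "fps_real (2 * l + 1) * ?T d =
      fps_real (cg True (l + 1/2) d m * cg True (l + 1/2) c (p + half c)) * spin_coeff (l + 1/2) (p + half c)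
          m X
    + fps_real (cg False (l - 1/2) d m * cg False (l - 1/2) c (p + half c)) * spin_coeff (l - 1/2) (p
        + half c) m X"
    using *[unfolded 1 2]
    by (cases d) (simp_all add: AB fps_real_uminus mult.assoc flip: fps_real_mult A_def B_def)
  then show ?thesis by (simp add: m_def)
qed

text \<open>Matrix elements \<open>(i, p, q)\<close> are ordered by \<open>i\<close> and then by \<open>p - q\<close>. A functional with all
components below \<open>(j, d)\<close> vanishes on the elements described here; this is how lower terms are
expressed without naming their coefficients.\<close>

definition killed :: "real \<Rightarrow> real \<Rightarrow> uh \<Rightarrow> bool" where
  "killed j d X \<longleftrightarrow> (\<forall>i p q. i < j \<or> i = j \<and> p - q < d \<longrightarrow> spin_coeff i p q X = 0)"

lemma spin_coeff_outside: "p \<notin> weights j \<or> q \<notin> weights j \<Longrightarrow> spin_coeff j p q X = 0"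
  by (rule fps_ext) (simp add: spin_coeff_def spin_outside)

lemma htensor_coeff_killed:
  assumes "killed (l + 1/2) e X" "i < l \<or> i = l \<and> p + half c - (q + half d) < e"
  shows "htensor_coeff i p c q d X = 0"
proof (cases "q \<in> weights i")
  case True
  have "spin_coeff (i + 1/2) (p + half c) (q + half d) X = 0"
    "spin_coeff (i - 1/2) (p + half c) (q + half d) X = 0"
    using assms by (auto simp: killed_def)
  then have "fps_real (2 * i + 1) * htensor_coeff i p c q d X = 0"
    using htensor_coeff_expand[OF True, of p c d X] by simp
  moreover have "2 * i + 1 \<noteq> 0" using weights_bounds[OF True] by auto
  ultimately show ?thesis by (simp add: fps_real_eq_0)
qed (simp add: htensor_coeff_def spin_coeff_outside)

text \<open>The twist only contributes terms with smaller \<open>p - q\<close>, so right convolution with a generator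
respects the order.\<close>

lemma killed_right_slice:
  assumes "killed (l + 1/2) (e + (half a - half b)) X"
  shows "killed l e (right_slice a b X)"
  unfolding killed_def
proof (intro allI impI)
  fix i p q assume *: "i < l \<or> i = l \<and> p - q < e"
  then have "htensor_coeff i p c q d X = 0" if "half c - half d \<le> half a - half b" for c d
    using that by (intro htensor_coeff_killed[OF assms]) auto
  then show "spin_coeff i p q (right_slice a b X) = 0"
    by (cases a; cases b) (simp_all add: spin_coeff_right_slice)
qed

text \<open>The leading term is the component of spin \<open>l + 1/2\<close> in the untwisted product with the same
generator. Its coefficient is a product of two square roots of positive numbers, divided by
\<open>2l + 1\<close>.\<close>

lemma spin_coeff_right_slice_leading:
  assumes "p \<in> weights l" "q \<in> weights l"
  shows "\<exists>r. r \<noteq> 0 \<and> (\<forall>X. killed (l + 1/2) (p - q + (half a - half b)) X \<longrightarrow>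
    spin_coeff l p q (right_slice a b X) = fps_real r * spin_coeff (l + 1/2) (p + half a) (q + half b) X)"
proof -
  let ?r = "cg True (l + 1/2) b (q + half b) * cg True (l + 1/2) a (p + half a)"
  have pos: "0 \<le> l + p" "0 \<le> l - p" "0 \<le> l + q" "0 \<le> l - q" "2 * l + 1 > 0"
    using weights_bounds[OF assms(1)] weights_bounds[OF assms(2)] by auto
  have r: "?r \<noteq> 0"
    using pos by (cases a; cases b; simp add: cg_def)
  show ?thesis
  proof (intro exI[of _ "?r / (2 * l + 1)"] conjI allI impI)
    show "?r / (2 * l + 1) \<noteq> 0" using r pos by simp
    fix X assume X: "killed (l + 1/2) (p - q + (half a - half b)) X"
    have "htensor_coeff l p c q d X = 0" if "half c - half d < half a - half b" for c d
      using that by (intro htensor_coeff_killed[OF X]) auto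
    then have 1: "spin_coeff l p q (right_slice a b X) = htensor_coeff l p a q b X"
      by (cases a; cases b) (simp_all add: spin_coeff_right_slice)
    have "spin_coeff (l - 1/2) (p + half a) (q + half b) X = 0"
      using X by (simp add: killed_def)
    then have "fps_real (2 * l + 1) * htensor_coeff l p a q b X
        = fps_real ?r * spin_coeff (l + 1/2) (p + half a) (q + half b) X"
      using htensor_coeff_expand[OF assms(2), of p a b X] by simp
    then have "fps_real (1 / (2 * l + 1)) * (fps_real (2 * l + 1) * htensor_coeff l p a q b X)
        = fps_real (1 / (2 * l + 1)) * (fps_real ?r * spin_coeff (l + 1/2) (p + half a) (q + half b) X)"
      by simp
    then show "spin_coeff l p q (right_slice a b X)
        = fps_real (?r / (2 * l + 1)) * spin_coeff (l + 1/2) (p + half a) (q + half b) X"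
      using pos unfolding 1 by (simp only: mult.assoc[symmetric] fps_real_mult) (simp add: fps_real_def)
  qed
qed

definition monomial :: "slh_gen list \<Rightarrow> slh2" where
  "monomial w = prod_list (map slgen w)"

lemma monomial_simps [simp]: "monomial [] = 1" "monomial (g # w) = slgen g * monomial w"
  "monomial (v @ w) = monomial v * monomial w"
  by (simp_all add: monomial_def)

primrec row_weight :: "slh_gen \<Rightarrow> real" where
  "row_weight GX = 1/2" | "row_weight GU = 1/2" | "row_weight GV = -1/2" | "row_weight GY = -1/2"

primrec col_weight :: "slh_gen \<Rightarrow> real" where
  "col_weight GX = 1/2" | "col_weight GU = -1/2" | "col_weight GV = 1/2" | "col_weight GY = -1/2"

lemma weight_entry: "row_weight (entry a b) = half a" "col_weight (entry a b) = half b"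
  by (cases a; cases b; simp add: entry_def)+

text \<open>The index of the leading matrix element in the functional of a word.\<close>

definition leading :: "slh_gen list \<Rightarrow> real \<times> real \<times> real" where
  "leading w = (real (length w) / 2, sum_list (map row_weight w), sum_list (map col_weight w))"

abbreviation weight_diff :: "slh_gen list \<Rightarrow> real" where
  "weight_diff w \<equiv> sum_list (map row_weight w) - sum_list (map col_weight w)"

lemma half_weights_add:
  assumes "p \<in> weights l"
  shows "p + half c \<in> weights (l + 1/2)"
proof -
  have "l + p \<in> \<nat>" "l - p \<in> \<nat>" using assms by (auto simp: weights_def)
  then have "(l + 1/2) + (p + half c) \<in> \<nat> \<and> (l + 1/2) - (p + half c) \<in> \<nat>"
    by (cases c) (use Nats_add1[of "l + p"] Nats_add1[of "l - p"] in \<open>simp_all add: algebra_simps\<close>)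
  then show ?thesis by (simp add: weights_def)
qed

lemma leading_weight_triples: "leading w \<in> weight_triples"
proof (induction w rule: rev_induct)
  case Nil
  show ?case by (simp add: leading_def weight_triples_def weights_0)
next
  case (snoc g w)
  obtain a b where g: "g = entry a b" by (rule entry_cases)
  have "leading (w @ [g]) = (real (length w) / 2 + 1/2, fst (snd (leading w)) + half a, snd (snd (leading w))
      + half b)"
    by (simp add: leading_def g weight_entry add_divide_distrib)
  moreover have "fst (snd (leading w)) \<in> weights (real (length w) / 2)"
      "snd (snd (leading w)) \<in> weights (real (length w) / 2)"
    using snoc by (auto simp: leading_def weight_triples_def)
  ultimately show ?case
    by (simp only: weight_triples_def mem_Collect_eq prod.case half_weights_add)
qed

text \<open>Letter by letter: each right convolution multiplies the leading coefficient by a nonzero number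
and does not bring lower matrix elements up.\<close>

lemma pairing_monomial_leading:
  "\<exists>r. r \<noteq> 0 \<and> (\<forall>X. killed (real (length w) / 2) (weight_diff w) X \<longrightarrow>
    pairing (monomial w) X = fps_real r * spin_coeff (fst (leading w)) (fst (snd (leading w)))
        (snd (snd (leading w))) X)"
proof (induction w rule: rev_induct)
  case Nil
  show ?case
    by (rule exI[of _ 1]) (simp add: leading_def pairing_1 counit_spin_coeff fps_real_def)
next
  case (snoc g w)
  obtain a b where g: "g = entry a b" by (rule entry_cases)
  let ?l = "real (length w) / 2" and ?p = "sum_list (map row_weight w)" and ?q = "sum_list (map col_weight w)"
  obtain r where r: "r \<noteq> 0" "\<And>X. killed ?l (?p - ?q) X \<Longrightarrow> pairing (monomial w) X
      = fps_real r * spin_coeff ?l ?p ?q X"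
    using snoc by (auto simp: leading_def)
  have "?p \<in> weights ?l" "?q \<in> weights ?l" using leading_weight_triples[of w]
  by (simp_all add: leading_def weight_triples_def)
  then obtain s where s: "s \<noteq> 0" "\<And>X. killed (?l + 1/2) (?p - ?q + (half a - half b)) X \<Longrightarrow>
      spin_coeff ?l ?p ?q (right_slice a b X) = fps_real s * spin_coeff (?l + 1/2) (?p + half a) (?q + half b)
          X"
    using spin_coeff_right_slice_leading by meson
  have l: "real (length (w @ [g])) / 2 = ?l + 1/2" by (simp add: add_divide_distrib)
  have d: "weight_diff (w @ [g]) = ?p - ?q + (half a - half b)" by (simp add: g weight_entry)
  have t: "leading (w @ [g]) = (?l + 1/2, ?p + half a, ?q + half b)"
    by (simp add: leading_def l[simplified] g weight_entry)
  show ?case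
    unfolding l d t fst_conv snd_conv
  proof (intro exI[of _ "r * s"] conjI allI impI)
    show "r * s \<noteq> 0" using r s by simp
    fix X assume X: "killed (?l + 1/2) (?p - ?q + (half a - half b)) X"
    have "pairing (monomial (w @ [g])) X = pairing (monomial w) (right_slice a b X)"
      by (simp add: g pairing_slgen)
    also have "\<dots> = fps_real r * spin_coeff ?l ?p ?q (right_slice a b X)"
      by (rule r(2)[OF killed_right_slice[OF X]])
    also have "\<dots> = fps_real (r * s) * spin_coeff (?l + 1/2) (?p + half a) (?q + half b) X"
      by (simp add: s(2)[OF X] mult.assoc flip: fps_real_mult)
    finally show "pairing (monomial (w @ [g])) X
        = fps_real (r * s) * spin_coeff (?l + 1/2) (?p + half a) (?q + half b) X" .
  qed
qed

lemma pairing_sum: "pairing (sum f S) X = (\<Sum>s\<in>S. pairing (f s) X)"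
  by (induction S rule: infinite_finite_induct) (simp_all add: pairing_add)

text \<open>Among the words with nonzero coefficient, take one whose leading matrix element is maximal, and an
element on which that matrix element is nonzero while all others up to the given spin vanish. Only
the chosen word has a nonzero value there.\<close>

lemma monomials_independent:
  assumes S: "finite S" "inj_on leading S" and zero: "\<And>X. pairing (\<Sum>w\<in>S. sscal (c w) * monomial w) X = 0"
  shows "\<forall>w\<in>S. c w = 0"
proof (rule ccontr)
  assume "\<not> (\<forall>w\<in>S. c w = 0)"
  define S' where "S' = {w \<in> S. c w \<noteq> 0}"
  have S': "finite S'" "S' \<noteq> {}" "S' \<subseteq> S"
    using \<open>\<not> (\<forall>w\<in>S. c w = 0)\<close> S by (auto simp: S'_def)
  define L where "L = Max (length ` S')"
  define S'' where "S'' = {w \<in> S'. length w = L}"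
  have "L \<in> length ` S'" unfolding L_def using S' by (intro Max_in) auto
  then have S'': "finite S''" "S'' \<noteq> {}" using S' by (auto simp: S''_def)
  have "Max (weight_diff ` S'') \<in> weight_diff ` S''" using S'' by (intro Max_in) auto
  then obtain w0 where w0: "w0 \<in> S''" "weight_diff w0 = Max (weight_diff ` S'')" by auto
  have max: "length w \<le> L" "length w = L \<Longrightarrow> weight_diff w \<le> weight_diff w0" if "w \<in> S'" for w
    using that S' S'' by (auto simp: w0(2) L_def S''_def)
  have len: "length w0 = L" and w0S: "w0 \<in> S'" using w0 by (auto simp: S''_def)
  define U where "U = {t \<in> weight_triples. fst t \<le> real L} - {leading w0}"
  have "\<exists>x. spin3 (leading w0) x \<noteq> 0 \<and> (\<forall>s\<in>U. spin3 s x = 0)"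
    by (rule spin_separate) (use finite_weight_triples[of L] leading_weight_triples in \<open>auto simp: U_def\<close>)
  then obtain x where x: "spin3 (leading w0) x \<noteq> 0" "\<And>s. s \<in> U \<Longrightarrow> spin3 s x = 0" by blast
  have U0: "spin_coeff i p q (fps_const x) = 0" if "i \<le> real L" "(i, p, q) \<noteq> leading w0" for i p q
  proof (cases "(i, p, q) \<in> weight_triples")
    case True
    then show ?thesis using x(2)[of "(i, p, q)"] that by (simp add: U_def spin_coeff_const)
  qed (auto simp: weight_triples_def spin_coeff_outside)
  have killed: "killed (real (length w) / 2) (weight_diff w) (fps_const x)" if w: "w \<in> S'" for w
    unfolding killed_def
  proof (intro allI impI)
    fix i p q assume *: "i < real (length w) / 2 \<or> i = real (length w) / 2 \<and> p - q < weight_diff w"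
    have "(i, p, q) \<noteq> leading w0"
    proof
      assume "(i, p, q) = leading w0"
      then have "i = real L / 2" "p - q = weight_diff w0" by (auto simp: leading_def len)
      then show False using * max[OF w] by auto
    qed
    moreover have "i \<le> real L" using * max(1)[OF w] by auto
    ultimately show "spin_coeff i p q (fps_const x) = 0" by (rule U0[rotated])
  qed
  have other: "pairing (monomial w) (fps_const x) = 0" if w: "w \<in> S'" "w \<noteq> w0" for w
  proof -
    have "leading w \<noteq> leading w0"
      using w w0S S' inj_onD[OF S(2), of w w0] by auto
    then have "spin_coeff (fst (leading w)) (fst (snd (leading w))) (snd (snd (leading w))) (fps_const x) = 0"
      using max(1)[OF w(1)] by (intro U0) (auto simp: leading_def)
    then show ?thesis
      using pairing_monomial_leading[of w] killed[OF w(1)] by auto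
  qed
  have "0 = (\<Sum>w\<in>S. c w * pairing (monomial w) (fps_const x))"
    using zero[of "fps_const x"] by (simp add: pairing_sum pairing_sscal)
  also have "\<dots> = (\<Sum>w\<in>{w0}. c w * pairing (monomial w) (fps_const x))"
    by (rule sum.mono_neutral_right) (use S S' w0S other in \<open>auto simp: S'_def\<close>)
  finally have "c w0 * pairing (monomial w0) (fps_const x) = 0" by simp
  moreover obtain r where "r \<noteq> 0"
      "pairing (monomial w0) (fps_const x) = fps_real r * fps_const (spin3 (leading w0) x)"
    using pairing_monomial_leading[of w0] killed[OF w0S] by (auto simp: spin_coeff_const)
  ultimately show False
    using w0S x(1) by (auto simp: S'_def fps_real_eq_0)
qed

section \<open>Normal words and injectivity of the pairing\<close>

interpretation slh_module: module "\<lambda>c a. sscal c * a"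
  by standard (simp_all add: distrib_left distrib_right sscal.sc_add sscal.sc_mult sscal.sc_1 mult.assoc)

text \<open>The relations, with the determinant set to \<open>1\<close>, solved for products of two letters in the wrong
order and for the products of \<open>u\<close> and \<open>v\<close>. The determinant relation serves to eliminate \<open>uv\<close>
rather than \<open>xy\<close>: then each step below lowers the number of letters \<open>u\<close>, or keeps it and either
lowers the number of letters \<open>x\<close> and \<open>y\<close> or moves letters into order.\<close>

lemma slh2_relations:
  "slv * slx = slx * slv + slh * (slv * slv)"
  "slv * sly = sly * slv + slh * (slv * slv)"
  "slu * slx = slx * slu + slh * (1 - slx * slx)"
  "slu * sly = sly * slu + slh * (1 - sly * sly)"
  "sly * slx = slx * sly - slh * (slx * slv - sly * slv)"
  "slu * slv = slx * sly - 1 - slh * (slx * slv)"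
  "slv * slu = slx * sly - 1 + slh * (slv * sly)"
proof -
  define D where "D = slx * sly - slu * slv - slh * slx * slv"
  have raw: "(slv * slx - slx * slv) - slh * slv^2 = 0"
    "(slu * slx - slx * slu) - slh * (D - slx^2) = 0"
    "(slv * sly - sly * slv) - slh * slv^2 = 0"
    "(slu * sly - sly * slu) - slh * (D - sly^2) = 0"
    "(slx * sly - sly * slx) - slh * (slx * slv - sly * slv) = 0"
    "(slv * slu - slu * slv) - slh * (slx * slv + slv * sly) = 0"
    "D - 1 = 0"
    unfolding D_def slh_def power2_eq_square
    by (transfer, unfold diff_0_right, rule tsideal_base, simp add: slh_rels_def Let_def power2_eq_square)+
  have D: "D = 1" using raw(7) by simp
  show "slv * slx = slx * slv + slh * (slv * slv)" "slv * sly = sly * slv + slh * (slv * slv)"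
    "slu * slx = slx * slu + slh * (1 - slx * slx)" "slu * sly = sly * slu + slh * (1 - sly * sly)"
    using raw(1-4) by (simp_all add: D power2_eq_square algebra_simps)
  show "sly * slx = slx * sly - slh * (slx * slv - sly * slv)"
    using raw(5) by (simp add: algebra_simps)
  show uv: "slu * slv = slx * sly - 1 - slh * (slx * slv)"
    using D by (simp add: D_def algebra_simps)
  show "slv * slu = slx * sly - 1 + slh * (slv * sly)"
    using raw(6) by (simp add: uv algebra_simps)
qed

text \<open>The right-hand sides of \<open>slh2_relations\<close> as lists of coefficients and words. Products that are not
reduced give the empty list.\<close>

fun reduct :: "slh_gen \<Rightarrow> slh_gen \<Rightarrow> (complex fps \<times> slh_gen list) list" where
  "reduct GU GX = [(1, [GX, GU]), (fps_X, []), (- fps_X, [GX, GX])]"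
| "reduct GU GY = [(1, [GY, GU]), (fps_X, []), (- fps_X, [GY, GY])]"
| "reduct GU GV = [(1, [GX, GY]), (- 1, []), (- fps_X, [GX, GV])]"
| "reduct GV GU = [(1, [GX, GY]), (- 1, []), (fps_X, [GV, GY])]"
| "reduct GY GX = [(1, [GX, GY]), (- fps_X, [GX, GV]), (fps_X, [GY, GV])]"
| "reduct GV GX = [(1, [GX, GV]), (fps_X, [GV, GV])]"
| "reduct GV GY = [(1, [GY, GV]), (fps_X, [GV, GV])]"
| "reduct _ _ = []"

definition reducible :: "slh_gen \<Rightarrow> slh_gen \<Rightarrow> bool" where
  "reducible g h \<longleftrightarrow> reduct g h \<noteq> []"

lemma sscal_uminus: "sscal (- c) = - sscal c"
  using sscal.sc_add[of c "- c"] by (simp add: sscal.sc_0 eq_neg_iff_add_eq_0 add.commute)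

lemma reduct_eq:
  assumes "reducible g h"
  shows "slgen g * slgen h = (\<Sum>(c, u)\<leftarrow>reduct g h. sscal c * monomial u)"
  using assms unfolding reducible_def
  by (cases g; cases h; simp add: slh2_relations sscal.sc_1 sscal_uminus algebra_simps flip: slh_def)

primrec rank :: "slh_gen \<Rightarrow> nat" where
  "rank GX = 0" | "rank GY = 1" | "rank GU = 2" | "rank GV = 2"

text \<open>Moving a letter of small rank to the left lowers this number, as each letter counts with the
number of letters to its right.\<close>

primrec disorder :: "slh_gen list \<Rightarrow> nat" where
  "disorder [] = 0"
| "disorder (g # w) = rank g * length w + disorder w"

lemma disorder_append:
  "disorder (v @ w) = disorder v + sum_list (map rank v) * length w + disorder w"
  by (induction v) (simp_all add: algebra_simps)

text \<open>The rules that keep the number of letters \<open>u\<close> either trade an \<open>x\<close> or \<open>y\<close> for a \<open>v\<close> or exchange two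
letters.\<close>

definition word_order :: "(slh_gen list \<times> slh_gen list) set" where
  "word_order = measures [\<lambda>w. count_list w GU, \<lambda>w. count_list w GX + count_list w GY, disorder]"

lemma reduct_decreases:
  assumes "(c, u) \<in> set (reduct g h)"
  shows "(v @ u @ w, v @ [g, h] @ w) \<in> word_order"
proof -
  have "count_list u GU < count_list [g, h] GU \<or> count_list u GU = count_list [g, h] GU \<and>
     (count_list u GX + count_list u GY < count_list [g, h] GX + count_list [g, h] GY \<or>
      count_list u GX + count_list u GY = count_list [g, h] GX + count_list [g, h] GY \<and>
      length u = 2 \<and> sum_list (map rank u) = sum_list (map rank [g, h]) \<and> disorder u < disorder [g, h])"
    using assms by (cases g; cases h) auto
  then show ?thesis
    by (auto simp: word_order_def disorder_append distrib_right)
qed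

definition normal :: "slh_gen list \<Rightarrow> bool" where
  "normal = successively (\<lambda>g h. \<not> reducible g h)"

lemma not_normalE:
  assumes "\<not> normal w"
  obtains v g h w' where "w = v @ [g, h] @ w'" "reducible g h"
proof -
  have "\<exists>v g h w'. w = v @ [g, h] @ w' \<and> reducible g h"
    using assms unfolding normal_def
  proof (induction w rule: induct_list012)
    case (3 g h w)
    show ?case
    proof (cases "reducible g h")
      case True
      then show ?thesis by (intro exI[of _ "[]"]) auto
    next
      case False
      then obtain v k l w' where "h # w = v @ [k, l] @ w'" "reducible k l"
        using 3 by auto
      then show ?thesis by (intro exI[of _ "g # v"]) auto
    qed
  qed auto
  then show ?thesis using that by blast
qed

lemma wf_word_order: "wf word_order"
  by (simp add: word_order_def)

lemma monomial_in_span: "monomial w \<in> slh_module.span (monomial ` {w. normal w})"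
proof (induction w rule: wf_induct_rule[OF wf_word_order])
  case (1 w)
  let ?span = "slh_module.span (monomial ` {w. normal w})"
  show ?case
  proof (cases "normal w")
    case True
    then show ?thesis by (intro slh_module.span_base) auto
  next
    case False
    then obtain v g h w' where w: "w = v @ [g, h] @ w'" and red: "reducible g h"
      by (rule not_normalE)
    \<comment> \<open>Stated for all sublists of the reduct, so as to be proved by induction on the list.\<close>
    have "monomial v * (\<Sum>(c, u)\<leftarrow>T. sscal c * monomial u) * monomial w' \<in> ?span"
      if "set T \<subseteq> set (reduct g h)" for T
      using that
    proof (induction T)
      case Nil
      show ?case by (simp add: slh_module.span_zero)
    next
      case (Cons t T)
      obtain c u where t: "t = (c, u)" by (cases t)
      have "monomial (v @ u @ w') \<in> ?span"
        using Cons.prems unfolding w t by (intro 1[unfolded w] reduct_decreases) auto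
      then have "sscal c * monomial (v @ u @ w') \<in> ?span"
        by (rule slh_module.span_scale)
      moreover have "monomial v * (sscal c * monomial u) * monomial w' = sscal c * monomial (v @ u @ w')"
        by (simp add: mult.assoc) (metis mult.assoc sscal.sc_central)
      ultimately show ?case
        using Cons slh_module.span_add by (simp add: t distrib_left distrib_right)
    qed
    then have "monomial v * (slgen g * slgen h) * monomial w' \<in> ?span"
      unfolding reduct_eq[OF red] by blast
    then show ?thesis by (simp add: w mult.assoc)
  qed
qed

lemma span_normal: "a \<in> slh_module.span (monomial ` {w. normal w})"
proof -
  let ?span = "slh_module.span (monomial ` {w. normal w})"
  have gens: "abs_slh2 (Poly_Mapping.single (Word w) 1) = monomial w" for w
  proof (induction w)
    case Nil
    show ?case by (simp add: one_slh2.abs_eq flip: zero_word_def)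
  next
    case (Cons g w)
    have "(Poly_Mapping.single (Word (g # w)) 1 :: slh_free) = freegen g * Poly_Mapping.single (Word w) 1"
      by (simp add: freegen_def mult_single plus_word_def)
    then show ?case using Cons by (simp add: slgen.abs_eq flip: times_slh2.abs_eq)
  qed
  have "abs_slh2 p \<in> ?span" for p
  proof (induction p rule: poly_mapping_single_induct)
    case zero
    show ?case using slh_module.span_zero by (simp add: zero_slh2.abs_eq)
  next
    case (single k c)
    obtain w where k: "k = Word w" by (cases k)
    have "Poly_Mapping.single k c = freescal c * Poly_Mapping.single (Word w) 1"
      by (simp add: k freescal_def mult_single)
    then have "abs_slh2 (Poly_Mapping.single k c) = sscal c * monomial w"
      by (simp add: sscal.abs_eq flip: times_slh2.abs_eq gens)
    then show ?case using slh_module.span_scale[OF monomial_in_span] by simp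
  next
    case (add p q)
    then show ?case using slh_module.span_add by (simp flip: plus_slh2.abs_eq)
  qed
  then show ?thesis by (metis slh2_abs_cases)
qed

lemma normal_form:
  assumes "normal w"
  obtains a b c g where "g = GU \<or> g = GV" "w = replicate a GX @ replicate b GY @ replicate c g"
proof -
  have "\<exists>a b c g. (g = GU \<or> g = GV) \<and> w = replicate a GX @ replicate b GY @ replicate c g"
    using assms unfolding normal_def
  proof (induction w)
    case Nil
    show ?case by (intro exI[of _ 0] exI[of _ GU]) simp
  next
    case (Cons k w)
    have "successively (\<lambda>g h. \<not> reducible g h) w" using Cons.prems by (auto simp: successively_Cons)
    from Cons.IH[OF this] obtain a b c g
      where g: "g = GU \<or> g = GV" and w: "w = replicate a GX @ replicate b GY @ replicate c g"
      by blast
    have hd: "w = [] \<or> \<not> reducible k (hd w)" using Cons.prems by (auto simp: successively_Cons)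
    show ?case
    proof (cases k)
      case GX
      then show ?thesis using g by (intro exI[of _ "Suc a"] exI[of _ b] exI[of _ c] exI[of _ g]) (simp add: w)
    next
      case GY
      then have "a = 0" using hd by (cases a) (auto simp: w reducible_def)
      then show ?thesis using g GY by (intro exI[of _ 0] exI[of _ "Suc b"] exI[of _ c] exI[of _ g])
          (simp add: w)
    next
      case GU
      then have "a = 0" using hd by (cases a) (auto simp: w reducible_def)
      moreover from this have "b = 0" using hd GU by (cases b) (auto simp: w reducible_def)
      moreover from calculation have "c = 0 \<or> g = GU" using hd GU g by (cases c) (auto simp: w reducible_def)
      ultimately show ?thesis using GU by (intro exI[of _ 0] exI[of _ "Suc c"] exI[of _ GU]) (auto simp: w)
    next
      case GV
      then have "a = 0" using hd by (cases a) (auto simp: w reducible_def)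
      moreover from this have "b = 0" using hd GV by (cases b) (auto simp: w reducible_def)
      moreover from calculation have "c = 0 \<or> g = GV" using hd GV g by (cases c) (auto simp: w reducible_def)
      ultimately show ?thesis using GV by (intro exI[of _ 0] exI[of _ "Suc c"] exI[of _ GV]) (auto simp: w)
    qed
  qed
  then show ?thesis using that by blast
qed

text \<open>In \<open>x\<^sup>a y\<^sup>b u\<^sup>c\<close> or \<open>x\<^sup>a y\<^sup>b v\<^sup>c\<close> the length is \<open>a + b + c\<close>, the sum of the two weights is
\<open>a - b\<close>, and their difference is \<open>c\<close> for \<open>u\<close> and \<open>- c\<close> for \<open>v\<close>.\<close>

lemma inj_on_leading_normal: "inj_on leading {w. normal w}"
proof (rule inj_onI)
  fix w w' assume *: "w \<in> {w. normal w}" "w' \<in> {w. normal w}" "leading w = leading w'"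
  then have nw: "normal w" "normal w'" by simp_all
  obtain a b c g where w: "g = GU \<or> g = GV" "w = replicate a GX @ replicate b GY @ replicate c g"
    by (rule normal_form[OF nw(1)])
  obtain a' b' c' g' where w': "g' = GU \<or> g' = GV" "w' = replicate a' GX @ replicate b' GY @ replicate c' g'"
    by (rule normal_form[OF nw(2)])
  define s s' :: real where "s = (if g = GU then 1 else -1)" and "s' = (if g' = GU then 1 else -1)"
  have sum: "sum_list (map row_weight w) = (real a - real b + s * real c) / 2"
    "sum_list (map col_weight w) = (real a - real b - s * real c) / 2"
    unfolding w(2) using w(1) by (auto simp: sum_list_replicate s_def field_simps)
  have sum': "sum_list (map row_weight w') = (real a' - real b' + s' * real c') / 2"
    "sum_list (map col_weight w') = (real a' - real b' - s' * real c') / 2"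
    unfolding w'(2) using w'(1) by (auto simp: sum_list_replicate s'_def field_simps)
  have "length w = length w'" using *(3) by (simp add: leading_def)
  then have len: "real a + real b + real c = real a' + real b' + real c'"
    unfolding w(2) w'(2) by simp
  have "sum_list (map row_weight w) = sum_list (map row_weight w')"
    "sum_list (map col_weight w) = sum_list (map col_weight w')"
    using *(3) by (simp_all add: leading_def)
  then have eq: "real a - real b = real a' - real b'" "s * real c = s' * real c'"
    unfolding sum sum' by simp_all
  from eq(2) have c: "real c = real c'"
    unfolding s_def s'_def by (auto split: if_splits)
  have "a = a'" "b = b'" "c = c'" using len eq(1) c by linarith+
  moreover have "c = 0 \<or> g = g'" using eq(2) w(1) w'(1) unfolding s_def s'_def by (auto split: if_splits)
  ultimately show "w = w'" unfolding w(2) w'(2) by auto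
qed

lemma pairing_injective:
  assumes "\<And>X. pairing a X = pairing b X"
  shows "a = b"
proof -
  obtain T r where T: "finite T" "T \<subseteq> monomial ` {w. normal w}" "a - b = (\<Sum>t\<in>T. sscal (r t) * t)"
    using span_normal[of "a - b"] unfolding slh_module.span_explicit by blast
  \<comment> \<open>The span lemma gives a sum over elements; it is indexed by words from here on.\<close>
  obtain S where S: "S \<subseteq> {w. normal w}" "inj_on monomial S" "T = monomial ` S"
    using T(2) unfolding subset_image_inj by blast
  have "finite S" using T(1) S finite_imageD by blast
  have eq: "a - b = (\<Sum>w\<in>S. sscal (r (monomial w)) * monomial w)"
    by (simp add: T(3) S(3) sum.reindex[OF S(2)])
  have "\<forall>w\<in>S. r (monomial w) = 0"
  proof (rule monomials_independent[OF \<open>finite S\<close>])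
    show "inj_on leading S" using inj_on_leading_normal S(1) inj_on_subset by blast
    show "pairing (\<Sum>w\<in>S. sscal (r (monomial w)) * monomial w) X = 0" for X
      unfolding eq[symmetric] by (simp add: pairing_diff assms)
  qed
  then have "a - b = 0" unfolding eq by (simp add: sscal.sc_0)
  then show ?thesis by simp
qed

section \<open>The \<open>D\<close>-functions\<close>

lemma pairing_slreal: "pairing (slreal r * a) X = fps_real r * pairing a X"
  by (simp add: slreal_def pairing_sscal fps_real_def)

lemma pairing_slh: "pairing (slh * a) X = fps_X * pairing a X"
  by (simp add: slh_def pairing_sscal)

lemma slreal_left: "a * (slreal r * b) = slreal r * (a * b)"
  unfolding slreal_def by (metis mult.assoc sscal.sc_central)

lemma slh_left: "a * (slh * b) = slh * (a * b)"
  unfolding slh_def by (metis mult.assoc sscal.sc_central)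

lemma pairing_letters:
  "pairing (a * slx) X = pairing a (right_slice True True X)"
  "pairing (a * slu) X = pairing a (right_slice True False X)"
  "pairing (a * slv) X = pairing a (right_slice False True X)"
  "pairing (a * sly) X = pairing a (right_slice False False X)"
  using pairing_slgen[of a True True X] pairing_slgen[of a True False X]
    pairing_slgen[of a False True X] pairing_slgen[of a False False X]
  by (simp_all add: entry_def)

text \<open>The combinations of generators on the right-hand sides of the recurrences are those that undo one
half of the conjugation by the twist, or all of it.\<close>

lemma pairing_mult_letters:
  assumes e: "\<And>X. pairing e X = spin_coeff l p q X"
  shows "pairing (e * slx) X = htensor_coeff l p True q True X - fps_X * fps_real (2 * p) * htensor_coeff l p
      False q True X"
    "pairing (e * slv) X = htensor_coeff l p False q True X"
    "pairing (e * sly) X = htensor_coeff l p False q False X + fps_X * fps_real (2 * q) * htensor_coeff l p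
        False q True X"
    "pairing (e * (slx + slreal (2 * p) * slh * slv)) X = htensor_coeff l p True q True X"
    "pairing (e * (sly - slreal (2 * q) * slh * slv)) X = htensor_coeff l p False q False X"
    "pairing (e * (slu + slreal (2 * p) * slh * sly)) X
      = htensor_coeff l p True q False X + fps_X * fps_real (2 * q) * htensor_coeff l p True q True X"
    "pairing (e * (slu - slreal (2 * q) * slh * slx)) X
      = htensor_coeff l p True q False X - fps_X * fps_real (2 * p) * htensor_coeff l p False q False X"
  by (simp_all add: distrib_left right_diff_distrib mult.assoc slreal_left[of e] slh_left[of e]
      pairing_add pairing_diff pairing_slreal pairing_slh pairing_letters e spin_coeff_right_slice)

lemma htensor_coeff_represented:
  assumes e: "\<And>X. pairing e X = spin_coeff l p q X"
  shows "\<exists>a. \<forall>X. pairing a X = htensor_coeff l p c q d X"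
proof -
  have "pairing (e * (slu + slreal (2 * p) * slh * sly)
      - slh * (slreal (2 * q) * (e * (slx + slreal (2 * p) * slh * slv)))) X
          = htensor_coeff l p True q False X" for X
    by (simp add: pairing_diff pairing_slh pairing_slreal pairing_mult_letters[OF e] mult.assoc[of "fps_X"])
  then have "\<exists>a. \<forall>X. pairing a X = htensor_coeff l p True q False X" by blast
  moreover have "\<exists>a. \<forall>X. pairing a X = htensor_coeff l p False q True X"
    "\<exists>a. \<forall>X. pairing a X = htensor_coeff l p True q True X"
    "\<exists>a. \<forall>X. pairing a X = htensor_coeff l p False q False X"
    using pairing_mult_letters(2,4,5)[OF e] by blast+
  ultimately show ?thesis by (cases c; cases d) simp_all
qed

text \<open>For \<open>p\<close> a weight of spin \<open>j > 0\<close>, one of the two coefficients in the Clebsch-Gordan relation with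
\<open>l = j - 1/2\<close> is nonzero, so that relation expresses the matrix element through products of matrix
elements of spin \<open>l\<close> with generators.\<close>

lemma spin_coeff_represented: "\<exists>a. \<forall>X. pairing a X = spin_coeff j p q X"
proof (cases "p \<in> weights j \<and> q \<in> weights j")
  case True
  obtain a b where "j + p = real a" "j - p = real b" using True by (auto simp: weights_def Nats_def)
  then have "j = real (a + b) / 2" by simp
  then obtain n where "j = real n / 2" by blast
  then show ?thesis
  proof (induction n arbitrary: j p q)
    case 0
    show ?case
    proof (cases "p = 0 \<and> q = 0")
      case True
      then show ?thesis using 0 pairing_1 by (auto simp: counit_spin_coeff)
    next
      case False
      then have "\<forall>X. pairing 0 X = spin_coeff j p q X"
        using 0 by (auto simp: spin_coeff_outside weights_0)
      then show ?thesis by blast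
    qed
  next
    case (Suc n)
    let ?l = "j - half True"
    have l: "?l = real n / 2" using Suc.prems by (simp add: add_divide_distrib)
    have rep: "\<exists>a. \<forall>X. pairing a X = htensor_coeff ?l (p - half c) c (q - half d) d X" for c d
    proof -
      obtain e where "\<And>X. pairing e X = spin_coeff ?l (p - half c) (q - half d) X"
        using Suc.IH[OF l] by blast
      then show ?thesis by (rule htensor_coeff_represented)
    qed
    show ?case
    proof (cases "p \<in> weights j")
      case True
      have "0 \<le> j + p" "0 \<le> j - p" using weights_bounds[OF True] by simp_all
      moreover have "0 < j" using Suc.prems by simp
      ultimately have "cg True j True p \<noteq> 0 \<or> cg True j False p \<noteq> 0" by (auto simp: cg_def)
      then obtain c where c: "cg True j c p \<noteq> 0" by blast
      obtain a b where ab: "\<And>X. pairing a X = htensor_coeff ?l (p - half c) c (q - half True) True X"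
        "\<And>X. pairing b X = htensor_coeff ?l (p - half c) c (q - half False) False X"
        using rep by metis
      let ?e = "slreal (1 / cg True j c p) * (slreal (cg True j True q) * a + slreal (cg True j False q) * b)"
      have "pairing ?e X = spin_coeff j p q X" for X
      proof -
        have "pairing ?e X = fps_real (1 / cg True j c p) * (fps_real (cg True j c p) * spin_coeff j p q X)"
          using htensor_coeff_row[of True j q "p - half c" c X]
          by (simp add: pairing_slreal pairing_add ab UNIV_bool add.commute)
        also have "\<dots> = fps_real (1 / cg True j c p * cg True j c p) * spin_coeff j p q X"
          by (simp only: mult.assoc flip: fps_real_mult)
        finally show ?thesis using c by (simp add: fps_real_def)
      qed
      then show ?thesis by blast
    next
      case False
      then have "\<forall>X. pairing 0 X = spin_coeff j p q X" by (simp add: spin_coeff_outside)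
      then show ?thesis by blast
    qed
  qed
next
  case False
  then have "\<forall>X. pairing 0 X = spin_coeff j p q X" by (auto simp: spin_coeff_outside)
  then show ?thesis by blast
qed

lemma pairing_dfun: "pairing (dfun j p q) X = spin_coeff j p q X"
proof (cases "p \<in> weights j \<and> q \<in> weights j")
  case True
  obtain a where a: "\<forall>X. pairing a X = spin_coeff j p q X"
    using spin_coeff_represented by blast
  then have "\<exists>!a. \<forall>X. pairing a X = spin_coeff j p q X"
    by (metis pairing_injective)
  from theI'[OF this] show ?thesis using True by (simp add: dfun_def)
qed (auto simp: dfun_def spin_coeff_outside)

section \<open>The recurrence relations\<close>

lemmas pairing_simps = pairing_add pairing_diff pairing_slreal pairing_slh mult.assoc

text \<open>The row of weight \<open>+1/2\<close> of the Clebsch-Gordan relation. In it \<open>u - (2m + 1) h x\<close> leaves the part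
\<open>- (2k - 1) h\<close> of the twist, which multiplies the row of weight \<open>-1/2\<close>; that row is the term with
\<open>k - 1\<close>. The booleans select \<open>l = j - 1/2\<close> or \<open>l = j + 1/2\<close> in this and the following relations.\<close>

lemma recurrence_row_upper:
  "slreal (cg up j True k) * dfun j k m
     - slreal (2 * k - 1) * slh * slreal (cg up j False (k - 1)) * dfun j (k - 1) m
   = slreal (cg up j True m) * dfun (j - half up) (k - 1/2) (m - 1/2) * slx
     + slreal (cg up j False m) * dfun (j - half up) (k - 1/2) (m + 1/2)
         * (slu - slreal (2 * m + 1) * slh * slx)"
proof (rule pairing_injective)
  fix X
  have "2 * (k - 1/2) = 2 * k - 1" "2 * (m + 1/2) = 2 * m + 1" by simp_all
  note L = pairing_mult_letters[OF pairing_dfun, of "j - half up" "k - 1/2" "m - 1/2" X, unfolded this]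
    pairing_mult_letters[OF pairing_dfun, of "j - half up" "k - 1/2" "m + 1/2" X, unfolded this]
  have T: "fps_real (cg up j True k) * spin_coeff j k m X = fps_real (cg up j True m) * htensor_coeff (j
      - half up) (k - 1/2) True (m - 1/2) True X
      + fps_real (cg up j False m) * htensor_coeff (j - half up) (k - 1/2) True (m + 1/2) False X"
    "fps_real (cg up j False (k - 1)) * spin_coeff j (k - 1) m X
      = fps_real (cg up j True m) * htensor_coeff (j - half up) (k - 1/2) False (m - 1/2) True X
      + fps_real (cg up j False m) * htensor_coeff (j - half up) (k - 1/2) False (m + 1/2) False X"
    using htensor_coeff_row[of up j m "k - 1/2" True X] htensor_coeff_row[of up j m "k - 1/2" False X]
    by (simp_all add: UNIV_bool add.commute)
  show "pairing (slreal (cg up j True k) * dfun j k m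
     - slreal (2 * k - 1) * slh * slreal (cg up j False (k - 1)) * dfun j (k - 1) m) X
   = pairing (slreal (cg up j True m) * dfun (j - half up) (k - 1/2) (m - 1/2) * slx
     + slreal (cg up j False m) * dfun (j - half up) (k - 1/2) (m + 1/2)
         * (slu - slreal (2 * m + 1) * slh * slx)) X"
    by (simp only: pairing_simps pairing_dfun T L[unfolded mult.assoc]) (simp add: algebra_simps)
qed

lemma recurrence_row_lower:
  "slreal (cg up j False k) * dfun j k m
   = slreal (cg up j True m) * dfun (j - half up) (k + 1/2) (m - 1/2) * slv
     + slreal (cg up j False m) * dfun (j - half up) (k + 1/2) (m + 1/2)
         * (sly - slreal (2 * m + 1) * slh * slv)"
proof (rule pairing_injective)
  fix X
  have "2 * (m + 1/2) = 2 * m + 1" by simp_all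
  note L = pairing_mult_letters[OF pairing_dfun, of "j - half up" "k + 1/2" "m - 1/2" X]
    pairing_mult_letters[OF pairing_dfun, of "j - half up" "k + 1/2" "m + 1/2" X, unfolded this]
  have T: "fps_real (cg up j False k) * spin_coeff j k m X
      = fps_real (cg up j True m) * htensor_coeff (j - half up) (k + 1/2) False (m - 1/2) True X
      + fps_real (cg up j False m) * htensor_coeff (j - half up) (k + 1/2) False (m + 1/2) False X"
    using htensor_coeff_row[of up j m "k + 1/2" False X]
    by (simp add: UNIV_bool add.commute)
  show "pairing (slreal (cg up j False k) * dfun j k m) X
   = pairing (slreal (cg up j True m) * dfun (j - half up) (k + 1/2) (m - 1/2) * slv
     + slreal (cg up j False m) * dfun (j - half up) (k + 1/2) (m + 1/2)
         * (sly - slreal (2 * m + 1) * slh * slv)) X"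
    by (simp only: pairing_simps pairing_dfun T L[unfolded mult.assoc])
qed

lemma recurrence_column_left:
  "slreal (cg up j True n) * dfun j m n
   = slreal (cg up j True m) * dfun (j - half up) (m - 1/2) (n - 1/2)
         * (slx + slreal (2 * m - 1) * slh * slv)
     + slreal (cg up j False m) * dfun (j - half up) (m + 1/2) (n - 1/2) * slv"
proof (rule pairing_injective)
  fix X
  have "2 * (m - 1/2) = 2 * m - 1" by simp_all
  note L = pairing_mult_letters[OF pairing_dfun, of "j - half up" "m - 1/2" "n - 1/2" X, unfolded this]
    pairing_mult_letters[OF pairing_dfun, of "j - half up" "m + 1/2" "n - 1/2" X]
  have T: "fps_real (cg up j True n) * spin_coeff j m n X
      = fps_real (cg up j True m) * htensor_coeff (j - half up) (m - 1/2) True (n - 1/2) True X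
      + fps_real (cg up j False m) * htensor_coeff (j - half up) (m + 1/2) False (n - 1/2) True X"
    using htensor_coeff_column[of up j m "n - 1/2" True X]
    by (simp add: UNIV_bool add.commute)
  show "pairing (slreal (cg up j True n) * dfun j m n) X
   = pairing (slreal (cg up j True m) * dfun (j - half up) (m - 1/2) (n - 1/2)
         * (slx + slreal (2 * m - 1) * slh * slv)
     + slreal (cg up j False m) * dfun (j - half up) (m + 1/2) (n - 1/2) * slv) X"
    by (simp only: pairing_simps pairing_dfun T L[unfolded mult.assoc])
qed

text \<open>Here it is the column of weight \<open>+1/2\<close>, taken at \<open>n + 1\<close>, that is added by the twist.\<close>

lemma recurrence_column_right:
  "slreal (cg up j False n) * dfun j m n
     + slreal (cg up j True (n + 1)) * slreal (2 * n + 1) * slh * dfun j m (n + 1)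
   = slreal (cg up j True m) * dfun (j - half up) (m - 1/2) (n + 1/2)
         * (slu + slreal (2 * m - 1) * slh * sly)
     + slreal (cg up j False m) * dfun (j - half up) (m + 1/2) (n + 1/2) * sly"
proof (rule pairing_injective)
  fix X
  have "2 * (m - 1/2) = 2 * m - 1" "2 * (n + 1/2) = 2 * n + 1" by simp_all
  note L = pairing_mult_letters[OF pairing_dfun, of "j - half up" "m - 1/2" "n + 1/2" X, unfolded this]
    pairing_mult_letters[OF pairing_dfun, of "j - half up" "m + 1/2" "n + 1/2" X, unfolded this]
  have T: "fps_real (cg up j False n) * spin_coeff j m n X
      = fps_real (cg up j True m) * htensor_coeff (j - half up) (m - 1/2) True (n + 1/2) False X
      + fps_real (cg up j False m) * htensor_coeff (j - half up) (m + 1/2) False (n + 1/2) False X"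
    "fps_real (cg up j True (n + 1)) * spin_coeff j m (n + 1) X
      = fps_real (cg up j True m) * htensor_coeff (j - half up) (m - 1/2) True (n + 1/2) True X
      + fps_real (cg up j False m) * htensor_coeff (j - half up) (m + 1/2) False (n + 1/2) True X"
    using htensor_coeff_column[of up j m "n + 1/2" False X] htensor_coeff_column[of up j m "n + 1/2" True X]
    by (simp_all add: UNIV_bool add.commute)
  have "fps_real (cg up j True (n + 1)) * (fps_real (2 * n + 1) * (fps_X * spin_coeff j m (n + 1) X))
      = fps_X * (fps_real (2 * n + 1) * (fps_real (cg up j True (n + 1)) * spin_coeff j m (n + 1) X))"
    by (simp only: mult_ac)
  note T = T(1) this[unfolded T(2)]
  show "pairing (slreal (cg up j False n) * dfun j m n
     + slreal (cg up j True (n + 1)) * slreal (2 * n + 1) * slh * dfun j m (n + 1)) X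
   = pairing (slreal (cg up j True m) * dfun (j - half up) (m - 1/2) (n + 1/2)
         * (slu + slreal (2 * m - 1) * slh * sly)
     + slreal (cg up j False m) * dfun (j - half up) (m + 1/2) (n + 1/2) * sly) X"
    by (simp only: pairing_simps pairing_dfun T L[unfolded mult.assoc]) (simp add: algebra_simps)
qed

lemma slreal_uminus: "slreal (- r) = - slreal r"
  by (simp add: slreal_def sscal_uminus flip: fps_const_neg)

theorem proposition3p5:
  fixes j :: real
  assumes "2 * j \<in> \<nat>"
  shows
    "(j \<ge> 1/2 \<longrightarrow>
      (\<forall>k\<in>weights j. \<forall>m\<in>weights j.
         slreal (sqrt (j + k)) * dfun j k m
           - slreal (2 * k - 1) * slh * slreal (sqrt (j - k + 1)) * dfun j (k - 1) m
         = slreal (sqrt (j + m)) * dfun (j - 1/2) (k - 1/2) (m - 1/2) * slx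
           + slreal (sqrt (j - m)) * dfun (j - 1/2) (k - 1/2) (m + 1/2)
               * (slu - slreal (2 * m + 1) * slh * slx))
    \<and> (\<forall>k\<in>weights j. \<forall>m\<in>weights j.
         slreal (sqrt (j - k)) * dfun j k m
         = slreal (sqrt (j + m)) * dfun (j - 1/2) (k + 1/2) (m - 1/2) * slv
           + slreal (sqrt (j - m)) * dfun (j - 1/2) (k + 1/2) (m + 1/2)
               * (sly - slreal (2 * m + 1) * slh * slv))
    \<and> (\<forall>m\<in>weights j. \<forall>n\<in>weights j.
         slreal (sqrt (j + n)) * dfun j m n
         = slreal (sqrt (j + m)) * dfun (j - 1/2) (m - 1/2) (n - 1/2)
               * (slx + slreal (2 * m - 1) * slh * slv)
           + slreal (sqrt (j - m)) * dfun (j - 1/2) (m + 1/2) (n - 1/2) * slv)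
    \<and> (\<forall>m\<in>weights j. \<forall>n\<in>weights j.
         slreal (sqrt (j - n)) * dfun j m n
           + slreal (sqrt (j + n + 1)) * slreal (2 * n + 1) * slh * dfun j m (n + 1)
         = slreal (sqrt (j + m)) * dfun (j - 1/2) (m - 1/2) (n + 1/2)
               * (slu + slreal (2 * m - 1) * slh * sly)
           + slreal (sqrt (j - m)) * dfun (j - 1/2) (m + 1/2) (n + 1/2) * sly))
    \<and> (\<forall>k\<in>weights j. \<forall>m\<in>weights j.
         slreal (sqrt (j - k + 1)) * dfun j k m
           + slreal (2 * k - 1) * slh * slreal (sqrt (j + k)) * dfun j (k - 1) m
         = slreal (sqrt (j - m + 1)) * dfun (j + 1/2) (k - 1/2) (m - 1/2) * slx
           - slreal (sqrt (j + m + 1)) * dfun (j + 1/2) (k - 1/2) (m + 1/2)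
               * (slu - slreal (2 * m + 1) * slh * slx))
    \<and> (\<forall>k\<in>weights j. \<forall>m\<in>weights j.
         slreal (sqrt (j + k + 1)) * dfun j k m
         = - (slreal (sqrt (j - m + 1)) * dfun (j + 1/2) (k + 1/2) (m - 1/2) * slv)
           + slreal (sqrt (j + m + 1)) * dfun (j + 1/2) (k + 1/2) (m + 1/2)
               * (sly - slreal (2 * m + 1) * slh * slv))
    \<and> (\<forall>m\<in>weights j. \<forall>n\<in>weights j.
         slreal (sqrt (j - n + 1)) * dfun j m n
         = slreal (sqrt (j - m + 1)) * dfun (j + 1/2) (m - 1/2) (n - 1/2)
               * (slx + slreal (2 * m - 1) * slh * slv)
           - slreal (sqrt (j + m + 1)) * dfun (j + 1/2) (m + 1/2) (n - 1/2) * slv)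
    \<and> (\<forall>m\<in>weights j. \<forall>n\<in>weights j.
         slreal (sqrt (j + n + 1)) * dfun j m n
           - slreal (sqrt (j - n)) * slreal (2 * n + 1) * slh * dfun j m (n + 1)
         = - (slreal (sqrt (j - m + 1)) * dfun (j + 1/2) (m - 1/2) (n + 1/2)
                * (slu + slreal (2 * m - 1) * slh * sly))
           + slreal (sqrt (j + m + 1)) * dfun (j + 1/2) (m + 1/2) (n + 1/2) * sly)"
proof -
  have cg_up: "cg True j True k = sqrt (j + k)" "cg True j False k = sqrt (j - k)"
    and cg_down: "cg False j True k = sqrt (j - k + 1)" "cg False j False k = - sqrt (j + k + 1)" for k
    by (simp_all add: cg_def)
  have shift: "j - (k - 1) = j - k + 1" "j + (k - 1) + 1 = j + k" "j - (k + 1) + 1 = j - k"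
    "j + (k + 1) = j + k + 1" "j - half True = j - 1/2" "j - half False = j + 1/2" for k
    by simp_all
  note up = recurrence_row_upper[of True j] recurrence_row_lower[of True j]
    recurrence_column_left[of True j] recurrence_column_right[of True j]
  note down = recurrence_row_upper[of False j] recurrence_row_lower[of False j]
    recurrence_column_left[of False j] recurrence_column_right[of False j]
  note up = up[unfolded cg_up shift]
  note down = down[unfolded cg_down shift slreal_uminus mult_minus_left mult_minus_right
      diff_minus_eq_add add_uminus_conv_diff]
  \<comment> \<open>For \<open>l = j + 1/2\<close> the coefficient of weight \<open>-1/2\<close> is negative, so the two relations with this
    coefficient on the left come with all signs reversed.\<close>
  have negate: "a = - b + c" if "- a = b - c" for a b c :: slh2
    using that by (metis minus_diff_eq minus_minus uminus_add_conv_diff)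
  have negate': "a - d = - b + c" if "- a + d = b - c" for a b c d :: slh2
    by (rule negate) (simp add: that[symmetric])
  show ?thesis
    by (intro conjI impI ballI) (rule up down negate[OF down(2)] negate'[OF down(4)])+
qed

end
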